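(* Assume the Continuum Hypothesis. There exists a stable union ultrafilter $u$ on $\mathbb{F}$ with $\min(u)$ and $\max(u)$ selective, such that there exists $FU(\mathbf{s})\in u$ with the property that for every ordered sequence $\mathbf{t}$, if $\mathbf{t}\sqsubseteq\mathbf{s}$ then $FU(\mathbf{t})\notin u$. Moreover, for any two non-isomorphic selective ultrafilters $p_1,p_2$ on $\omega$, such $u$ can be found with $\min(u)=p_1$ and $\max(u)=p_2$.
   Context: $\mathbb{F}$ denotes the set of nonempty finite subsets of $\omega$, a partial semigroup under $s\cdot t=s\cup t$ defined only when $s\cap t=\emptyset$. For $s,t\in\mathbb{F}$ write $s<t$ iff $\max(s)<\min(t)$; a sequence $(x_i)$ is ordered if $x_i<x_j$ whenever $i<j$. For a sequence $\mathbf{x}=(x_i)_{i<N}$ ($N\le\omega$) of pairwise disjoint elements of $\mathbb{F}$, $FU(\mathbf{x})=\{\bigcup_{i\in v}x_i : v \text{ a nonempty finite subset of } N\}$. $\mathbf{y}\sqsubseteq\mathbf{x}$ means $FU(\mathbf{y})\subseteq FU(\mathbf{x})$; $\mathbf{y}\sqsubseteq^*\mathbf{x}$ means some tail of $\mathbf{y}$ satisfies this. An ultrafilter $u$ on $\mathbb{F}$ is a union ultrafilter if every member contains some $FU(\mathbf{x})\in u$ with $\mathbf{x}$ an infinite sequence of pairwise disjoint elements of $\mathbb{F}$; it is stable if for every sequence $(FU(\mathbf{s}^\alpha))_{\alpha<\omega}$ in $u$ there is $FU(\mathbf{t})\in u$ with $\mathbf{t}\sqsubseteq^*\mathbf{s}^\alpha$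 for all $\alpha$. For an ultrafilter $u$ on $\mathbb{F}$, $\min(u)=\{A\subseteq\omega:\{x\in\mathbb{F}:\min x\in A\}\in u\}$ and $\max(u)$ is defined analogously. A selective (Ramsey) ultrafilter is a nonprincipal ultrafilter $p$ on $\omega$ such that for every partition of $\omega$ into pieces not in $p$ there is a set in $p$ meeting each piece in at most one point. Two ultrafilters on $\omega$ are isomorphic if some bijection of $\omega$ maps one onto the other. *)

theory Defs
  imports Main "HOL-Library.Extended_Nat" "HOL-Library.Disjoint_Sets"
begin

unbundle cardinal_syntax

text \<open>The Continuum Hypothesis, as \<open>2 ^ \<aleph>\<^sub>0 = \<aleph>\<^sub>1\<close>.\<close>

definition continuum_hypothesis :: bool where
  "continuum_hypothesis \<longleftrightarrow> |UNIV :: nat set set| =o cardSuc natLeq"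

text \<open>Families of sets are used instead of the type \<open>'a filter\<close> because some of the
  ultrafilters below live on a proper subset of their type.\<close>

definition ultrafilter_on :: "'a set \<Rightarrow> 'a set set \<Rightarrow> bool" where
  "ultrafilter_on X U \<longleftrightarrow>
     U \<subseteq> Pow X \<and> X \<in> U \<and> {} \<notin> U \<and>
     (\<forall>A\<in>U. \<forall>B. A \<subseteq> B \<and> B \<subseteq> X \<longrightarrow> B \<in> U) \<and>
     (\<forall>A\<in>U. \<forall>B\<in>U. A \<inter> B \<in> U) \<and>
     (\<forall>A. A \<subseteq> X \<longrightarrow> A \<in> U \<or> X - A \<in> U)"

definition principal_on :: "'a set \<Rightarrow> 'a set set \<Rightarrow> bool" where
  "principal_on X U \<longleftrightarrow> (\<exists>a\<in>X. U = {A. A \<subseteq> X \<and> a \<in> A})"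

definition selective :: "nat set set \<Rightarrow> bool" where
  "selective p \<longleftrightarrow>
     ultrafilter_on UNIV p \<and> \<not> principal_on UNIV p \<and>
     (\<forall>P. partition_on UNIV P \<and> (\<forall>A\<in>P. A \<notin> p) \<longrightarrow>
        (\<exists>B\<in>p. \<forall>A\<in>P. \<exists>\<^sub>\<le>\<^sub>1n. n \<in> A \<inter> B))"

definition isomorphic_uf :: "nat set set \<Rightarrow> nat set set \<Rightarrow> bool" where
  "isomorphic_uf p q \<longleftrightarrow> (\<exists>f :: nat \<Rightarrow> nat. bij f \<and> q = (\<lambda>A. f ` A) ` p)"

definition FF :: "nat set set" where
  "FF = {s. finite s \<and> s \<noteq> {}}"

definition before :: "nat set \<Rightarrow> nat set \<Rightarrow> bool" where
  "before s t \<longleftrightarrow> Max s < Min t"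

text \<open>A sequence \<open>(x\<^sub>i)\<close> with \<open>i < N \<le> \<omega>\<close> is given by its length \<open>N\<close>, an extended
  natural number, and a function of which only the values at \<open>i < N\<close> matter.\<close>

definition disjoint_seq :: "enat \<Rightarrow> (nat \<Rightarrow> nat set) \<Rightarrow> bool" where
  "disjoint_seq N x \<longleftrightarrow>
     (\<forall>i. enat i < N \<longrightarrow> x i \<in> FF) \<and> disjoint_family_on x {i. enat i < N}"

definition ordered_seq :: "enat \<Rightarrow> (nat \<Rightarrow> nat set) \<Rightarrow> bool" where
  "ordered_seq N x \<longleftrightarrow>
     (\<forall>i. enat i < N \<longrightarrow> x i \<in> FF) \<and>
     (\<forall>i j. i < j \<and> enat j < N \<longrightarrow> before (x i) (x j))"

definition FU :: "enat \<Rightarrow> (nat \<Rightarrow> nat set) \<Rightarrow> nat set set" where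
  "FU N x = {\<Union>i\<in>v. x i | v. finite v \<and> v \<noteq> {} \<and> (\<forall>i\<in>v. enat i < N)}"

definition condensation :: "enat \<Rightarrow> (nat \<Rightarrow> nat set) \<Rightarrow> enat \<Rightarrow> (nat \<Rightarrow> nat set) \<Rightarrow> bool" where
  "condensation M y N x \<longleftrightarrow> FU M y \<subseteq> FU N x"

definition almost_condensation :: "enat \<Rightarrow> (nat \<Rightarrow> nat set) \<Rightarrow> enat \<Rightarrow> (nat \<Rightarrow> nat set) \<Rightarrow> bool" where
  "almost_condensation M y N x \<longleftrightarrow> (\<exists>m. condensation (M - enat m) (\<lambda>i. y (m + i)) N x)"

definition union_ultrafilter :: "nat set set set \<Rightarrow> bool" where
  "union_ultrafilter u \<longleftrightarrow>
     ultrafilter_on FF u \<and>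
     (\<forall>A\<in>u. \<exists>x. disjoint_seq \<infinity> x \<and> FU \<infinity> x \<in> u \<and> FU \<infinity> x \<subseteq> A)"

definition stable_union_ultrafilter :: "nat set set set \<Rightarrow> bool" where
  "stable_union_ultrafilter u \<longleftrightarrow>
     union_ultrafilter u \<and>
     (\<forall>(N :: nat \<Rightarrow> enat) (s :: nat \<Rightarrow> nat \<Rightarrow> nat set).
        (\<forall>\<alpha>. disjoint_seq (N \<alpha>) (s \<alpha>) \<and> FU (N \<alpha>) (s \<alpha>) \<in> u) \<longrightarrow>
        (\<exists>M t. disjoint_seq M t \<and> FU M t \<in> u \<and> (\<forall>\<alpha>. almost_condensation M t (N \<alpha>) (s \<alpha>))))"

definition min_uf :: "nat set set set \<Rightarrow> nat set set" where
  "min_uf u = {A. {x \<in> FF. Min x \<in> A} \<in> u}"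

definition max_uf :: "nat set set set \<Rightarrow> nat set set" where
  "max_uf u = {A. {x \<in> FF. Max x \<in> A} \<in> u}"

end

theory Submission
  imports Defs "HOL-Library.Countable_Set_Type" "HOL-Library.Infinite_Set" "HOL-Library.Nat_Bijection"
begin

text \<open>Let \<open>p\<^sub>1\<close>, \<open>p\<^sub>2\<close> be non-isomorphic selective ultrafilters and let \<open>D\<close> be an infinite set that is
  small for both. Let the initial family \<open>S\<close> consist of the singletons off \<open>D\<close> and of pairs
  contained in \<open>D\<close>; the pairs are organised in finite blocks \<open>B\<^sub>n\<close> of \<open>n\<close> pairs each, any two of
  which interleave. Two members of an ordered condensation of \<open>S\<close> therefore never meet the same
  block. A tower of length \<open>\<omega>\<^sub>1\<close> of infinite disjoint families \<open>T\<close> below \<open>S\<close> is built so that the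
  minima of \<open>T\<close> form a set in \<open>p\<^sub>1\<close>, the maxima a set in \<open>p\<^sub>2\<close>, and the number of members of \<open>T\<close>
  that meet a common block is unbounded; it generates the required ultrafilter.

  The one-step extension combines two ingredients. Call a set large if it contains, for every
  \<open>k\<close>, all unions of some \<open>k\<close> disjoint sets meeting a common block. Largeness is partition regular
  (Folkman's theorem), and the ultrafilters of large sets with minimum \<open>p\<^sub>1\<close> and maximum \<open>p\<^sub>2\<close> form a
  closed semigroup; an idempotent in it decides any given partition. A fusion then diagonalises
  against countably many members of the idempotent: since \<open>p\<^sub>1\<close>, \<open>p\<^sub>2\<close> are selective and
  non-isomorphic, they contain sets \<open>X\<close>, \<open>Y\<close> whose union is so sparse that the prescribed minima
  and maxima can be played along the increasing enumeration of \<open>X \<union> Y\<close>.\<close>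

section \<open>Filters and idempotent ultrafilters\<close>

text \<open>A condition must contain several sets that meet one block, so it cannot be ordered; the
  fusion therefore adds finite unordered batches, and only the batches come one after another.
  Pigeonhole alone would give \<open>k\<close> disjoint sets meeting a block inside one half of a
  partition; largeness asks for all their unions because a condition acts through its finite unions.

  Three requirements have to survive products of ultrafilters. For \<open>x\<close> before
  \<open>y\<close> the union takes its minimum from \<open>x\<close>, its maximum from
  \<open>y\<close>, and still meets every block that \<open>x\<close> meets; this is why minimum,
  maximum and blocks can be kept together.

  Minima and maxima are prescribed in one common increasing run, so a point of \<open>X\<close> must
  be far not only from the other points of \<open>X\<close> but also from those of \<open>Y\<close>.
  A bijection carrying \<open>p1\<close> to \<open>p2\<close> could tie each point of
  \<open>X\<close> to a nearby point of \<open>Y\<close>; non-isomorphism excludes this. The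
  Continuum Hypothesis enters through the fusion, which handles only countably many earlier
  conditions.\<close>

definition proper_filter :: "'a set set \<Rightarrow> bool" where
  "proper_filter F \<longleftrightarrow> UNIV \<in> F \<and> {} \<notin> F \<and>
     (\<forall>A\<in>F. \<forall>B. A \<subseteq> B \<longrightarrow> B \<in> F) \<and> (\<forall>A\<in>F. \<forall>B\<in>F. A \<inter> B \<in> F)"

abbreviation ultra :: "'a set set \<Rightarrow> bool" where
  "ultra \<equiv> ultrafilter_on UNIV"

lemma ultra_iff: "ultra v \<longleftrightarrow> proper_filter v \<and> (\<forall>A. A \<in> v \<or> - A \<in> v)"
  by (simp add: ultrafilter_on_def proper_filter_def Compl_eq_Diff_UNIV)

lemma filter_mono: "proper_filter F \<Longrightarrow> A \<in> F \<Longrightarrow> A \<subseteq> B \<Longrightarrow> B \<in> F"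
  by (simp add: proper_filter_def)

lemma filter_Int: "proper_filter F \<Longrightarrow> A \<in> F \<Longrightarrow> B \<in> F \<Longrightarrow> A \<inter> B \<in> F"
  by (simp add: proper_filter_def)

lemma ultra_filter: "ultra v \<Longrightarrow> proper_filter v"
  by (simp add: ultra_iff)

lemma ultra_mono: "ultra v \<Longrightarrow> A \<in> v \<Longrightarrow> A \<subseteq> B \<Longrightarrow> B \<in> v"
  by (meson filter_mono ultra_filter)

lemma ultra_Int: "ultra v \<Longrightarrow> A \<in> v \<Longrightarrow> B \<in> v \<Longrightarrow> A \<inter> B \<in> v"
  by (meson filter_Int ultra_filter)

lemma ultra_UNIV: "ultra v \<Longrightarrow> UNIV \<in> v"
  by (simp add: ultrafilter_on_def)

lemma ultra_nonempty: "ultra v \<Longrightarrow> A \<in> v \<Longrightarrow> A \<noteq> {}"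
  by (auto simp: ultrafilter_on_def)

lemma ultra_Compl: "ultra v \<Longrightarrow> - A \<in> v \<longleftrightarrow> A \<notin> v"
  by (metis Compl_disjoint ultra_Int ultra_iff ultra_nonempty)

lemma ultra_INT:
  assumes "ultra v" "finite I" "\<And>i. i \<in> I \<Longrightarrow> A i \<in> v"
  shows "(\<Inter>i\<in>I. A i) \<in> v"
  using assms(2,3) by (induction I) (auto simp: assms(1) ultra_UNIV ultra_Int)

lemma ultra_Un:
  assumes "ultra v" "A \<union> B \<in> v"
  shows "A \<in> v \<or> B \<in> v"
proof (rule ccontr)
  assume "\<not> ?thesis"
  then have "- A \<inter> - B \<in> v" using assms(1) by (simp add: ultra_Compl ultra_Int)
  then show False using assms ultra_Compl[of v "A \<union> B"] by simp
qed

lemma ultra_subset_eq: "ultra v \<Longrightarrow> ultra w \<Longrightarrow> v \<subseteq> w \<Longrightarrow> v = w"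
  by (metis subsetD subsetI subset_antisym ultra_Compl)

lemma filter_Union_chain:
  assumes "\<C> \<noteq> {}" "chain\<^sub>\<subseteq> \<C>" "\<And>F. F \<in> \<C> \<Longrightarrow> proper_filter F"
  shows "proper_filter (\<Union>\<C>)"
  unfolding proper_filter_def
proof (intro conjI ballI allI impI)
  show "UNIV \<in> \<Union>\<C>" using assms(1,3) by (auto simp: proper_filter_def)
  show "{} \<notin> \<Union>\<C>" using assms(3) by (auto simp: proper_filter_def)
  show "B \<in> \<Union>\<C>" if "A \<in> \<Union>\<C>" "A \<subseteq> B" for A B
    using that assms(3) filter_mono by (metis Union_iff)
  show "A \<inter> B \<in> \<Union>\<C>" if AB: "A \<in> \<Union>\<C>" "B \<in> \<Union>\<C>" for A B
  proof -
    obtain F G where FG: "F \<in> \<C>" "A \<in> F" "G \<in> \<C>" "B \<in> G" using AB by auto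
    then have "F \<subseteq> G \<or> G \<subseteq> F" using assms(2) by (auto simp: chain_subset_def)
    then show ?thesis using FG assms(3) filter_Int by (metis UnionI subsetD)
  qed
qed

lemma filter_generated:
  assumes "\<B> \<noteq> {}" "{} \<notin> \<B>"
    and dir: "\<And>A B. A \<in> \<B> \<Longrightarrow> B \<in> \<B> \<Longrightarrow> \<exists>C\<in>\<B>. C \<subseteq> A \<inter> B"
  shows "proper_filter {X. \<exists>A\<in>\<B>. A \<subseteq> X}"
  unfolding proper_filter_def
proof (intro conjI ballI allI impI)
  fix X Y assume "X \<in> {X. \<exists>A\<in>\<B>. A \<subseteq> X}" "Y \<in> {X. \<exists>A\<in>\<B>. A \<subseteq> X}"
  then obtain A B where AB: "A \<in> \<B>" "B \<in> \<B>" "A \<subseteq> X" "B \<subseteq> Y" by blast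
  then obtain C where "C \<in> \<B>" "C \<subseteq> A \<inter> B" using dir by blast
  then have "C \<subseteq> X \<inter> Y" using AB by blast
  then show "X \<inter> Y \<in> {X. \<exists>A\<in>\<B>. A \<subseteq> X}" using \<open>C \<in> \<B>\<close> by blast
next
  show "UNIV \<in> {X. \<exists>A\<in>\<B>. A \<subseteq> X}" using assms(1) by blast
  show "{} \<notin> {X. \<exists>A\<in>\<B>. A \<subseteq> X}" using assms(2) by simp
  show "Y \<in> {X. \<exists>A\<in>\<B>. A \<subseteq> X}" if "X \<in> {X. \<exists>A\<in>\<B>. A \<subseteq> X}" "X \<subseteq> Y" for X Y
    using that by (blast intro: subset_trans)
qed

text \<open>The explicit form of \<open>G\<close> is part of the conclusion because the proof of
  idempotence must show that this particular filter is a subsemigroup, which needs a handle on each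
  of its members.\<close>

lemma filter_extend:
  assumes F: "proper_filter F" and "\<W> \<noteq> {}"
    and int: "\<And>A B. A \<in> \<W> \<Longrightarrow> B \<in> \<W> \<Longrightarrow> A \<inter> B \<in> \<W>"
    and pos: "\<And>A. A \<in> \<W> \<Longrightarrow> - A \<notin> F"
  obtains G where "proper_filter G" "F \<subseteq> G" "\<W> \<subseteq> G" "G = {X. \<exists>A\<in>\<W>. \<exists>C\<in>F. A \<inter> C \<subseteq> X}"
proof -
  let ?B = "{A \<inter> C | A C. A \<in> \<W> \<and> C \<in> F}"
  let ?G = "{X. \<exists>A\<in>?B. A \<subseteq> X}"
  have UF: "UNIV \<in> F" using F by (simp add: proper_filter_def)
  have G: "proper_filter ?G"
  proof (rule filter_generated)
    have "UNIV \<in> F" using F by (simp add: proper_filter_def)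
    then show "?B \<noteq> {}" using assms(2) by blast
    show "{} \<notin> ?B"
    proof
      assume "{} \<in> ?B"
      then obtain A C where AC: "A \<in> \<W>" "C \<in> F" "A \<inter> C = {}" by blast
      then have "C \<subseteq> - A" by blast
      then show False using filter_mono[OF F AC(2)] pos[OF AC(1)] by blast
    qed
    fix X Y assume "X \<in> ?B" "Y \<in> ?B"
    then obtain A C A' C' where *: "A \<in> \<W>" "C \<in> F" "X = A \<inter> C" "A' \<in> \<W>" "C' \<in> F" "Y = A' \<inter> C'"
      by blast
    then have "A \<inter> A' \<in> \<W>" "C \<inter> C' \<in> F" using int filter_Int[OF F] by simp_all
    then have "(A \<inter> A') \<inter> (C \<inter> C') \<in> ?B" by blast
    moreover have "(A \<inter> A') \<inter> (C \<inter> C') \<subseteq> X \<inter> Y" using * by blast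
    ultimately show "\<exists>C\<in>?B. C \<subseteq> X \<inter> Y" by (rule rev_bexI)
  qed
  show thesis
  proof (rule that[OF G])
    show G_eq: "?G = {X. \<exists>A\<in>\<W>. \<exists>C\<in>F. A \<inter> C \<subseteq> X}"
    proof (intro set_eqI iffI)
      fix X assume "X \<in> {X. \<exists>A\<in>\<W>. \<exists>C\<in>F. A \<inter> C \<subseteq> X}"
      then obtain A C where "A \<in> \<W>" "C \<in> F" "A \<inter> C \<subseteq> X" by blast
      then show "X \<in> ?G" by (intro CollectI bexI[of _ "A \<inter> C"]) blast+
    qed blast
    obtain A0 where "A0 \<in> \<W>" using assms(2) by blast
    then show "F \<subseteq> ?G" unfolding G_eq by (blast intro: Int_lower2)
    show "\<W> \<subseteq> ?G" unfolding G_eq using UF by (blast intro: Int_lower1)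
  qed
qed

lemma filter_extend_single:
  assumes "proper_filter F" "- A \<notin> F"
  obtains G where "proper_filter G" "F \<subseteq> G" "A \<in> G"
proof (rule filter_extend[OF assms(1), of "{A}"])
  show "thesis" if "proper_filter G" "F \<subseteq> G" "{A} \<subseteq> G" for G
    using \<open>\<And>G. proper_filter G \<Longrightarrow> F \<subseteq> G \<Longrightarrow> A \<in> G \<Longrightarrow> thesis\<close>[of G] that by simp
qed (use assms(2) in simp_all)

lemma ultrafilter_extends:
  assumes "proper_filter F"
  obtains v where "ultra v" "F \<subseteq> v"
proof -
  have "\<exists>M\<in>{G. proper_filter G \<and> F \<subseteq> G}. \<forall>X\<in>{G. proper_filter G \<and> F \<subseteq> G}. M \<subseteq> X \<longrightarrow> X = M"
  proof (rule subset_Zorn_nonempty)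
    show "{G. proper_filter G \<and> F \<subseteq> G} \<noteq> {}" using assms by auto
    fix \<C> assume "\<C> \<noteq> {}" and C: "subset.chain {G. proper_filter G \<and> F \<subseteq> G} \<C>"
    then have "proper_filter (\<Union>\<C>)"
      by (intro filter_Union_chain) (auto simp: chain_subset_def subset_chain_def)
    then show "\<Union>\<C> \<in> {G. proper_filter G \<and> F \<subseteq> G}"
      using C \<open>\<C> \<noteq> {}\<close> unfolding subset_chain_def by blast
  qed
  then obtain v where v: "proper_filter v" "F \<subseteq> v"
    and max: "\<And>G. proper_filter G \<Longrightarrow> F \<subseteq> G \<Longrightarrow> v \<subseteq> G \<Longrightarrow> G = v" by auto
  have "A \<in> v" if neg: "- A \<notin> v" for A
  proof -
    obtain G where "proper_filter G" "v \<subseteq> G" "A \<in> G"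
      using filter_extend_single[OF v(1) neg] .
    then show ?thesis using max[of G] v(2) by auto
  qed
  then show thesis using that v by (auto simp: ultra_iff)
qed

section \<open>The Ellis-Numakura theorem, with filters in place of closed sets of
  ultrafilters\<close>

context semigroup
begin

definition shift :: "'a set \<Rightarrow> 'a set set \<Rightarrow> 'a set" where
  "shift A w = {x. {y. x \<^bold>* y \<in> A} \<in> w}"

text \<open>The usual extension of the operation to ultrafilters, with \<open>v\<close> as the outer
  quantifier: for \<open>v\<close>-most \<open>x\<close> and \<open>w\<close>-most \<open>y\<close>
  the product lies in \<open>A\<close>.\<close>

definition uprod :: "'a set set \<Rightarrow> 'a set set \<Rightarrow> 'a set set" where
  "uprod v w = {A. shift A w \<in> v}"

text \<open>The closed set of ultrafilters extending \<open>F\<close> is a subsemigroup.\<close>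

definition subsemi :: "'a set set \<Rightarrow> bool" where
  "subsemi F \<longleftrightarrow> (\<forall>v w. ultra v \<longrightarrow> ultra w \<longrightarrow> F \<subseteq> v \<longrightarrow> F \<subseteq> w \<longrightarrow> F \<subseteq> uprod v w)"

lemma subsemiD: "subsemi F \<Longrightarrow> ultra v \<Longrightarrow> ultra w \<Longrightarrow> F \<subseteq> v \<Longrightarrow> F \<subseteq> w \<Longrightarrow> F \<subseteq> uprod v w"
  by (simp add: subsemi_def)

lemma shift_simps:
  assumes "ultra w"
  shows "shift (A \<inter> B) w = shift A w \<inter> shift B w" "shift (- A) w = - shift A w"
    "shift UNIV w = UNIV" "shift {} w = {}"
proof -
  have "{y. x \<^bold>* y \<in> A \<inter> B} \<in> w \<longleftrightarrow> {y. x \<^bold>* y \<in> A} \<in> w \<and> {y. x \<^bold>* y \<in> B} \<in> w" for x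
  proof -
    have "{y. x \<^bold>* y \<in> A \<inter> B} = {y. x \<^bold>* y \<in> A} \<inter> {y. x \<^bold>* y \<in> B}" by blast
    then show ?thesis
      using ultra_Int[OF assms, of "{y. x \<^bold>* y \<in> A}" "{y. x \<^bold>* y \<in> B}"]
        ultra_mono[OF assms _ Int_lower1, of "{y. x \<^bold>* y \<in> A}" "{y. x \<^bold>* y \<in> B}"]
        ultra_mono[OF assms _ Int_lower2, of "{y. x \<^bold>* y \<in> A}" "{y. x \<^bold>* y \<in> B}"]
      by auto
  qed
  then show "shift (A \<inter> B) w = shift A w \<inter> shift B w" by (auto simp: shift_def)
  show "shift (- A) w = - shift A w"
  proof -
    have "{y. x \<^bold>* y \<in> - A} = - {y. x \<^bold>* y \<in> A}" for x by blast
    then show ?thesis unfolding shift_def using ultra_Compl[OF assms] by auto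
  qed
  show "shift UNIV w = UNIV" "shift {} w = {}"
    using assms ultra_UNIV ultra_nonempty[of w "{}"] by (auto simp: shift_def)
qed

lemma shift_mono: "ultra w \<Longrightarrow> A \<subseteq> B \<Longrightarrow> shift A w \<subseteq> shift B w"
  using ultra_mono[of w "{y. _ \<^bold>* y \<in> A}" "{y. _ \<^bold>* y \<in> B}"] by (auto simp: shift_def)

lemma ultra_uprod:
  assumes v: "ultra v" and w: "ultra w"
  shows "ultra (uprod v w)"
  unfolding ultra_iff proper_filter_def
proof (intro conjI ballI allI impI)
  show "UNIV \<in> uprod v w" "{} \<notin> uprod v w"
    using v by (auto simp: uprod_def shift_simps[OF w] ultra_UNIV dest: ultra_nonempty)
  show "B \<in> uprod v w" if "A \<in> uprod v w" "A \<subseteq> B" for A B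
    using that ultra_mono[OF v _ shift_mono[OF w]] by (simp add: uprod_def)
  show "A \<inter> B \<in> uprod v w" if "A \<in> uprod v w" "B \<in> uprod v w" for A B
    using that by (simp add: uprod_def shift_simps[OF w] ultra_Int[OF v])
  show "A \<in> uprod v w \<or> - A \<in> uprod v w" for A
    by (simp add: uprod_def shift_simps[OF w] ultra_Compl[OF v])
qed

lemma uprod_assoc: "uprod (uprod u v) w = uprod u (uprod v w)"
  by (simp add: uprod_def shift_def assoc)

text \<open>Let \<open>K\<close> be the closed set of ultrafilters extending \<open>F\<close>. The
  filter \<open>{A. shift A v \<in> F}\<close> describes the set \<open>K v\<close> of all
  \<open>uprod w v\<close> with \<open>w\<close> in \<open>K\<close>; it is again a closed
  subsemigroup, and it lies inside \<open>K\<close>.\<close>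

lemma subsemi_fixed_left:
  assumes F: "proper_filter F" "subsemi F" and v: "ultra v" "F \<subseteq> v"
  shows "proper_filter {A. shift A v \<in> F}" "subsemi {A. shift A v \<in> F}" "F \<subseteq> {A. shift A v \<in> F}"
proof -
  let ?G = "{A. shift A v \<in> F}"
  show G: "proper_filter ?G"
    unfolding proper_filter_def
  proof (intro conjI ballI allI impI)
    show "UNIV \<in> ?G" "{} \<notin> ?G"
      using F(1) by (simp_all add: shift_simps[OF v(1)] proper_filter_def)
    show "B \<in> ?G" if "A \<in> ?G" "A \<subseteq> B" for A B
      using that filter_mono[OF F(1) _ shift_mono[OF v(1)]] by simp
    show "A \<inter> B \<in> ?G" if "A \<in> ?G" "B \<in> ?G" for A B
      using that by (simp add: shift_simps[OF v(1)] filter_Int[OF F(1)])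
  qed
  \<comment> \<open>Compactness: the shifts of the members of \<open>w\<close> are compatible with
    \<open>F\<close>, so some ultrafilter \<open>w'\<close> over \<open>F\<close> contains them all,
    and then \<open>w\<close> is \<open>uprod w' v\<close>.\<close>
  have *: "\<exists>w'. ultra w' \<and> F \<subseteq> w' \<and> w = uprod w' v" if w: "ultra w" "?G \<subseteq> w" for w
  proof -
    obtain H where H: "proper_filter H" "F \<subseteq> H" "(\<lambda>A. shift A v) ` w \<subseteq> H"
    proof (rule filter_extend[OF F(1)])
      show "(\<lambda>A. shift A v) ` w \<noteq> {}" using ultra_UNIV[OF w(1)] by blast
      show "A \<inter> B \<in> (\<lambda>A. shift A v) ` w"
        if "A \<in> (\<lambda>A. shift A v) ` w" "B \<in> (\<lambda>A. shift A v) ` w" for A B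
        using that ultra_Int[OF w(1)] by (auto simp: shift_simps(1)[OF v(1), symmetric])
      fix B assume "B \<in> (\<lambda>A. shift A v) ` w"
      then obtain A where A: "A \<in> w" "B = shift A v" by blast
      show "- B \<notin> F"
      proof
        assume "- B \<in> F"
        then have "- A \<in> ?G" using A v(1) by (simp add: shift_simps)
        then show False using A w ultra_Compl by blast
      qed
    qed
    from H(1) obtain w' where w': "ultra w'" "H \<subseteq> w'" by (rule ultrafilter_extends)
    have "F \<subseteq> w'" using w'(2) H(2) by blast
    moreover have "w \<subseteq> uprod w' v" using H(3) w'(2) by (auto simp: uprod_def)
    ultimately show ?thesis
      using ultra_subset_eq[OF w(1) ultra_uprod[OF w'(1) v(1)]] w'(1) by blast
  qed
  show "subsemi ?G"
    unfolding subsemi_def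
  proof (intro allI impI)
    fix w1 w2 assume w: "ultra w1" "ultra w2" "?G \<subseteq> w1" "?G \<subseteq> w2"
    obtain w1' where w1: "ultra w1'" "F \<subseteq> w1'" "w1 = uprod w1' v" using *[OF w(1,3)] by auto
    obtain w2' where w2: "ultra w2'" "F \<subseteq> w2'" "w2 = uprod w2' v" using *[OF w(2,4)] by auto
    \<comment> \<open>Reassociate: the product of \<open>w1' v\<close> and \<open>w2' v\<close> is
      \<open>w1' (v w2')\<close> times \<open>v\<close>, and the left factor again extends
      \<open>F\<close>.\<close>
    have "F \<subseteq> uprod w1' (uprod v w2')"
      using subsemiD[OF F(2) w1(1) ultra_uprod[OF v(1) w2(1)] w1(2)] subsemiD[OF F(2) v(1) w2(1) v(2) w2(2)]
      by blast
    then have "?G \<subseteq> uprod (uprod w1' (uprod v w2')) v" by (auto simp: uprod_def)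
    then show "?G \<subseteq> uprod w1 w2" by (simp add: w1 w2 uprod_assoc)
  qed
  show "F \<subseteq> ?G"
  proof (rule ccontr)
    assume "\<not> F \<subseteq> ?G"
    then obtain A where A: "A \<in> F" "shift A v \<notin> F" by auto
    then have "- (- shift A v) \<notin> F" by simp
    then obtain H where H: "proper_filter H" "F \<subseteq> H" "- shift A v \<in> H"
      using filter_extend_single[OF F(1)] by blast
    from H(1) obtain w where w: "ultra w" "H \<subseteq> w" by (rule ultrafilter_extends)
    then have "F \<subseteq> w" "- shift A v \<in> w" using H by auto
    moreover have "shift A v \<in> w"
      using subsemiD[OF F(2) w(1) v(1) \<open>F \<subseteq> w\<close> v(2)] A(1) by (auto simp: uprod_def)
    ultimately show False using w(1) by (simp add: ultra_Compl)
  qed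
qed

text \<open>A maximal filter \<open>M\<close> describes a minimal closed subsemigroup
  \<open>K\<close>. For any \<open>v\<close> in \<open>K\<close>, the set \<open>K v\<close> is a
  closed subsemigroup inside \<open>K\<close>, hence all of it, so \<open>v = w v\<close> for some
  \<open>w\<close> in \<open>K\<close>. These \<open>w\<close> form a closed subsemigroup too, hence
  again all of \<open>K\<close>, and \<open>v\<close> itself is among them.\<close>

lemma idempotent_ultrafilter_extends:
  assumes F: "proper_filter F" "subsemi F"
  obtains v where "ultra v" "F \<subseteq> v" "uprod v v = v"
proof -
  let ?P = "{G. proper_filter G \<and> subsemi G \<and> F \<subseteq> G}"
  have "\<exists>M\<in>?P. \<forall>X\<in>?P. M \<subseteq> X \<longrightarrow> X = M"
  proof (rule subset_Zorn_nonempty)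
    show "?P \<noteq> {}" using assms by auto
    fix \<C> assume ne: "\<C> \<noteq> {}" and C: "subset.chain ?P \<C>"
    then have "proper_filter (\<Union>\<C>)"
      by (intro filter_Union_chain) (auto simp: chain_subset_def subset_chain_def)
    moreover have "G \<subseteq> uprod v w"
      if "G \<in> \<C>" "ultra v" "ultra w" "\<Union>\<C> \<subseteq> v" "\<Union>\<C> \<subseteq> w" for G v w
    proof -
      have "subsemi G" "G \<subseteq> v" "G \<subseteq> w" using C that by (auto simp: subset_chain_def)
      then show ?thesis using that(2,3) by (simp add: subsemi_def)
    qed
    then have "subsemi (\<Union>\<C>)"
      unfolding subsemi_def by (intro allI impI Union_least)
    moreover obtain G where "G \<in> \<C>" using ne by blast
    then have "F \<subseteq> \<Union>\<C>" using C by (auto simp: subset_chain_def)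
    ultimately show "\<Union>\<C> \<in> ?P" by simp
  qed
  then obtain M where M: "proper_filter M" "subsemi M" "F \<subseteq> M"
    and max: "\<And>G. proper_filter G \<Longrightarrow> subsemi G \<Longrightarrow> M \<subseteq> G \<Longrightarrow> G = M"
  proof -
    assume *: "\<And>M. proper_filter M \<Longrightarrow> subsemi M \<Longrightarrow> F \<subseteq> M \<Longrightarrow>
      (\<And>G. proper_filter G \<Longrightarrow> subsemi G \<Longrightarrow> M \<subseteq> G \<Longrightarrow> G = M) \<Longrightarrow> thesis"
    assume "\<exists>M\<in>?P. \<forall>X\<in>?P. M \<subseteq> X \<longrightarrow> X = M"
    then obtain M where "M \<in> ?P" "\<forall>X\<in>?P. M \<subseteq> X \<longrightarrow> X = M" by (rule bexE)
    then show thesis using *[of M] subset_trans[of F M] by simp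
  qed
  obtain v where v: "ultra v" "M \<subseteq> v" using ultrafilter_extends[OF M(1)] .
  have Mv: "{A. shift A v \<in> M} = M"
    using max[OF subsemi_fixed_left[OF M(1,2) v]] .
  \<comment> \<open>\<open>G\<close> describes the \<open>w\<close> over \<open>M\<close> with
    \<open>uprod w v = v\<close>. It is proper because a failure would put the complement of a
    member of \<open>v\<close> into \<open>M\<close> by \<open>Mv\<close>.\<close>
  obtain G where G: "proper_filter G" "M \<subseteq> G" "(\<lambda>A. shift A v) ` v \<subseteq> G"
    "G = {B. \<exists>A\<in>(\<lambda>A. shift A v) ` v. \<exists>C\<in>M. A \<inter> C \<subseteq> B}"
  proof (rule filter_extend[OF M(1)])
    show "(\<lambda>A. shift A v) ` v \<noteq> {}" using ultra_UNIV[OF v(1)] by blast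
    show "A \<inter> B \<in> (\<lambda>A. shift A v) ` v"
      if "A \<in> (\<lambda>A. shift A v) ` v" "B \<in> (\<lambda>A. shift A v) ` v" for A B
      using that ultra_Int[OF v(1)] by (auto simp: shift_simps(1)[OF v(1), symmetric])
    fix B assume "B \<in> (\<lambda>A. shift A v) ` v"
    then obtain A where A: "A \<in> v" "B = shift A v" by blast
    show "- B \<notin> M"
    proof
      assume "- B \<in> M"
      then have "- A \<in> {A. shift A v \<in> M}" using A(2) by (simp add: shift_simps[OF v(1)])
      then have "- A \<in> M" unfolding Mv .
      then show False using A v ultra_Compl by blast
    qed
  qed
  have "subsemi G"
    unfolding subsemi_def
  proof (intro allI impI)
    fix w1 w2 assume w: "ultra w1" "ultra w2" "G \<subseteq> w1" "G \<subseteq> w2"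
    have fix_v: "uprod w v = v" if "ultra w" "G \<subseteq> w" for w
    proof -
      have "v \<subseteq> uprod w v" using that(2) G(3) by (auto simp: uprod_def)
      then show ?thesis using ultra_subset_eq[OF v(1) ultra_uprod[OF that(1) v(1)]] by simp
    qed
    have fx: "uprod (uprod w1 w2) v = v"
      using fix_v[OF w(1,3)] fix_v[OF w(2,4)] by (simp add: uprod_assoc)
    have M12: "M \<subseteq> uprod w1 w2"
      using subsemiD[OF M(2) w(1,2)] G(2) w(3,4) by (meson subset_trans)
    show "G \<subseteq> uprod w1 w2"
    proof
      fix B assume "B \<in> G"
      then obtain A C where AC: "A \<in> v" "C \<in> M" "shift A v \<inter> C \<subseteq> B" unfolding G(4) by blast
      have "A \<in> uprod (uprod w1 w2) v" using AC(1) unfolding fx .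
      then have "shift A v \<in> uprod w1 w2" by (simp add: uprod_def[of "uprod w1 w2" v])
      then have "shift A v \<inter> C \<in> uprod w1 w2"
        using ultra_Int[OF ultra_uprod[OF w(1,2)]] M12 AC(2) by blast
      then show "B \<in> uprod w1 w2" by (rule ultra_mono[OF ultra_uprod[OF w(1,2)] _ AC(3)])
    qed
  qed
  then have "G = M" using max[OF G(1) _ G(2)] by simp
  then have "v \<subseteq> uprod v v" using v(2) G(3) by (auto simp: uprod_def)
  then have "uprod v v = v" using ultra_subset_eq[OF v(1) ultra_uprod[OF v(1) v(1)]] by simp
  then show thesis using that[OF v(1)] v(2) M(3) by blast
qed

end

section \<open>Selective ultrafilters\<close>

text \<open>Selectivity applied to the partition into the fibres of \<open>f\<close>.\<close>

lemma selective_fun: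
  fixes f :: "nat \<Rightarrow> nat"
  assumes "selective p"
  obtains (const) B c where "B \<in> p" "\<And>x. x \<in> B \<Longrightarrow> f x = c"
  | (inj) B where "B \<in> p" "inj_on f B"
proof (cases "\<exists>c. f -` {c} \<in> p")
  case True
  then show thesis using const by auto
next
  case False
  let ?P = "(\<lambda>c. f -` {c}) ` range f"
  have "partition_on UNIV ?P"
    by (auto simp: partition_on_def disjoint_def)
  moreover have "\<forall>A\<in>?P. A \<notin> p" using False by auto
  ultimately obtain B where B: "B \<in> p" "\<forall>A\<in>?P. \<exists>\<^sub>\<le>\<^sub>1n. n \<in> A \<inter> B"
    using assms unfolding selective_def by blast
  have "inj_on f B"
  proof (rule inj_onI)
    fix x y assume "x \<in> B" "y \<in> B" "f x = f y"
    moreover have "\<exists>\<^sub>\<le>\<^sub>1n. n \<in> f -` {f x} \<inter> B" using B(2) by blast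
    ultimately show "x = y" unfolding Uniq_def by simp
  qed
  then show thesis using inj B(1) by blast
qed

lemma selectiveI:
  assumes p: "ultra p" and np: "\<not> principal_on UNIV p"
    and f: "\<And>f :: nat \<Rightarrow> nat. \<exists>B\<in>p. (\<exists>c. \<forall>x\<in>B. f x = c) \<or> inj_on f B"
  shows "selective p"
  unfolding selective_def
proof (intro conjI p np allI impI)
  fix P assume P: "partition_on UNIV P \<and> (\<forall>A\<in>P. A \<notin> p)"
  \<comment> \<open>The least element of a piece serves as its name, so that a function into the
    naturals encodes the partition.\<close>
  define f :: "nat \<Rightarrow> nat" where "f x = (LEAST y. \<exists>A\<in>P. x \<in> A \<and> y \<in> A)" for x
  have f_eq: "f x = (LEAST y. y \<in> A)" if "A \<in> P" "x \<in> A" for A x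
  proof -
    have "A' = A" if "A' \<in> P" "x \<in> A'" for A'
      using that \<open>A \<in> P\<close> \<open>x \<in> A\<close> P by (auto simp: partition_on_def disjoint_def)
    then show ?thesis unfolding f_def using that by metis
  qed
  have cov: "\<exists>A\<in>P. x \<in> A" for x using P by (auto simp: partition_on_def)
  obtain B where B: "B \<in> p" "(\<exists>c. \<forall>x\<in>B. f x = c) \<or> inj_on f B" using f by blast
  have "inj_on f B"
  proof (rule ccontr)
    assume "\<not> inj_on f B"
    then obtain c where c: "\<forall>x\<in>B. f x = c" using B(2) by blast
    obtain x where x: "x \<in> B" using B(1) ultra_nonempty[OF p] by blast
    then obtain A where A: "A \<in> P" "x \<in> A" using cov by blast
    have "B \<subseteq> A"
    proof
      fix y assume y: "y \<in> B"
      then obtain A' where A': "A' \<in> P" "y \<in> A'" using cov by blast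
      have "f x \<in> A" using f_eq[OF A] A(2) by (metis LeastI)
      moreover have "f y \<in> A'" using f_eq[OF A'] A'(2) by (metis LeastI)
      moreover have "f x = f y" using c x y by simp
      ultimately have "A = A'" using P A(1) A'(1) by (auto simp: partition_on_def disjoint_def)
      then show "y \<in> A" using A' by simp
    qed
    then show False using ultra_mono[OF p B(1)] P A(1) by blast
  qed
  moreover have "\<exists>\<^sub>\<le>\<^sub>1n. n \<in> A \<inter> B" if "A \<in> P" "inj_on f B" for A
    unfolding Uniq_def
  proof (intro allI impI)
    fix x y assume "x \<in> A \<inter> B" "y \<in> A \<inter> B"
    then show "x = y" using f_eq[OF that(1), of x] f_eq[OF that(1), of y] that(2)
      by (auto simp: inj_on_def)
  qed
  ultimately show "\<exists>B\<in>p. \<forall>A\<in>P. \<exists>\<^sub>\<le>\<^sub>1n. n \<in> A \<inter> B" using B(1) by blast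
qed

lemma nonprincipal_finite:
  assumes p: "ultra p" and np: "\<not> principal_on UNIV p" and "finite A"
  shows "A \<notin> p"
proof
  assume "A \<in> p"
  have "\<exists>a. {a} \<in> p" using \<open>finite A\<close> \<open>A \<in> p\<close>
  proof (induction A)
    case empty
    then show ?case using ultra_nonempty[OF p] by blast
  next
    case (insert a A)
    then show ?case using ultra_Un[OF p, of "{a}" A] by auto
  qed
  then obtain a where a: "{a} \<in> p" by blast
  have "p = {A. A \<subseteq> UNIV \<and> a \<in> A}"
  proof (intro set_eqI iffI)
    fix A assume "A \<in> p"
    then have "{a} \<inter> A \<noteq> {}" using ultra_Int[OF p a] ultra_nonempty[OF p] by blast
    then show "A \<in> {A. A \<subseteq> UNIV \<and> a \<in> A}" by simp
  next
    fix A assume "A \<in> {A. A \<subseteq> UNIV \<and> a \<in> A}"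
    then show "A \<in> p" using ultra_mono[OF p a, of A] by simp
  qed
  then show False using np unfolding principal_on_def by blast
qed

lemma selective_ultra: "selective p \<Longrightarrow> ultra p"
  by (simp add: selective_def)

lemma selective_infinite: "selective p \<Longrightarrow> A \<in> p \<Longrightarrow> infinite A"
  using nonprincipal_finite[of p A] by (auto simp: selective_def)

lemma selective_Diff_finite:
  assumes "selective p" "A \<in> p" "finite N"
  shows "A - N \<in> p"
proof -
  have "- N \<in> p"
    using assms selective_infinite ultra_Compl selective_ultra by metis
  then show ?thesis
    using ultra_Int[OF selective_ultra[OF assms(1)] assms(2)] by (simp add: Diff_eq)
qed

lemma selective_greater:
  assumes "selective p"
  shows "{m::nat<..} \<in> p"
proof -
  have "UNIV - {..m} \<in> p"
    using assms selective_Diff_finite ultra_UNIV selective_ultra by blast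
  moreover have "UNIV - {..m} = {m<..}" by auto
  ultimately show ?thesis by simp
qed

text \<open>Selective ultrafilters are P-points. Send a point to the first \<open>a n\<close> that
  it leaves. A set in \<open>p\<close> cannot have a constant exit \<open>n\<close>, since it would
  be disjoint from \<open>a n\<close>; and if the exit is injective, only finitely many points have
  left by stage \<open>n\<close>.\<close>

lemma selective_pseudo_intersection:
  assumes p: "selective p" and a: "\<And>n::nat. a n \<in> p"
  obtains X where "X \<in> p" "\<And>n. finite (X - a n)"
proof -
  \<comment> \<open>The value 0 is reserved for the points lying in every \<open>a n\<close>, hence
    the \<open>Suc\<close>.\<close>
  let ?f = "\<lambda>x. if \<forall>n. x \<in> a n then 0 else Suc (LEAST n. x \<notin> a n)"
  have pf: "ultra p" using p by (rule selective_ultra)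
  show thesis
    using p
  proof (cases rule: selective_fun[where f = ?f])
    case (const B c)
    show thesis
    proof (cases c)
      case 0
      have "x \<in> a n" if "x \<in> B" for x n
        using const(2)[OF that] 0 by (metis nat.distinct(1))
      then have "B \<subseteq> a n" for n by blast
      then show thesis using that[of B] const(1) by (metis Diff_eq_empty_iff finite.emptyI)
    next
      case (Suc k)
      have "B \<inter> a k = {}"
      proof (rule equals0I)
        fix x assume x: "x \<in> B \<inter> a k"
        then have "?f x = Suc k" using const(2) Suc by blast
        then have "\<not> (\<forall>n. x \<in> a n)" "(LEAST n. x \<notin> a n) = k" by (auto split: if_splits)
        then have "x \<notin> a k" using LeastI_ex[of "\<lambda>n. x \<notin> a n"] by auto
        then show False using x by simp
      qed
      then show thesis using ultra_Int[OF pf const(1) a] ultra_nonempty[OF pf] by blast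
    qed
  next
    case (inj B)
    have "finite (B - a n)" for n
    proof (rule finite_imageD)
      have "?f x \<le> Suc n" if "x \<in> B - a n" for x
        using that Least_le[of "\<lambda>n. x \<notin> a n" n] by auto
      then have "?f ` (B - a n) \<subseteq> {..Suc n}" by blast
      then show "finite (?f ` (B - a n))" by (rule finite_subset) simp
      show "inj_on ?f (B - a n)" using inj(2) by (rule inj_on_subset) blast
    qed
    then show thesis using that inj(1) by blast
  qed
qed

lemma selective_finite_to_one:
  fixes f :: "nat \<Rightarrow> nat"
  assumes p: "selective p" and f: "\<And>c. finite (f -` {c})"
  obtains X where "X \<in> p" "inj_on f X"
  using p
proof (cases rule: selective_fun[where f = f])
  case (const B c)
  then have "B \<subseteq> f -` {c}" by auto
  then show thesis using const(1) f selective_infinite[OF p] finite_subset by metis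
qed (use that in blast)

lemma infinite_split:
  assumes "infinite (A :: nat set)"
  obtains B C where "A = B \<union> C" "B \<inter> C = {}" "infinite B" "infinite C"
proof -
  let ?e = "enumerate A"
  have inj: "inj ?e" using assms by (simp add: strict_mono_enumerate strict_mono_imp_inj_on)
  have r: "range ?e = A" using assms by (rule range_enumerate)
  show thesis
  proof (rule that[of "?e ` {n. even n}" "?e ` {n. odd n}"])
    show "A = ?e ` {n. even n} \<union> ?e ` {n. odd n}" using r by (auto simp: image_iff)
    show "?e ` {n. even n} \<inter> ?e ` {n. odd n} = {}" using inj by (auto simp: inj_def)
    have "infinite {n::nat. even n}" "infinite {n::nat. odd n}"
    proof -
      have "\<exists>n\<ge>m. even n" "\<exists>n\<ge>m. odd n" for m :: nat
        by (rule exI[of _ "2 * m"], simp) (rule exI[of _ "Suc (2 * m)"], simp)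
      then show "infinite {n::nat. even n}" "infinite {n::nat. odd n}"
        by (simp_all add: infinite_nat_iff_unbounded_le)
    qed
    then show "infinite (?e ` {n. even n})" "infinite (?e ` {n. odd n})"
      using inj by (auto simp: finite_image_iff inj_on_subset)
  qed
qed

lemma ultra_image_bij:
  assumes p: "ultra p" and f: "bij (f :: nat \<Rightarrow> nat)"
  shows "ultra ((\<lambda>A. f ` A) ` p)"
  unfolding ultra_iff proper_filter_def
proof (intro conjI ballI allI impI)
  show "UNIV \<in> (\<lambda>A. f ` A) ` p" using ultra_UNIV[OF p] f by (metis bij_is_surj image_eqI)
  show "{} \<notin> (\<lambda>A. f ` A) ` p" using ultra_nonempty[OF p] by blast
  show "B \<in> (\<lambda>A. f ` A) ` p" if A: "A \<in> (\<lambda>A. f ` A) ` p" "A \<subseteq> B" for A B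
  proof -
    obtain A' where A': "A' \<in> p" "A = f ` A'" using A(1) by blast
    then have "A' \<subseteq> f -` B" using A(2) by blast
    then have "f -` B \<in> p" by (rule ultra_mono[OF p A'(1)])
    moreover have "B = f ` (f -` B)" using f by (simp add: bij_is_surj surj_image_vimage_eq)
    ultimately show ?thesis by blast
  qed
  show "A \<inter> B \<in> (\<lambda>A. f ` A) ` p" if "A \<in> (\<lambda>A. f ` A) ` p" "B \<in> (\<lambda>A. f ` A) ` p" for A B
    using that ultra_Int[OF p] by (auto simp: image_Int[OF bij_is_inj[OF f], symmetric])
  show "A \<in> (\<lambda>A. f ` A) ` p \<or> - A \<in> (\<lambda>A. f ` A) ` p" for A
  proof -
    have "f -` A \<in> p \<or> - (f -` A) \<in> p" using ultra_Compl[OF p] by blast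
    moreover have "A = f ` (f -` A)" using f by (simp add: bij_is_surj surj_image_vimage_eq)
    moreover have "- A = f ` (- (f -` A))" using f calculation(2) by (metis bij_image_Compl_eq)
    ultimately show ?thesis by blast
  qed
qed

text \<open>If the conclusion fails then \<open>h\<close> carries \<open>p1\<close> to \<open>p2\<close>; restricting \<open>h\<close> to a set in \<open>p1\<close> with infinite
  complement and coinfinite image makes it extend to a bijection.\<close>

lemma nonisomorphic_separated:
  assumes p1: "selective p1" and p2: "ultra p2" and iso: "\<not> isomorphic_uf p1 p2"
    and h: "inj_on h D"
  obtains X where "X \<in> p1" "h ` (X \<inter> D) \<notin> p2"
proof (cases "D \<in> p1")
  case False
  then have "- D \<in> p1" using ultra_Compl[OF selective_ultra[OF p1]] by simp
  moreover have "h ` (- D \<inter> D) = {}" by blast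
  ultimately show thesis using that ultra_nonempty[OF p2] by metis
next
  case True
  note up1 = selective_ultra[OF p1]
  obtain B C where BC: "D = B \<union> C" "B \<inter> C = {}" "infinite B" "infinite C"
    using infinite_split selective_infinite[OF p1 True] .
  then obtain D' where D': "D' \<in> p1" "D' \<subseteq> D" "infinite (D - D')"
  proof (cases "B \<in> p1")
    case True
    moreover have "D - B = C" using BC by blast
    ultimately show thesis using that[of B] BC by auto
  next
    case False
    then have "C \<in> p1" using ultra_Un[OF up1] True BC(1) by blast
    moreover have "D - C = B" using BC by blast
    ultimately show thesis using that[of C] BC by auto
  qed
  show thesis
  proof (rule ccontr)
    assume "\<not> thesis"
    then have all: "h ` (X \<inter> D) \<in> p2" if "X \<in> p1" for X using that \<open>\<And>X. X \<in> p1 \<Longrightarrow> h ` (X \<inter> D) \<notin> p2 \<Longrightarrow> thesis\<close> by blast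
    have inj': "inj_on h D'" using h D'(2) by (rule inj_on_subset)
    have "infinite (- D')" using D'(3) by (rule contrapos_nn) (rule finite_subset, auto)
    moreover have "infinite (- h ` D')"
    proof -
      have "h ` (D - D') \<subseteq> - h ` D'" using h D'(2) by (auto simp: inj_on_def)
      moreover have "infinite (h ` (D - D'))"
        using D'(3) h by (simp add: finite_image_iff inj_on_diff)
      ultimately show ?thesis using finite_subset by blast
    qed
    ultimately obtain g where g: "bij_betw g (- D') (- h ` D')"
      by (meson bij_betw_trans bij_betw_inv bij_enumerate)
    define f where "f x = (if x \<in> D' then h x else g x)" for x
    have "bij_betw f (D' \<union> - D') (h ` D' \<union> - h ` D')"
    proof (rule bij_betw_combine)
      show "bij_betw f D' (h ` D')"
        using inj' by (simp add: bij_betw_def f_def inj_on_def)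
      show "bij_betw f (- D') (- h ` D')"
        using g by (rule bij_betw_cong[THEN iffD1, rotated]) (simp add: f_def)
    qed simp
    then have bf: "bij f" by (metis Compl_partition)
    have "(\<lambda>A. f ` A) ` p1 \<subseteq> p2"
    proof (rule image_subsetI)
      fix A assume "A \<in> p1"
      then have "h ` ((A \<inter> D') \<inter> D) \<in> p2" using all ultra_Int[OF up1] D'(1) by blast
      moreover have "h ` ((A \<inter> D') \<inter> D) \<subseteq> f ` A" by (auto simp: f_def)
      ultimately show "f ` A \<in> p2" by (rule ultra_mono[OF p2])
    qed
    then have "(\<lambda>A. f ` A) ` p1 = p2" by (rule ultra_subset_eq[OF ultra_image_bij[OF up1 bf] p2])
    then show False using iso bf unfolding isomorphic_uf_def by blast
  qed
qed

text \<open>Cut the line so fast that from two intervals further on the finite exceptions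
  \<open>X0 - a z\<close> and \<open>Y0 - b z\<close> are over. It remains to find \<open>X\<close>
  and \<open>Y\<close> such that distinct points of their union lie in intervals that are neither
  equal nor adjacent. Within one ultrafilter, injectivity and constant parity of the interval index
  achieve this; across the two it is non-isomorphism.\<close>

lemma selective_pair_spread:
  assumes p1: "selective p1" and p2: "selective p2" and iso: "\<not> isomorphic_uf p1 p2"
    and a: "\<And>n::nat. a n \<in> p1" and b: "\<And>n::nat. b n \<in> p2"
  obtains X Y where "X \<in> p1" "Y \<in> p2" "X \<inter> Y = {}"
    "\<And>z z'. z \<in> X \<union> Y \<Longrightarrow> z' \<in> X \<Longrightarrow> z < z' \<Longrightarrow> z' \<in> a z"
    "\<And>z z'. z \<in> X \<union> Y \<Longrightarrow> z' \<in> Y \<Longrightarrow> z < z' \<Longrightarrow> z' \<in> b z"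
proof -
  note up1 = selective_ultra[OF p1] and up2 = selective_ultra[OF p2]
  obtain X0 where X0: "X0 \<in> p1" "\<And>n. finite (X0 - a n)"
    using selective_pseudo_intersection[of p1 a] p1 a by blast
  obtain Y0 where Y0: "Y0 \<in> p2" "\<And>n. finite (Y0 - b n)"
    using selective_pseudo_intersection[of p2 b] p2 b by blast
  have "\<exists>m. \<forall>z\<le>n. \<forall>z'\<ge>m. (z' \<in> X0 \<longrightarrow> z' \<in> a z) \<and> (z' \<in> Y0 \<longrightarrow> z' \<in> b z)" for n
  proof -
    have "finite (\<Union>z\<in>{..n}. (X0 - a z) \<union> (Y0 - b z))" using X0(2) Y0(2) by simp
    then obtain m where m: "\<And>z'. z' \<in> (\<Union>z\<in>{..n}. (X0 - a z) \<union> (Y0 - b z)) \<Longrightarrow> z' < m"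
      unfolding finite_nat_set_iff_bounded by blast
    have "(z' \<in> X0 \<longrightarrow> z' \<in> a z) \<and> (z' \<in> Y0 \<longrightarrow> z' \<in> b z)" if "z \<le> n" "z' \<ge> m" for z z'
      using m[of z'] that by fastforce
    then show ?thesis by blast
  qed
  then obtain g where g: "\<And>n z z'. z \<le> n \<Longrightarrow> z' \<ge> g n \<Longrightarrow>
      (z' \<in> X0 \<longrightarrow> z' \<in> a z) \<and> (z' \<in> Y0 \<longrightarrow> z' \<in> b z)" by metis
  define N where "N = rec_nat (0::nat) (\<lambda>_ m. max (Suc m) (g m))"
  have N_Suc: "N (Suc i) = max (Suc (N i)) (g (N i))" for i by (simp add: N_def)
  have N_ge: "i \<le> N i" for i by (induction i) (auto simp: N_Suc)
  define \<pi> where "\<pi> z = (LEAST i. z < N i)" for z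
  have \<pi>1: "z < N (\<pi> z)" for z
    unfolding \<pi>_def by (rule LeastI[of "\<lambda>i. z < N i" "Suc z"]) (use N_ge[of "Suc z"] in simp)
  have \<pi>_mono: "\<pi> z \<le> \<pi> z'" if "z \<le> z'" for z z'
    unfolding \<pi>_def[of z] by (rule Least_le) (use that \<pi>1[of z'] in simp)
  \<comment> \<open>Here \<open>z\<close> is below \<open>N (\<pi> z)\<close>, and a point that
    skips the next interval is at least the following cut, which was chosen above
    \<open>g (N (\<pi> z))\<close>. Hence the gap of 2.\<close>
  have far: "g (N (\<pi> z)) \<le> z'" if "\<pi> z + 2 \<le> \<pi> z'" for z z'
  proof -
    have "\<not> z' < N (Suc (\<pi> z))"
      using not_less_Least[of "Suc (\<pi> z)" "\<lambda>i. z' < N i"] that by (simp add: \<pi>_def[of z'])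
    then show ?thesis by (simp add: N_Suc)
  qed
  have fin: "finite (\<pi> -` {c})" for c
    by (rule finite_subset[of _ "{..<N c}"]) (use \<pi>1 in auto)
  have spread: "\<exists>X2\<in>p. X2 \<subseteq> X \<and> inj_on \<pi> X2 \<and> (\<forall>z\<in>X2. \<forall>z'\<in>X2. z < z' \<longrightarrow> \<pi> z + 2 \<le> \<pi> z')"
    if p: "selective p" and X: "X \<in> p" for p X
  proof -
    note up = selective_ultra[OF p]
    obtain X1 where X1: "X1 \<in> p" "inj_on \<pi> X1"
      using selective_finite_to_one[of p \<pi>, OF p] fin by blast
    obtain E where E: "E \<in> p" "E = {z. even (\<pi> z)} \<or> E = {z. odd (\<pi> z)}"
      using ultra_Compl[OF up, of "{z. even (\<pi> z)}"] by (auto simp: Collect_neg_eq[symmetric])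
    let ?X = "X \<inter> X1 \<inter> E"
    have "inj_on \<pi> ?X" using X1(2) by (rule inj_on_subset) blast
    moreover have "\<pi> z + 2 \<le> \<pi> z'" if z: "z \<in> ?X" "z' \<in> ?X" "z < z'" for z z'
    proof -
      have "\<pi> z \<noteq> \<pi> z'" using X1(2) z by (auto simp: inj_on_def)
      moreover have "\<pi> z \<le> \<pi> z'" using \<pi>_mono z(3) by simp
      moreover have "even (\<pi> z) = even (\<pi> z')" using E(2) z by auto
      ultimately show ?thesis by presburger
    qed
    moreover have "?X \<in> p" using X X1 E ultra_Int[OF up] by simp
    ultimately show ?thesis by (intro bexI[of _ ?X]) auto
  qed
  obtain X2 where X2: "X2 \<in> p1" "X2 \<subseteq> X0" "inj_on \<pi> X2"
    "\<And>z z'. z \<in> X2 \<Longrightarrow> z' \<in> X2 \<Longrightarrow> z < z' \<Longrightarrow> \<pi> z + 2 \<le> \<pi> z'"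
    using spread[OF p1 X0(1)] by blast
  obtain Y2 where Y2: "Y2 \<in> p2" "Y2 \<subseteq> Y0" "inj_on \<pi> Y2"
    "\<And>z z'. z \<in> Y2 \<Longrightarrow> z' \<in> Y2 \<Longrightarrow> z < z' \<Longrightarrow> \<pi> z + 2 \<le> \<pi> z'"
    using spread[OF p2 Y0(1)] by blast
  \<comment> \<open>The values 0, 1, 2 of \<open>j\<close> will exclude the index differences -1, 0
    and 1; the summand 1 keeps the equation within the naturals.\<close>
  have "\<exists>X\<in>p1. \<exists>Y\<in>p2. \<forall>x\<in>X \<inter> X2. \<forall>y\<in>Y \<inter> Y2. \<pi> y + 1 \<noteq> \<pi> x + j" for j
  proof -
    let ?D = "{x \<in> X2. \<exists>y\<in>Y2. \<pi> y + 1 = \<pi> x + j}"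
    \<comment> \<open>By injectivity of \<open>\<pi>\<close> on \<open>Y2\<close>, each bad
      \<open>x\<close> has exactly one partner \<open>y\<close>. The partner map is injective on the
      bad points, so \<open>nonisomorphic_separated\<close> yields a set in \<open>p1\<close> whose
      partners can be removed from \<open>Y2\<close>.\<close>
    let ?h = "\<lambda>x. inv_into Y2 \<pi> (\<pi> x + j - 1)"
    have h: "?h x = y" if "y \<in> Y2" "\<pi> y + 1 = \<pi> x + j" for x y
    proof -
      have "\<pi> x + j - 1 = \<pi> y" using that(2) by simp
      then show ?thesis using Y2(3) that(1) by (simp add: inv_into_f_f)
    qed
    have "inj_on ?h ?D"
    proof (rule inj_onI)
      fix x x' assume x: "x \<in> ?D" "x' \<in> ?D" "?h x = ?h x'"
      then obtain y y' where y: "y \<in> Y2" "\<pi> y + 1 = \<pi> x + j" "y' \<in> Y2" "\<pi> y' + 1 = \<pi> x' + j"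
        by blast
      then have "y = y'" using h x(3) by metis
      then have "\<pi> x = \<pi> x'" using y by simp
      then show "x = x'" using X2(3) x by (auto simp: inj_on_def)
    qed
    then obtain X where X: "X \<in> p1" "?h ` (X \<inter> ?D) \<notin> p2"
      using nonisomorphic_separated[OF p1 up2 iso] by blast
    have "- ?h ` (X \<inter> ?D) \<in> p2" using X(2) ultra_Compl[OF up2] by simp
    moreover have "\<pi> y + 1 \<noteq> \<pi> x + j"
      if "x \<in> X \<inter> X2" "y \<in> - ?h ` (X \<inter> ?D) \<inter> Y2" for x y
    proof
      assume eq: "\<pi> y + 1 = \<pi> x + j"
      then have "x \<in> X \<inter> ?D" "y = ?h x" using that h[of y x] by auto
      then show False using that(2) by blast
    qed
    ultimately show ?thesis using X(1) by blast
  qed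
  then obtain XX YY where XY: "\<And>j. XX j \<in> p1" "\<And>j. YY j \<in> p2"
    "\<And>j x y. x \<in> XX j \<inter> X2 \<Longrightarrow> y \<in> YY j \<inter> Y2 \<Longrightarrow> \<pi> y + 1 \<noteq> \<pi> x + j"
    by metis
  define X where "X = X2 \<inter> (XX 0 \<inter> XX 1 \<inter> XX 2)"
  define Y where "Y = Y2 \<inter> (YY 0 \<inter> YY 1 \<inter> YY 2)"
  have cross: "\<pi> x + 2 \<le> \<pi> y \<or> \<pi> y + 2 \<le> \<pi> x" if "x \<in> X" "y \<in> Y" for x y
    using XY(3)[of x 0 y] XY(3)[of x 1 y] XY(3)[of x 2 y] that
    by (auto simp: X_def Y_def)
  have sep: "\<pi> z + 2 \<le> \<pi> z'" if "z \<in> X \<union> Y" "z' \<in> X \<union> Y" "z < z'" for z z'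
    using that cross[of z z'] cross[of z' z] X2(4)[of z z'] Y2(4)[of z z'] \<pi>_mono[of z z']
    by (auto simp: X_def Y_def)
  show thesis
  proof (rule that[of X Y])
    show "X \<in> p1" unfolding X_def using X2(1) XY(1) ultra_Int[OF up1] by simp
    show "Y \<in> p2" unfolding Y_def using Y2(1) XY(2) ultra_Int[OF up2] by simp
    show "X \<inter> Y = {}" using cross by fastforce
    show "z' \<in> a z" if "z \<in> X \<union> Y" "z' \<in> X" "z < z'" for z z'
      using g[of z "N (\<pi> z)" z'] far[OF sep[of z z']] that \<pi>1[of z] X2(2) by (auto simp: X_def)
    show "z' \<in> b z" if "z \<in> X \<union> Y" "z' \<in> Y" "z < z'" for z z'
      using g[of z "N (\<pi> z)" z'] far[OF sep[of z z']] that \<pi>1[of z] Y2(2) by (auto simp: Y_def)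
  qed
qed

section \<open>Towers of length \<open>\<omega>\<^sub>1\<close>\<close>

text \<open>Recursion along the cardinal well-order of the sets of naturals, which also index the
  tasks \<open>D\<close>. Under CH every proper initial segment is countable, so \<open>step\<close>
  applies at each stage. The whole type being uncountable, countably many stages always have an
  upper bound, which gives the last conclusion.\<close>

lemma tower_exists:
  fixes le :: "'p \<Rightarrow> 'p \<Rightarrow> bool" and D :: "nat set \<Rightarrow> 'p set"
  assumes ch: continuum_hypothesis and refl: "\<And>t. t \<in> P \<Longrightarrow> le t t"
    and step: "\<And>C i. countable C \<Longrightarrow> C \<subseteq> P \<Longrightarrow> (\<forall>c\<in>C. \<forall>d\<in>C. le c d \<or> le d c) \<Longrightarrow>
      \<exists>t\<in>P \<inter> D i. \<forall>c\<in>C. le t c"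
  obtains G where "G \<subseteq> P" "\<And>c d. c \<in> G \<Longrightarrow> d \<in> G \<Longrightarrow> le c d \<or> le d c" "\<And>i. \<exists>t\<in>G. t \<in> D i"
    "\<And>C. countable C \<Longrightarrow> C \<subseteq> G \<Longrightarrow> \<exists>g\<in>G. \<forall>c\<in>C. le g c"
proof -
  define r where "r = |UNIV :: nat set set|"
  have r: "Well_order r" "Card_order r" "Field r = UNIV"
    by (simp_all add: r_def Field_card_of card_of_well_order_on card_of_card_order_on)
  have rs: "r =o cardSuc natLeq" using ch by (simp add: r_def continuum_hypothesis_def)
  have cS: "countable (underS r \<alpha>)" for \<alpha>
  proof -
    have "|underS r \<alpha>| <o r" using r by (simp add: card_of_underS)
    then have "|underS r \<alpha>| <o cardSuc natLeq" using rs by (rule ordLess_ordIso_trans)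
    then show ?thesis
      by (simp add: cardSuc_ordLeq_ordLess natLeq_Card_order card_of_Card_order countable_card_le_natLeq)
  qed
  have unc: "\<not> countable (UNIV :: nat set set)"
  proof
    assume "countable (UNIV :: nat set set)"
    then have "r \<le>o natLeq" by (simp add: r_def countable_card_le_natLeq)
    moreover have "natLeq <o r"
      using cardSuc_greater[OF natLeq_Card_order] rs ordIso_symmetric ordLess_ordIso_trans by blast
    ultimately show False using not_ordLess_ordLeq by blast
  qed
  define R where "R = r - Id"
  have wf: "wf R" using r(1) unfolding R_def well_order_on_def by blast
  have R_under: "{\<beta>. (\<beta>, \<alpha>) \<in> R} = underS r \<alpha>" for \<alpha> unfolding R_def underS_def by blast
  have lin: "(\<alpha>, \<beta>) \<in> R \<or> \<alpha> = \<beta> \<or> (\<beta>, \<alpha>) \<in> R" for \<alpha> \<beta>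
    using r unfolding R_def well_order_on_def linear_order_on_def total_on_def by blast
  have "\<exists>f. \<forall>\<alpha>. f \<alpha> \<in> P \<inter> D \<alpha> \<and> (\<forall>\<beta>. (\<beta>, \<alpha>) \<in> R \<longrightarrow> le (f \<alpha>) (f \<beta>))"
  proof (rule dependent_wf_choice[OF wf, where P = "\<lambda>f \<alpha> t. t \<in> P \<inter> D \<alpha> \<and> (\<forall>\<beta>. (\<beta>, \<alpha>) \<in> R \<longrightarrow> le t (f \<beta>))"])
    fix \<alpha> f
    assume IH: "\<And>\<beta>. (\<beta>, \<alpha>) \<in> R \<Longrightarrow> f \<beta> \<in> P \<inter> D \<beta> \<and> (\<forall>\<gamma>. (\<gamma>, \<beta>) \<in> R \<longrightarrow> le (f \<beta>) (f \<gamma>))"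
    let ?C = "f ` {\<beta>. (\<beta>, \<alpha>) \<in> R}"
    have "\<exists>t\<in>P \<inter> D \<alpha>. \<forall>c\<in>?C. le t c"
    proof (rule step)
      show "countable ?C" unfolding R_under using cS by simp
      show "?C \<subseteq> P" using IH by blast
      show "\<forall>c\<in>?C. \<forall>d\<in>?C. le c d \<or> le d c"
      proof (intro ballI)
        fix c d assume "c \<in> ?C" "d \<in> ?C"
        then obtain \<beta> \<gamma> where *: "c = f \<beta>" "d = f \<gamma>" "(\<beta>, \<alpha>) \<in> R" "(\<gamma>, \<alpha>) \<in> R" by blast
        then show "le c d \<or> le d c" using lin[of \<beta> \<gamma>] IH[of \<beta>] IH[of \<gamma>] refl by auto
      qed
    qed
    then show "\<exists>t. t \<in> P \<inter> D \<alpha> \<and> (\<forall>\<beta>. (\<beta>, \<alpha>) \<in> R \<longrightarrow> le t (f \<beta>))" by blast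
  qed auto
  then obtain f where f: "\<And>\<alpha>. f \<alpha> \<in> P \<inter> D \<alpha>" "\<And>\<alpha> \<beta>. (\<beta>, \<alpha>) \<in> R \<Longrightarrow> le (f \<alpha>) (f \<beta>)" by blast
  show thesis
  proof (rule that[of "range f"])
    show "range f \<subseteq> P" using f(1) by blast
    show "le c d \<or> le d c" if "c \<in> range f" "d \<in> range f" for c d
    proof -
      from that obtain \<beta> \<gamma> where "c = f \<beta>" "d = f \<gamma>" by blast
      then show ?thesis using lin[of \<beta> \<gamma>] f(2) f(1)[of \<beta>] refl by auto
    qed
    show "\<exists>t\<in>range f. t \<in> D i" for i using f(1)[of i] by blast
    fix C assume "countable C" "C \<subseteq> range f"
    then obtain S where S: "countable S" "C = f ` S" by (metis countable_subset_image)
    have "\<exists>\<alpha>. \<forall>\<beta>\<in>S. (\<beta>, \<alpha>) \<in> R"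
    proof (rule ccontr)
      assume "\<not> ?thesis"
      \<comment> \<open>An unbounded countable \<open>S\<close> would cover the type by countably
        many countable segments.\<close>
      then have "\<exists>\<beta>\<in>S. \<alpha> = \<beta> \<or> (\<alpha>, \<beta>) \<in> R" for \<alpha> using lin by metis
      then have "UNIV \<subseteq> (\<Union>\<beta>\<in>S. insert \<beta> (underS r \<beta>))" unfolding R_under[symmetric] by blast
      moreover have "countable (\<Union>\<beta>\<in>S. insert \<beta> (underS r \<beta>))" using S(1) cS by auto
      ultimately show False using unc countable_subset by blast
    qed
    then show "\<exists>g\<in>range f. \<forall>c\<in>C. le g c" using S(2) f(2) by blast
  qed
qed

lemma pseudo_intersection:
  assumes C: "countable C" "\<And>A. A \<in> C \<Longrightarrow> infinite (A :: nat set)"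
    and chain: "\<And>A B. A \<in> C \<Longrightarrow> B \<in> C \<Longrightarrow> finite (A - B) \<or> finite (B - A)"
  obtains X where "infinite X" "\<And>A. A \<in> C \<Longrightarrow> finite (X - A)"
proof (cases "C = {}")
  case True
  then show thesis using that[of UNIV] by simp
next
  case False
  define c where "c = from_nat_into C"
  have c: "range c = C" using C(1) False by (simp add: c_def range_from_nat_into)
  \<comment> \<open>Among finitely many sets of the chain one is almost contained in all of them, so
    finite intersections are infinite and a diagonal sequence exists.\<close>
  have low: "\<exists>A\<in>C. \<forall>i\<le>n. finite (A - c i)" for n
  proof (induction n)
    case 0
    then show ?case using c by (intro bexI[of _ "c 0"]) auto
  next
    case (Suc n)
    then obtain A where A: "A \<in> C" "\<forall>i\<le>n. finite (A - c i)" by blast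
    have cS: "c (Suc n) \<in> C" using c by blast
    show ?case
    proof (cases "finite (A - c (Suc n))")
      case True
      then have "\<forall>i\<le>Suc n. finite (A - c i)" using A(2) by (simp add: le_Suc_eq)
      then show ?thesis using A(1) by blast
    next
      case False
      then have fin: "finite (c (Suc n) - A)" using chain A(1) cS by blast
      have "finite (c (Suc n) - c i)" if "i \<le> n" for i
        by (rule finite_subset[of _ "(c (Suc n) - A) \<union> (A - c i)"]) (use fin A(2) that in auto)
      then have "\<forall>i\<le>Suc n. finite (c (Suc n) - c i)" by (simp add: le_Suc_eq)
      then show ?thesis using cS by blast
    qed
  qed
  have "\<exists>x\<ge>n. \<forall>i\<le>n. x \<in> c i" for n
  proof -
    obtain A where A: "A \<in> C" "\<forall>i\<le>n. finite (A - c i)" using low by blast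
    have "finite (\<Union>i\<in>{..n}. A - c i)" by (rule finite_UN_I) (use A(2) in auto)
    then have "infinite (A - (\<Union>i\<in>{..n}. A - c i))"
      using C(2)[OF A(1)] by (rule Diff_infinite_finite)
    then obtain x where "x \<ge> n" "x \<in> A - (\<Union>i\<in>{..n}. A - c i)"
      unfolding infinite_nat_iff_unbounded_le by blast
    then show ?thesis by blast
  qed
  then obtain x where x: "\<And>n. x n \<ge> n" "\<And>n i. i \<le> n \<Longrightarrow> x n \<in> c i" by metis
  show thesis
  proof (rule that[of "range x"])
    show "infinite (range x)"
      unfolding infinite_nat_iff_unbounded_le using x(1) by blast
    fix A assume "A \<in> C"
    then obtain i where "A = c i" using c by blast
    then have "range x - A \<subseteq> x ` {..<i}" using x(2) not_less by blast
    then show "finite (range x - A)" by (rule finite_subset) simp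
  qed
qed

section \<open>Two non-isomorphic selective ultrafilters from CH\<close>

definition homogeneous :: "(nat \<Rightarrow> nat) \<Rightarrow> nat set \<Rightarrow> bool" where
  "homogeneous f A \<longleftrightarrow> (\<exists>c. \<forall>x\<in>A. f x = c) \<or> inj_on f A"

lemma homogeneous_exists:
  assumes "infinite A"
  obtains B where "B \<subseteq> A" "infinite B" "homogeneous f B"
proof (cases "finite (f ` A)")
  case True
  then obtain a where "infinite {x \<in> A. f x = f a}"
    using pigeonhole_infinite[OF assms] by blast
  then show thesis using that[of "{x \<in> A. f x = f a}"] unfolding homogeneous_def by blast
next
  case False
  obtain B where "B \<subseteq> A" "inj_on f B" "f ` A = f ` B" by (metis subset_image_inj order_refl)
  then show thesis using that[of B] False by (metis finite_imageI homogeneous_def)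
qed

text \<open>Homogeneity also yields the ultrafilter property: a characteristic function cannot be
  injective on an infinite set, so it is constant on some \<open>A\<close> of the tower, and this
  decides the set.\<close>

lemma selective_from_tower:
  fixes \<G> :: "nat set set"
  assumes inf: "\<And>A. A \<in> \<G> \<Longrightarrow> infinite A"
    and chain: "\<And>A B. A \<in> \<G> \<Longrightarrow> B \<in> \<G> \<Longrightarrow> finite (A - B) \<or> finite (B - A)"
    and hom: "\<And>f. \<exists>A\<in>\<G>. homogeneous f A"
  shows "selective {X. \<exists>A\<in>\<G>. finite (A - X)}" (is "selective ?p")
proof (rule selectiveI)
  show "ultra ?p"
    unfolding ultra_iff proper_filter_def
  proof (intro conjI ballI allI impI)
    show "UNIV \<in> ?p" using hom by auto
    show "{} \<notin> ?p" using inf by auto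
    show "B \<in> ?p" if A: "A \<in> ?p" "A \<subseteq> B" for A B
    proof -
      obtain D where D: "D \<in> \<G>" "finite (D - A)" using A(1) by blast
      have "finite (D - B)" by (rule finite_subset[OF _ D(2)]) (use A(2) in blast)
      then show ?thesis using D(1) by blast
    qed
    show "A \<inter> B \<in> ?p" if AB: "A \<in> ?p" "B \<in> ?p" for A B
    proof -
      obtain D E where DE: "D \<in> \<G>" "finite (D - A)" "E \<in> \<G>" "finite (E - B)"
        using AB by blast
      from chain[OF DE(1,3)] show ?thesis
      proof
        assume "finite (D - E)"
        then have "finite (D - (A \<inter> B))"
          by (intro finite_subset[of "D - (A \<inter> B)" "(D - A) \<union> (D - E) \<union> (E - B)"]) (use DE in auto)
        then show ?thesis using DE(1) by blast
      next
        assume "finite (E - D)"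
        then have "finite (E - (A \<inter> B))"
          by (intro finite_subset[of "E - (A \<inter> B)" "(D - A) \<union> (E - D) \<union> (E - B)"]) (use DE in auto)
        then show ?thesis using DE(3) by blast
      qed
    qed
    show "X \<in> ?p \<or> - X \<in> ?p" for X
    proof -
      let ?f = "\<lambda>x. if x \<in> X then 1 else 0 :: nat"
      obtain A where A: "A \<in> \<G>" "homogeneous ?f A" using hom by blast
      have "\<not> inj_on ?f A"
      proof
        assume "inj_on ?f A"
        moreover have "finite (?f ` A)" by (rule finite_subset[of _ "{0, 1}"]) auto
        ultimately show False using inf[OF A(1)] finite_imageD by blast
      qed
      then obtain c where "\<forall>x\<in>A. ?f x = c" using A(2) unfolding homogeneous_def by blast
      then have "A \<subseteq> X \<or> A \<subseteq> - X" by (cases "c = 1") (auto split: if_splits)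
      then have "A - X = {} \<or> A - (- X) = {}" by blast
      then show ?thesis using A(1) by (metis (mono_tags, lifting) finite.emptyI mem_Collect_eq)
    qed
  qed
  show "\<not> principal_on UNIV ?p"
  proof
    assume "principal_on UNIV ?p"
    then obtain a where a: "?p = {A. A \<subseteq> UNIV \<and> a \<in> A}" unfolding principal_on_def by blast
    obtain A where "A \<in> \<G>" using hom by blast
    moreover have "finite (A - (- {a}))" by (rule finite_subset[of _ "{a}"]) auto
    ultimately have "- {a} \<in> ?p" by blast
    then show False unfolding a by simp
  qed
  show "\<exists>B\<in>?p. (\<exists>c. \<forall>x\<in>B. f x = c) \<or> inj_on f B" for f :: "nat \<Rightarrow> nat"
  proof -
    obtain A where A: "A \<in> \<G>" "homogeneous f A" using hom by blast
    then have "A \<in> ?p" using finite.emptyI by (metis (mono_tags, lifting) Diff_cancel mem_Collect_eq)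
    then show ?thesis using A(2) unfolding homogeneous_def by blast
  qed
qed

text \<open>The tasks of \<open>tower_exists\<close> are indexed by sets of naturals, so functions
  have to be coded by such sets, namely by their graphs.\<close>

definition decode_fun :: "nat set \<Rightarrow> nat \<Rightarrow> nat" where
  "decode_fun S n = (SOME m. prod_encode (n, m) \<in> S)"

lemma decode_fun_surj: "\<exists>S. decode_fun S = f"
proof
  show "decode_fun ((\<lambda>n. prod_encode (n, f n)) ` UNIV) = f"
    by (auto simp: decode_fun_def image_iff prod_encode_eq)
qed

text \<open>Two towers grow side by side. The stage for a bijection \<open>f\<close> makes the image
  of the first set disjoint from the second, so \<open>f\<close> cannot carry \<open>p\<close> to
  \<open>q\<close>.\<close>

lemma nonisomorphic_selective_exist:
  assumes ch: continuum_hypothesis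
  obtains p q where "selective p" "selective q" "\<not> isomorphic_uf p q"
proof -
  define P :: "(nat set \<times> nat set) set" where "P = {A. infinite A} \<times> {A. infinite A}"
  define le :: "nat set \<times> nat set \<Rightarrow> nat set \<times> nat set \<Rightarrow> bool" where
    "le s t \<longleftrightarrow> finite (fst s - fst t) \<and> finite (snd s - snd t)" for s t
  define D :: "nat set \<Rightarrow> (nat set \<times> nat set) set" where
    "D S = {(A, B). homogeneous (decode_fun S) A \<and> homogeneous (decode_fun S) B \<and>
       (bij (decode_fun S) \<longrightarrow> decode_fun S ` A \<inter> B = {})}" for S
  obtain G where G: "G \<subseteq> P" "\<And>c d. c \<in> G \<Longrightarrow> d \<in> G \<Longrightarrow> le c d \<or> le d c"
    "\<And>S. \<exists>t\<in>G. t \<in> D S"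
  proof (rule tower_exists[OF ch, of P le D])
    show "le t t" for t by (simp add: le_def)
    fix C S assume C: "countable C" "C \<subseteq> P" "\<forall>c\<in>C. \<forall>d\<in>C. le c d \<or> le d c"
    obtain A where A: "infinite A" "\<And>c. c \<in> C \<Longrightarrow> finite (A - fst c)"
    proof (rule pseudo_intersection[of "fst ` C"])
      show "countable (fst ` C)" using C(1) by simp
      show "infinite A" if "A \<in> fst ` C" for A using that C(2) by (auto simp: P_def)
      show "finite (A - B) \<or> finite (B - A)" if "A \<in> fst ` C" "B \<in> fst ` C" for A B
        using that C(3) unfolding le_def by blast
    qed blast
    obtain B where B: "infinite B" "\<And>c. c \<in> C \<Longrightarrow> finite (B - snd c)"
    proof (rule pseudo_intersection[of "snd ` C"])
      show "countable (snd ` C)" using C(1) by simp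
      show "infinite A" if "A \<in> snd ` C" for A using that C(2) by (auto simp: P_def)
      show "finite (A - B) \<or> finite (B - A)" if "A \<in> snd ` C" "B \<in> snd ` C" for A B
        using that C(3) unfolding le_def by blast
    qed blast
    let ?f = "decode_fun S"
    obtain A1 A2 where A12: "A = A1 \<union> A2" "A1 \<inter> A2 = {}" "infinite A1" "infinite A2"
      using infinite_split[OF A(1)] .
    \<comment> \<open>Either the image of the half \<open>A1\<close> leaves infinitely much of
      \<open>B\<close>, or it covers an infinite part of \<open>B\<close>, and a bijection maps the
      other half \<open>A2\<close> off that part.\<close>
    have "\<exists>A'\<subseteq>A. \<exists>B'\<subseteq>B. infinite A' \<and> infinite B' \<and> (bij ?f \<longrightarrow> ?f ` A' \<inter> B' = {})"
    proof (cases "infinite (B - ?f ` A1)")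
      case True
      then show ?thesis
        using A12 by (intro exI[of _ A1] conjI exI[of _ "B - ?f ` A1"]) auto
    next
      case False
      then have "infinite (B \<inter> ?f ` A1)"
        using B(1) by (metis Diff_Diff_Int Diff_infinite_finite)
      moreover have "?f ` A2 \<inter> (B \<inter> ?f ` A1) = {}" if "bij ?f"
        using A12(2) bij_is_inj[OF that] by (auto simp: inj_def)
      ultimately show ?thesis
        using A12 by (intro exI[of _ A2] conjI exI[of _ "B \<inter> ?f ` A1"]) auto
    qed
    then obtain A' B' where AB': "A' \<subseteq> A" "B' \<subseteq> B" "infinite A'" "infinite B'"
      "bij ?f \<Longrightarrow> ?f ` A' \<inter> B' = {}" by blast
    obtain A'' where A'': "A'' \<subseteq> A'" "infinite A''" "homogeneous ?f A''"
      using homogeneous_exists[OF AB'(3)] .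
    obtain B'' where B'': "B'' \<subseteq> B'" "infinite B''" "homogeneous ?f B''"
      using homogeneous_exists[OF AB'(4)] .
    have "(A'', B'') \<in> P \<inter> D S"
      using A'' B'' AB'(5) by (auto simp: P_def D_def)
    moreover have "le (A'', B'') c" if "c \<in> C" for c
    proof -
      have "A'' - fst c \<subseteq> A - fst c" "B'' - snd c \<subseteq> B - snd c" using A'' B'' AB' by auto
      then show ?thesis using A(2)[OF that] B(2)[OF that] finite_subset by (auto simp: le_def)
    qed
    ultimately show "\<exists>t\<in>P \<inter> D S. \<forall>c\<in>C. le t c" by blast
  qed blast
  have hom: "\<exists>t\<in>G. homogeneous f (fst t) \<and> homogeneous f (snd t) \<and> (bij f \<longrightarrow> f ` fst t \<inter> snd t = {})" for f
    using G(3) decode_fun_surj[of f] by (force simp: D_def)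
  define p where "p = {X. \<exists>A\<in>fst ` G. finite (A - X)}"
  define q where "q = {X. \<exists>A\<in>snd ` G. finite (A - X)}"
  have sp: "selective p"
    unfolding p_def
  proof (rule selective_from_tower)
    show "infinite A" if "A \<in> fst ` G" for A using that G(1) by (auto simp: P_def)
    show "finite (A - B) \<or> finite (B - A)" if "A \<in> fst ` G" "B \<in> fst ` G" for A B
      using that G(2) unfolding le_def by blast
    show "\<exists>A\<in>fst ` G. homogeneous f A" for f
    proof -
      obtain t where "t \<in> G" "homogeneous f (fst t)" using hom[of f] by (elim bexE conjE)
      then show ?thesis by (intro bexI[of _ "fst t"] imageI)
    qed
  qed
  have sq: "selective q"
    unfolding q_def
  proof (rule selective_from_tower)
    show "infinite A" if "A \<in> snd ` G" for A using that G(1) by (auto simp: P_def)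
    show "finite (A - B) \<or> finite (B - A)" if "A \<in> snd ` G" "B \<in> snd ` G" for A B
      using that G(2) unfolding le_def by blast
    show "\<exists>A\<in>snd ` G. homogeneous f A" for f
    proof -
      obtain t where "t \<in> G" "homogeneous f (snd t)" using hom[of f] by (elim bexE conjE)
      then show ?thesis by (intro bexI[of _ "snd t"] imageI)
    qed
  qed
  have "\<not> isomorphic_uf p q"
  proof
    assume "isomorphic_uf p q"
    then obtain f where f: "bij f" "q = (\<lambda>A. f ` A) ` p" unfolding isomorphic_uf_def by blast
    obtain t where t: "t \<in> G" "f ` fst t \<inter> snd t = {}" using hom f(1) by blast
    have "fst t \<in> p" "snd t \<in> q" unfolding p_def q_def using t(1) by (auto intro!: bexI[of _ t])
    then have "f ` fst t \<inter> snd t \<in> q"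
      using f(2) ultra_Int[OF selective_ultra[OF sq]] by blast
    then show False using t(2) ultra_nonempty[OF selective_ultra[OF sq]] by blast
  qed
  then show thesis using that sp sq by blast
qed

section \<open>Finite unions and large sets\<close>

text \<open>Families are kept as sets; an enumeration is chosen only when a sequence is finally
  required.\<close>

definition FUs :: "nat set set \<Rightarrow> nat set set" where
  "FUs T = {\<Union>V | V. V \<subseteq> T \<and> finite V \<and> V \<noteq> {}}"

text \<open>The substitute for the tail of a sequence: a disjoint family has only finitely many
  members outside it, in whatever order they are listed.\<close>

definition tail :: "nat \<Rightarrow> nat set set" where
  "tail m = {x \<in> FF. m < Min x}"

lemma FF_D: "x \<in> FF \<Longrightarrow> finite x" "x \<in> FF \<Longrightarrow> x \<noteq> {}"
  by (simp_all add: FF_def)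

lemma FF_Un: "x \<in> FF \<Longrightarrow> y \<in> FF \<Longrightarrow> x \<union> y \<in> FF"
  by (simp add: FF_def)

lemma FF_Union: "finite V \<Longrightarrow> V \<noteq> {} \<Longrightarrow> V \<subseteq> FF \<Longrightarrow> \<Union>V \<in> FF"
  by (auto simp: FF_def)

lemma Min_Max_Un:
  assumes "x \<in> FF" "y \<in> FF" "Max x < Min y"
  shows "Min (x \<union> y) = Min x" "Max (x \<union> y) = Max y"
proof -
  have *: "finite x" "x \<noteq> {}" "finite y" "y \<noteq> {}" using assms FF_D by auto
  have "Min x \<le> Max x" "Min y \<le> Max y" using * by simp_all
  then show "Min (x \<union> y) = Min x" "Max (x \<union> y) = Max y"
    using * assms(3) by (simp_all add: Min_Un Max_Un)
qed

lemma Max_less_Min_disjoint: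
  assumes "x \<in> FF" "y \<in> FF" "Max x < Min y"
  shows "x \<inter> y = {}"
proof (rule equals0I)
  fix z assume "z \<in> x \<inter> y"
  then have "z \<le> Max x" "Min y \<le> z" using assms FF_D by auto
  then show False using assms(3) by simp
qed

lemma finite_Min_le:
  assumes "T \<subseteq> FF" "disjoint T"
  shows "finite {x \<in> T. Min x \<le> m}"
proof (rule finite_imageD)
  show "finite (Min ` {x \<in> T. Min x \<le> m})" by (rule finite_subset[of _ "{..m}"]) auto
  show "inj_on Min {x \<in> T. Min x \<le> m}"
  proof (rule inj_onI)
    fix x y assume *: "x \<in> {x \<in> T. Min x \<le> m}" "y \<in> {x \<in> T. Min x \<le> m}" "Min x = Min y"
    then have "x \<in> FF" "y \<in> FF" using assms(1) by auto
    then have "Min x \<in> x" "Min y \<in> y" using FF_D Min_in by blast+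
    then have "Min x \<in> x \<inter> y" using *(3) by simp
    then show "x = y" using assms(2) * unfolding disjoint_def by blast
  qed
qed

lemma Max_bound:
  assumes "finite L" "L \<subseteq> FF"
  obtains M where "\<And>x. x \<in> L \<Longrightarrow> Max x \<le> M"
  using finite_imageI[OF assms(1), of Max] by (meson finite_nat_set_iff_bounded_le imageI)

lemma FUs_mono: "S \<subseteq> T \<Longrightarrow> FUs S \<subseteq> FUs T"
  unfolding FUs_def by blast

lemma FUs_incl: "x \<in> T \<Longrightarrow> x \<in> FUs T"
  unfolding FUs_def by (intro CollectI exI[of _ "{x}"]) simp

lemma FUsI: "V \<subseteq> T \<Longrightarrow> finite V \<Longrightarrow> V \<noteq> {} \<Longrightarrow> \<Union>V \<in> FUs T"
  unfolding FUs_def by blast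

lemma FUs_Un: "x \<in> FUs T \<Longrightarrow> y \<in> FUs T \<Longrightarrow> x \<union> y \<in> FUs T"
  unfolding FUs_def by clarify (rule_tac x = "V \<union> Va" in exI, blast)

lemma FUs_insert:
  assumes "x \<in> FUs (insert a T)"
  obtains "x = a" | "x \<in> FUs T" | y where "y \<in> FUs T" "x = a \<union> y"
proof -
  obtain V where V: "x = \<Union>V" "V \<subseteq> insert a T" "finite V" "V \<noteq> {}"
    using assms unfolding FUs_def by blast
  show thesis
  proof (cases "a \<in> V")
    case False
    then have "x \<in> FUs T" using V unfolding FUs_def by blast
    then show thesis using that by blast
  next
    case True
    then have x: "x = a \<union> \<Union>(V - {a})" using V(1) by blast
    show thesis
    proof (cases "V - {a} = {}")
      case True
      have "x = a" using x unfolding True by simp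
      then show thesis by (rule that(1))
    next
      case False
      then have "\<Union>(V - {a}) \<in> FUs T" using V unfolding FUs_def by blast
      then show thesis using that(3) x by blast
    qed
  qed
qed

lemma tail_Union:
  assumes "V \<subseteq> tail m" "finite V" "V \<noteq> {}"
  shows "\<Union>V \<in> tail m"
proof -
  have FF: "\<Union>V \<in> FF" using assms by (intro FF_Union) (auto simp: tail_def)
  have "Min (\<Union>V) \<in> \<Union>V" using FF_D[OF FF] by (intro Min_in)
  then obtain x where x: "x \<in> V" "Min (\<Union>V) \<in> x" by blast
  have xt: "x \<in> FF" "m < Min x" using x(1) assms(1) by (auto simp: tail_def)
  have "Min x \<le> Min (\<Union>V)" using FF_D(1)[OF xt(1)] x(2) by (rule Min_le)
  then show ?thesis using FF xt(2) by (simp add: tail_def)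
qed

lemma FUs_tail: "FUs (T \<inter> tail m) \<subseteq> tail m"
  unfolding FUs_def using tail_Union by auto

lemma tail_FF: "tail m \<subseteq> FF"
  by (auto simp: tail_def)

lemma FUs_FF: "T \<subseteq> FF \<Longrightarrow> FUs T \<subseteq> FF"
  unfolding FUs_def using FF_Union by blast

lemma tail_mono: "m \<le> n \<Longrightarrow> tail n \<subseteq> tail m"
  by (auto simp: tail_def)

section \<open>Folkman systems inside the members of an idempotent\<close>

definition fu_system :: "nat \<Rightarrow> (nat \<Rightarrow> nat set) \<Rightarrow> nat set set \<Rightarrow> bool" where
  "fu_system k e A \<longleftrightarrow> (\<forall>i<k. e i \<in> FF) \<and> disjoint_family_on e {..<k} \<and>
     (\<forall>s. s \<noteq> {} \<and> s \<subseteq> {..<k} \<longrightarrow> (\<Union>i\<in>s. e i) \<in> A)"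

lemma fu_systemD:
  assumes "fu_system k e A"
  shows "i < k \<Longrightarrow> e i \<in> FF" "i < k \<Longrightarrow> j < k \<Longrightarrow> i \<noteq> j \<Longrightarrow> e i \<inter> e j = {}"
    "s \<noteq> {} \<Longrightarrow> s \<subseteq> {..<k} \<Longrightarrow> (\<Union>i\<in>s. e i) \<in> A"
  using assms by (simp_all add: fu_system_def disjoint_family_on_def)

lemma fu_systemI:
  assumes "\<And>i. i < k \<Longrightarrow> e i \<in> FF" "\<And>i j. i < k \<Longrightarrow> j < k \<Longrightarrow> i \<noteq> j \<Longrightarrow> e i \<inter> e j = {}"
    "\<And>s. s \<noteq> {} \<Longrightarrow> s \<subseteq> {..<k} \<Longrightarrow> (\<Union>i\<in>s. e i) \<in> A"
  shows "fu_system k e A"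
  using assms by (simp add: fu_system_def disjoint_family_on_def)

lemma fu_system_mono: "fu_system k e A \<Longrightarrow> A \<subseteq> A' \<Longrightarrow> fu_system k e A'"
  unfolding fu_system_def by blast

text \<open>The Galvin-Glazer argument: \<open>v\<close>-most \<open>x\<close> in \<open>A\<close>
  satisfy \<open>x \<union> y \<in> A\<close> for \<open>v\<close>-most \<open>y\<close>. Fix one
  such \<open>x\<close> and look for the rest of the system among those \<open>y\<close>.\<close>

lemma idempotent_fu_system:
  assumes v: "ultra v" "sup.uprod v v = v" "\<And>m. tail m \<in> v" and "A \<in> v"
  shows "\<exists>e. fu_system k e A"
  using \<open>A \<in> v\<close>
proof (induction k arbitrary: A)
  case 0
  show ?case by (auto simp: fu_system_def disjoint_family_on_def)
next
  case (Suc k)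
  have "sup.shift A v \<in> v" using Suc.prems v(2) by (auto simp: sup.uprod_def)
  then have "A \<inter> sup.shift A v \<inter> tail 0 \<in> v" using Suc.prems v(1,3) ultra_Int by blast
  then obtain x where x: "x \<in> A" "x \<in> sup.shift A v" "x \<in> FF"
    using ultra_nonempty[OF v(1)] by (fastforce simp: tail_def)
  \<comment> \<open>Union is a total operation on the type; the factor \<open>tail (Max x)\<close>
    is what keeps the remaining sets disjoint from \<open>x\<close>.\<close>
  let ?A = "A \<inter> {y. x \<union> y \<in> A} \<inter> tail (Max x)"
  have "?A \<in> v"
    using Suc.prems x(2) v(3) by (intro ultra_Int[OF v(1)]) (simp_all add: sup.shift_def)
  from Suc.IH[OF this] obtain e where e: "fu_system k e ?A" ..
  let ?e = "e(k := x)"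
  have ex: "e i \<inter> x = {}" if "i < k" for i
  proof -
    have "e i \<in> tail (Max x)" using fu_systemD(3)[OF e, of "{i}"] that by simp
    then show ?thesis using Max_less_Min_disjoint[OF x(3), of "e i"] by (auto simp: tail_def)
  qed
  have "fu_system (Suc k) ?e A"
  proof (rule fu_systemI)
    show "?e i \<in> FF" if "i < Suc k" for i
      using that fu_systemD(1)[OF e] x(3) by (auto simp: less_Suc_eq)
    show "?e i \<inter> ?e j = {}" if "i < Suc k" "j < Suc k" "i \<noteq> j" for i j
      using that ex[of i] ex[of j] fu_systemD(2)[OF e, of i j] by (auto simp: less_Suc_eq)
    fix s :: "nat set" assume s: "s \<noteq> {}" "s \<subseteq> {..<Suc k}"
    show "(\<Union>i\<in>s. ?e i) \<in> A"
    proof (cases "k \<in> s")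
      case False
      then have "s \<subseteq> {..<k}" using s(2) by (auto simp: less_Suc_eq)
      moreover have "(\<Union>i\<in>s. ?e i) = (\<Union>i\<in>s. e i)" using False by auto
      ultimately show ?thesis using fu_systemD(3)[OF e s(1)] by simp
    next
      case True
      then have eq: "(\<Union>i\<in>s. ?e i) = x \<union> (\<Union>i\<in>s - {k}. e i)" by auto
      show ?thesis
      proof (cases "s - {k} = {}")
        case True
        show ?thesis unfolding eq True using x(1) by simp
      next
        case False
        have "s - {k} \<subseteq> {..<k}" using s(2) by (auto simp: less_Suc_eq)
        then show ?thesis using fu_systemD(3)[OF e False] unfolding eq by simp
      qed
    qed
  qed
  then show ?case by blast
qed

text \<open>This idempotent serves the colourings of index sets in \<open>large_Un\<close>. The
  filter generated by the tails is a subsemigroup because each tail is closed under union.\<close>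

lemma idempotent_tail_exists:
  obtains v where "ultra v" "sup.uprod v v = v" "\<And>m. tail m \<in> v"
proof -
  let ?F = "{X. \<exists>A\<in>range tail. A \<subseteq> X}"
  have "proper_filter ?F"
  proof (rule filter_generated)
    have "{Suc m} \<in> tail m" for m by (simp add: tail_def FF_def)
    then show "{} \<notin> range tail" by (metis empty_iff imageE)
    fix A B assume "A \<in> range tail" "B \<in> range tail"
    then obtain m n where "A = tail m" "B = tail n" by blast
    then show "\<exists>C\<in>range tail. C \<subseteq> A \<inter> B"
      using tail_mono[of m "max m n"] tail_mono[of n "max m n"] by auto
  qed simp
  moreover have "sup.subsemi ?F"
    unfolding sup.subsemi_def
  proof (intro allI impI subsetI)
    fix v w X assume v: "ultra v" "ultra w" "?F \<subseteq> v" "?F \<subseteq> w" and "X \<in> ?F"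
    then obtain m where m: "tail m \<subseteq> X" by blast
    have tv: "tail m \<in> v" "tail m \<in> w" using v(3,4) by blast+
    have "tail m \<subseteq> sup.shift X w"
    proof
      fix x assume x: "x \<in> tail m"
      have "x \<union> y \<in> X" if "y \<in> tail m" for y
        using tail_Union[of "{x, y}" m] x that m by auto
      then have "tail m \<subseteq> {y. x \<union> y \<in> X}" by blast
      then have "{y. x \<union> y \<in> X} \<in> w" by (rule ultra_mono[OF v(2) tv(2)])
      then show "x \<in> sup.shift X w" by (simp add: sup.shift_def)
    qed
    then show "X \<in> sup.uprod v w"
      unfolding sup.uprod_def using ultra_mono[OF v(1) tv(1)] by simp
  qed
  ultimately obtain v where v: "ultra v" "?F \<subseteq> v" "sup.uprod v v = v"
    by (rule sup.idempotent_ultrafilter_extends)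
  then have "tail m \<in> v" for m by blast
  then show thesis using that[OF v(1,3)] by blast
qed

text \<open>\<open>B n\<close> is the support of the \<open>n\<close>th block; nothing is assumed about it here.\<close>

locale selective_pair =
  fixes p1 p2 :: "nat set set" and B :: "nat \<Rightarrow> nat set"
  assumes sel1: "selective p1" and sel2: "selective p2" and noniso: "\<not> isomorphic_uf p1 p2"
begin

definition large :: "nat set set \<Rightarrow> bool" where
  "large A \<longleftrightarrow> (\<forall>k. \<exists>n e. fu_system k e A \<and> (\<forall>i<k. e i \<inter> B n \<noteq> {}))"

lemma large_mono: "large A \<Longrightarrow> A \<subseteq> A' \<Longrightarrow> large A'"
  unfolding large_def using fu_system_mono by meson

lemma largeE:
  assumes "large A"
  obtains n e where "fu_system k e A" "\<And>i. i < k \<Longrightarrow> e i \<inter> B n \<noteq> {}"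
  using assms unfolding large_def by blast

lemma not_large_empty: "\<not> large {}"
proof
  assume "large {}"
  then obtain n e where "fu_system 1 e {}" by (rule largeE)
  from fu_systemD(3)[OF this, of "{0}"] show False by simp
qed

text \<open>For every \<open>k\<close> there is a colouring of the nonempty subsets of \<open>{..<k}\<close>; the compactness
  argument that derives Folkman's finite theorem from Hindman's is a limit of these colourings
  along \<open>p1\<close>.\<close>

lemma large_Un:
  assumes "large (A \<union> A')"
  shows "large A \<or> large A'"
proof -
  note up = selective_ultra[OF sel1]
  have "\<exists>n e. fu_system k e (A \<union> A') \<and> (\<forall>i<k. e i \<inter> B n \<noteq> {})" for k
    using assms unfolding large_def ..
  then obtain n e where e: "\<And>k. fu_system k (e k) (A \<union> A')" "\<And>k i. i < k \<Longrightarrow> e k i \<inter> B (n k) \<noteq> {}"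
    by metis
  \<comment> \<open>The limit colouring: a set \<open>s\<close> of indices receives the colour that
    its union has in the system \<open>e K\<close> for \<open>p1\<close>-most
    \<open>K\<close>.\<close>
  define Q where "Q D = {s. {K. (\<Union>i\<in>s. e K i) \<in> D} \<in> p1}" for D
  have transfer: "large D" if D: "\<And>k. \<exists>w. fu_system k w (Q D)" for D
    unfolding large_def
  proof (intro allI)
    fix k :: nat
    obtain w where w: "fu_system k w (Q D)" using D[of k] ..
    have "finite (\<Union>j\<in>{..<k}. w j)" using fu_systemD(1)[OF w] FF_D by auto
    then obtain M where M: "(\<Union>j\<in>{..<k}. w j) \<subseteq> {..<M}" by (meson finite_nat_iff_bounded)
    let ?S = "{s. s \<noteq> {} \<and> s \<subseteq> {..<k}}"
    have "(\<Inter>s\<in>?S. {K. (\<Union>i\<in>(\<Union>j\<in>s. w j). e K i) \<in> D}) \<in> p1"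
      using fu_systemD(3)[OF w] by (intro ultra_INT[OF up]) (auto simp: Q_def)
    then have "(\<Inter>s\<in>?S. {K. (\<Union>i\<in>(\<Union>j\<in>s. w j). e K i) \<in> D}) \<inter> {M<..} \<in> p1"
      using selective_greater[OF sel1] ultra_Int[OF up] by blast
    \<comment> \<open>Finitely many limit statements hold simultaneously at some \<open>K\<close>
      beyond all indices occurring in the \<open>w j\<close>; there the index sets select unions
      from the single system \<open>e K\<close>, which all touch one block.\<close>
    then obtain K where K: "K > M" "\<And>s. s \<in> ?S \<Longrightarrow> (\<Union>i\<in>(\<Union>j\<in>s. w j). e K i) \<in> D"
      using ultra_nonempty[OF up] by blast
    have wK: "w j \<subseteq> {..<K}" if "j < k" for j using M K(1) that by force
    let ?e = "\<lambda>j. \<Union>i\<in>w j. e K i"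
    have "fu_system k ?e D"
    proof (rule fu_systemI)
      fix j assume j: "j < k"
      have wj: "finite (w j)" "w j \<noteq> {}" using fu_systemD(1)[OF w j] FF_D by auto
      show "?e j \<in> FF"
        using wj wK[OF j] fu_systemD(1)[OF e(1)] by (intro FF_Union) auto
    next
      fix j j' assume j: "j < k" "j' < k" "j \<noteq> j'"
      show "?e j \<inter> ?e j' = {}"
      proof (rule equals0I)
        fix z assume "z \<in> ?e j \<inter> ?e j'"
        then obtain i i' where i: "i \<in> w j" "z \<in> e K i" "i' \<in> w j'" "z \<in> e K i'" by blast
        have "i < K" "i' < K" using wK j i by auto
        then have "i = i'" using fu_systemD(2)[OF e(1), of i K i'] i by blast
        then show False using fu_systemD(2)[OF w j] i by blast
      qed
    next
      fix s :: "nat set" assume "s \<noteq> {}" "s \<subseteq> {..<k}"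
      then show "(\<Union>j\<in>s. ?e j) \<in> D" using K(2)[of s] by (simp add: UN_UN_flatten)
    qed
    moreover have "?e j \<inter> B (n K) \<noteq> {}" if j: "j < k" for j
    proof -
      obtain i where i: "i \<in> w j" using fu_systemD(1)[OF w j] FF_D by blast
      then have "e K i \<inter> B (n K) \<noteq> {}" using wK[OF j] e(2)[of i K] by blast
      then show ?thesis using i by blast
    qed
    ultimately show "\<exists>n e. fu_system k e D \<and> (\<forall>i<k. e i \<inter> B n \<noteq> {})" by blast
  qed
  obtain v where v: "ultra v" "sup.uprod v v = v" "\<And>m. tail m \<in> v"
    by (rule idempotent_tail_exists) blast
  show ?thesis
  proof (cases "Q A \<in> v")
    case True
    then show ?thesis using transfer[of A] idempotent_fu_system[OF v True] by blast
  next
    case False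
    then have *: "- Q A \<inter> tail 0 \<in> v" using v ultra_Compl ultra_Int by blast
    \<comment> \<open>The factor \<open>tail 0\<close> leaves only finite nonempty index sets; for
      these the union lies in \<open>A \<union> A'\<close> as soon as \<open>K\<close> is large
      enough.\<close>
    have "- Q A \<inter> tail 0 \<subseteq> Q A'"
    proof
      fix s assume s: "s \<in> - Q A \<inter> tail 0"
      then have sf: "finite s" "s \<noteq> {}" using FF_D by (auto simp: tail_def)
      then obtain M where M: "s \<subseteq> {..<M}" by (meson finite_nat_iff_bounded)
      have "- {K. (\<Union>i\<in>s. e K i) \<in> A} \<in> p1" using s ultra_Compl[OF up] by (simp add: Q_def)
      then have p: "- {K. (\<Union>i\<in>s. e K i) \<in> A} \<inter> {M<..} \<in> p1"
        using selective_greater[OF sel1] ultra_Int[OF up] by blast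
      have "- {K. (\<Union>i\<in>s. e K i) \<in> A} \<inter> {M<..} \<subseteq> {K. (\<Union>i\<in>s. e K i) \<in> A'}"
      proof
        fix K assume K: "K \<in> - {K. (\<Union>i\<in>s. e K i) \<in> A} \<inter> {M<..}"
        then have "s \<subseteq> {..<K}" using M by force
        then have "(\<Union>i\<in>s. e K i) \<in> A \<union> A'" using fu_systemD(3)[OF e(1) sf(2)] by blast
        then show "K \<in> {K. (\<Union>i\<in>s. e K i) \<in> A'}" using K by blast
      qed
      then show "s \<in> Q A'" using ultra_mono[OF up p] by (simp add: Q_def)
    qed
    then have "Q A' \<in> v" by (rule ultra_mono[OF v(1) *])
    then show ?thesis using transfer[of A'] idempotent_fu_system[OF v] by blast
  qed
qed

text \<open>A system \<open>e\<close> in \<open>shift A w\<close> is completed, set by set, by a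
  later system \<open>f\<close> of the same length. The common block is inherited from
  \<open>e\<close>, so the blocks on the two sides need not be related.\<close>

lemma large_uprod:
  assumes v: "ultra v" "\<And>A. A \<in> v \<Longrightarrow> large A"
    and w: "ultra w" "\<And>A. A \<in> w \<Longrightarrow> large A" "\<And>m. tail m \<in> w"
    and A: "A \<in> sup.uprod v w"
  shows "large A"
  unfolding large_def
proof (intro allI)
  fix k :: nat
  have "large (sup.shift A w)" using v(2) A by (simp add: sup.uprod_def)
  then obtain n e where e: "fu_system k e (sup.shift A w)" "\<And>i. i < k \<Longrightarrow> e i \<inter> B n \<noteq> {}"
    by (rule largeE[of _ k]) blast
  let ?S = "{s. s \<noteq> {} \<and> s \<subseteq> {..<k}}"
  \<comment> \<open>\<open>?C1\<close> lets one \<open>y\<close> complete each of the finitely many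
    unions of \<open>e\<close> to a member of \<open>A\<close>; \<open>?C2\<close> places
    \<open>y\<close> after all the sets \<open>e i\<close>.\<close>
  let ?C1 = "\<Inter>s\<in>?S. {y. (\<Union>i\<in>s. e i) \<union> y \<in> A}" and ?C2 = "\<Inter>i\<in>{..<k}. tail (Max (e i))"
  have "?C1 \<in> w"
    using fu_systemD(3)[OF e(1)] by (intro ultra_INT[OF w(1)]) (auto simp: sup.shift_def)
  moreover have "?C2 \<in> w" using w(3) by (intro ultra_INT[OF w(1)]) auto
  ultimately have "large (?C1 \<inter> ?C2)" using w(2) ultra_Int[OF w(1)] by blast
  then obtain n' f where f: "fu_system k f (?C1 \<inter> ?C2)" by (rule largeE)
  have ef: "e i \<inter> f j = {}" if "i < k" "j < k" for i j
  proof -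
    have "f j \<in> tail (Max (e i))" using fu_systemD(3)[OF f, of "{j}"] that by auto
    then show ?thesis
      using Max_less_Min_disjoint[OF fu_systemD(1)[OF e(1) that(1)]] by (auto simp: tail_def)
  qed
  let ?g = "\<lambda>i. e i \<union> f i"
  have "fu_system k ?g A"
  proof (rule fu_systemI)
    show "?g i \<in> FF" if "i < k" for i
      using fu_systemD(1)[OF e(1) that] fu_systemD(1)[OF f that] by (rule FF_Un)
    show "?g i \<inter> ?g j = {}" if "i < k" "j < k" "i \<noteq> j" for i j
      using fu_systemD(2)[OF e(1) that] fu_systemD(2)[OF f that] ef[OF that(1,2)] ef[OF that(2,1)]
      by blast
    show "(\<Union>i\<in>s. ?g i) \<in> A" if s: "s \<noteq> {}" "s \<subseteq> {..<k}" for s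
    proof -
      have "(\<Union>i\<in>s. f i) \<in> ?C1" using fu_systemD(3)[OF f s] by (rule IntD1)
      then have "(\<Union>i\<in>s. e i) \<union> (\<Union>i\<in>s. f i) \<in> A" using s by simp
      then show ?thesis by (simp add: UN_Un_distrib)
    qed
  qed
  then show "\<exists>n e. fu_system k e A \<and> (\<forall>i<k. e i \<inter> B n \<noteq> {})" using e(2) by blast
qed

section \<open>Conditions and fusion\<close>

definition condition :: "nat set set \<Rightarrow> bool" where
  "condition T \<longleftrightarrow> T \<subseteq> FF \<and> disjoint T \<and> Min ` T \<in> p1 \<and> Max ` T \<in> p2 \<and>
     (\<forall>k. \<exists>n. \<exists>E\<subseteq>T. finite E \<and> card E = k \<and> (\<forall>x\<in>E. x \<inter> B n \<noteq> {}))"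

text \<open>Almost condensation for families. Quantifying over all tails of \<open>T\<close> makes
  the sets \<open>FUs (T \<inter> tail m)\<close>, with \<open>T\<close> from a chain, directed
  downwards.\<close>

definition extends :: "nat set set \<Rightarrow> nat set set \<Rightarrow> bool" where
  "extends T' T \<longleftrightarrow> (\<forall>k. \<exists>m. FUs (T' \<inter> tail m) \<subseteq> FUs (T \<inter> tail k))"

definition good :: "nat set set set \<Rightarrow> bool" where
  "good v \<longleftrightarrow> ultra v \<and> sup.uprod v v = v \<and> (\<forall>m. tail m \<in> v) \<and>
     (\<forall>a\<in>p1. {x. Min x \<in> a} \<in> v) \<and> (\<forall>b\<in>p2. {x. Max x \<in> b} \<in> v) \<and> (\<forall>A\<in>v. large A)"

lemma conditionD:
  assumes "condition T"
  shows "T \<subseteq> FF" "disjoint T" "Min ` T \<in> p1" "Max ` T \<in> p2"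
    "\<exists>n. \<exists>E\<subseteq>T. finite E \<and> card E = k \<and> (\<forall>x\<in>E. x \<inter> B n \<noteq> {})"
  using assms unfolding condition_def by simp_all

lemma condition_finite_Diff_tail:
  assumes "condition T"
  shows "finite (T - tail m)"
  by (rule finite_subset[OF _ finite_Min_le[OF conditionD(1,2)[OF assms], of m]])
    (use conditionD(1)[OF assms] in \<open>auto simp: tail_def\<close>)

lemma condition_Min_tail:
  assumes "condition T"
  shows "Min ` (T \<inter> tail m) \<in> p1"
proof -
  have "Min ` T - Min ` (T - tail m) \<in> p1"
    using conditionD(3)[OF assms] condition_finite_Diff_tail[OF assms]
    by (intro selective_Diff_finite[OF sel1]) auto
  moreover have "Min ` T - Min ` (T - tail m) \<subseteq> Min ` (T \<inter> tail m)" by blast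
  ultimately show ?thesis by (rule ultra_mono[OF selective_ultra[OF sel1]])
qed

lemma condition_Max_tail:
  assumes "condition T"
  shows "Max ` (T \<inter> tail m) \<in> p2"
proof -
  have "Max ` T - Max ` (T - tail m) \<in> p2"
    using conditionD(4)[OF assms] condition_finite_Diff_tail[OF assms]
    by (intro selective_Diff_finite[OF sel2]) auto
  moreover have "Max ` T - Max ` (T - tail m) \<subseteq> Max ` (T \<inter> tail m)" by blast
  ultimately show ?thesis by (rule ultra_mono[OF selective_ultra[OF sel2]])
qed

lemma condition_infinite_Min:
  assumes "condition T" "a \<in> p1"
  shows "infinite {x \<in> T \<inter> tail m. Min x \<in> a}"
proof
  assume "finite {x \<in> T \<inter> tail m. Min x \<in> a}"
  then have "finite (Min ` {x \<in> T \<inter> tail m. Min x \<in> a})" by simp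
  moreover have "Min ` (T \<inter> tail m) \<inter> a = Min ` {x \<in> T \<inter> tail m. Min x \<in> a}" by blast
  ultimately show False
    using condition_Min_tail[OF assms(1)] assms(2) ultra_Int[OF selective_ultra[OF sel1]]
      selective_infinite[OF sel1] by metis
qed

lemma condition_infinite_Max:
  assumes "condition T" "b \<in> p2"
  shows "infinite {x \<in> T \<inter> tail m. Max x \<in> b}"
proof
  assume "finite {x \<in> T \<inter> tail m. Max x \<in> b}"
  then have "finite (Max ` {x \<in> T \<inter> tail m. Max x \<in> b})" by simp
  moreover have "Max ` (T \<inter> tail m) \<inter> b = Max ` {x \<in> T \<inter> tail m. Max x \<in> b}" by blast
  ultimately show False
    using condition_Max_tail[OF assms(1)] assms(2) ultra_Int[OF selective_ultra[OF sel2]]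
      selective_infinite[OF sel2] by metis
qed

text \<open>Passing to a tail loses finitely many members of \<open>T\<close>, so a block met by
  that many additional members is requested.\<close>

lemma condition_block_tail:
  assumes T: "condition T"
  obtains n E where "E \<subseteq> T \<inter> tail m" "finite E" "card E = k" "\<forall>x\<in>E. x \<inter> B n \<noteq> {}"
proof -
  obtain n E where E: "E \<subseteq> T" "finite E" "card E = k + card (T - tail m)" "\<forall>x\<in>E. x \<inter> B n \<noteq> {}"
    using conditionD(5)[OF T] by blast
  have "card E - card (T - tail m) \<le> card (E - (T - tail m))"
    using condition_finite_Diff_tail[OF T] by (rule diff_card_le_card_Diff)
  then have "k \<le> card (E - (T - tail m))" using E(3) by simp
  then obtain E' where E': "E' \<subseteq> E - (T - tail m)" "card E' = k" "finite E'"
    using obtain_subset_with_card_n by metis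
  have "E' \<subseteq> T \<inter> tail m" using E'(1) E(1) by blast
  then show thesis using that[of E' n] E' E(4) by blast
qed

text \<open>Each set of the system is a sandwich: a left part with minimum in \<open>a\<close>, a
  middle part meeting the block, a right part with maximum in \<open>b\<close>. All left parts
  precede all middle parts, and these precede all right parts; so every union has its minimum from a
  left part and its maximum from a right part.\<close>

lemma large_condition:
  assumes T: "condition T" and a: "a \<in> p1" and b: "b \<in> p2"
  shows "large {x \<in> FUs (T \<inter> tail m). Min x \<in> a \<and> Max x \<in> b}" (is "large ?D")
  unfolding large_def
proof (intro allI)
  fix k :: nat
  obtain L where L: "L \<subseteq> {x \<in> T \<inter> tail m. Min x \<in> a}" "finite L" "card L = k"
    using infinite_arbitrarily_large[OF condition_infinite_Min[OF T a]] by metis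
  have LF: "L \<subseteq> FF" using L(1) tail_FF by blast
  obtain M1 where M1: "\<And>x. x \<in> L \<Longrightarrow> Max x \<le> M1" using Max_bound[OF L(2) LF] by blast
  obtain n E where E: "E \<subseteq> T \<inter> tail (max m M1)" "finite E" "card E = k" "\<forall>x\<in>E. x \<inter> B n \<noteq> {}"
    using condition_block_tail[OF T] by metis
  have EF: "E \<subseteq> FF" using E(1) tail_FF by blast
  obtain M2 where M2: "\<And>x. x \<in> E \<Longrightarrow> Max x \<le> M2" using Max_bound[OF E(2) EF] by blast
  obtain R where R: "R \<subseteq> {x \<in> T \<inter> tail (max (max m M1) M2). Max x \<in> b}" "finite R" "card R = k"
    using infinite_arbitrarily_large[OF condition_infinite_Max[OF T b]] by metis
  have RF: "R \<subseteq> FF" using R(1) tail_FF by blast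
  have lr: "Max x < Min y" if "x \<in> L" "y \<in> E \<union> R" for x y
  proof -
    have "M1 < Min y" using that(2) E(1) R(1) by (auto simp: tail_def)
    then show ?thesis using M1[OF that(1)] by simp
  qed
  have er: "Max x < Min y" if "x \<in> E" "y \<in> R" for x y
  proof -
    have "M2 < Min y" using that(2) R(1) by (auto simp: tail_def)
    then show ?thesis using M2[OF that(1)] by simp
  qed
  obtain l where l: "bij_betw l {..<k} L" using L(2,3) by (metis ex_bij_betw_nat_finite lessThan_atLeast0)
  obtain c where c: "bij_betw c {..<k} E" using E(2,3) by (metis ex_bij_betw_nat_finite lessThan_atLeast0)
  obtain r where r: "bij_betw r {..<k} R" using R(2,3) by (metis ex_bij_betw_nat_finite lessThan_atLeast0)
  have mem: "l i \<in> L" "c i \<in> E" "r i \<in> R" if "i < k" for i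
    using l c r that by (auto simp: bij_betw_def)
  have memF: "l i \<in> FF" "c i \<in> FF" "r i \<in> FF" if "i < k" for i
    using mem[OF that] LF EF RF by auto
  have memT: "l i \<in> T" "c i \<in> T" "r i \<in> T" if "i < k" for i
    using mem[OF that] L(1) E(1) R(1) by auto
  have dis: "x \<inter> y = {}" if "x \<in> T" "y \<in> T" "x \<noteq> y" for x y
    using conditionD(2)[OF T] that unfolding disjoint_def by blast
  have neq: "l i \<noteq> l j" "c i \<noteq> c j" "r i \<noteq> r j" if "i < k" "j < k" "i \<noteq> j" for i j
    using l c r that unfolding bij_betw_def inj_on_def by auto
  have cross: "l i \<inter> c j = {}" "l i \<inter> r j = {}" "c i \<inter> r j = {}" if "i < k" "j < k" for i j
    using Max_less_Min_disjoint[OF memF(1)[OF that(1)] memF(2)[OF that(2)]]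
      Max_less_Min_disjoint[OF memF(1)[OF that(1)] memF(3)[OF that(2)]]
      Max_less_Min_disjoint[OF memF(2)[OF that(1)] memF(3)[OF that(2)]]
      lr[OF mem(1)[OF that(1)]] er[OF mem(2)[OF that(1)]] mem(2,3)[OF that(2)] by simp_all
  let ?e = "\<lambda>i. l i \<union> c i \<union> r i"
  have "fu_system k ?e ?D"
  proof (rule fu_systemI)
    show "?e i \<in> FF" if "i < k" for i
      using memF[OF that] FF_Un by blast
    show "?e i \<inter> ?e j = {}" if ij: "i < k" "j < k" "i \<noteq> j" for i j
      using neq[OF ij] memT[OF ij(1)] memT[OF ij(2)] dis cross[OF ij(1,2)] cross[OF ij(2,1)]
      by (simp add: Int_Un_distrib Int_Un_distrib2 Int_commute)
    fix s :: "nat set" assume s: "s \<noteq> {}" "s \<subseteq> {..<k}"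
    let ?U = "\<Union>i\<in>s. ?e i"
    have fs: "finite s" using s(2) finite_subset by blast
    have sk: "i < k" if "i \<in> s" for i using s(2) that by blast
    have UF: "?U \<in> FF" using s fs memF sk by (intro FF_Union) (auto intro!: FF_Un)
    have U_eq: "?U = \<Union>(l ` s \<union> c ` s \<union> r ` s)" by blast
    have "l ` s \<union> c ` s \<union> r ` s \<subseteq> T \<inter> tail m"
    proof -
      have "L \<subseteq> T \<inter> tail m" "E \<subseteq> T \<inter> tail m" "R \<subseteq> T \<inter> tail m"
        using L(1) E(1) R(1) by (auto simp: tail_def)
      then show ?thesis using mem sk by blast
    qed
    then have "?U \<in> FUs (T \<inter> tail m)"
      unfolding U_eq by (rule FUsI) (use fs s(1) in simp_all)
    moreover have "Min ?U \<in> a"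
    proof -
      obtain j where j: "j \<in> s" using s(1) by blast
      have in_U: "x \<in> ?U \<Longrightarrow> Min ?U \<le> x" for x using FF_D(1)[OF UF] by (rule Min_le)
      have "Min ?U \<in> ?U" using FF_D[OF UF] by (intro Min_in)
      then obtain i where i: "i \<in> s" "Min ?U \<in> ?e i" by blast
      have Mj: "Min (l j) \<in> l j" using memF(1)[OF sk[OF j]] FF_D by auto
      then have "Min ?U \<le> Min (l j)" using in_U j by blast
      also have "Min (l j) \<le> Max (l j)" using memF(1)[OF sk[OF j]] FF_D by auto
      finally have le: "Min ?U \<le> Max (l j)" .
      have "Min ?U \<notin> y" if y: "y \<in> E \<union> R" for y
      proof
        assume "Min ?U \<in> y"
        then have "Min y \<le> Min ?U" using y EF RF FF_D(1) by (intro Min_le) auto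
        then show False using le lr[OF mem(1)[OF sk[OF j]] y] by simp
      qed
      then have Ul: "Min ?U \<in> l i" using i mem[OF sk[OF i(1)]] by blast
      have li: "finite (l i)" "l i \<noteq> {}" using memF(1)[OF sk[OF i(1)]] FF_D by auto
      have "Min ?U \<le> Min (l i)" using Min_in[OF li] in_U i(1) by blast
      moreover have "Min (l i) \<le> Min ?U" using li(1) Ul by (rule Min_le)
      ultimately have "Min ?U = Min (l i)" by (rule order_antisym)
      then show ?thesis using mem(1)[OF sk[OF i(1)]] L(1) by auto
    qed
    moreover have "Max ?U \<in> b"
    proof -
      obtain j where j: "j \<in> s" using s(1) by blast
      have in_U: "x \<in> ?U \<Longrightarrow> x \<le> Max ?U" for x using FF_D(1)[OF UF] by (rule Max_ge)
      have "Max ?U \<in> ?U" using FF_D[OF UF] by (intro Max_in)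
      then obtain i where i: "i \<in> s" "Max ?U \<in> ?e i" by blast
      have rj: "finite (r j)" "r j \<noteq> {}" using memF(3)[OF sk[OF j]] FF_D by auto
      have "Min (r j) \<le> Max (r j)" using rj by simp
      also have "Max (r j) \<le> Max ?U" using in_U j Max_in[OF rj] by blast
      finally have le: "Min (r j) \<le> Max ?U" .
      have "Max ?U \<notin> y" if y: "y \<in> L \<union> E" for y
      proof
        assume "Max ?U \<in> y"
        then have "Max ?U \<le> Max y" using y LF EF FF_D(1) by (intro Max_ge) auto
        moreover have "Max y < Min (r j)" using y lr er mem(3)[OF sk[OF j]] by blast
        ultimately show False using le by simp
      qed
      then have Ur: "Max ?U \<in> r i" using i mem[OF sk[OF i(1)]] by blast
      have ri: "finite (r i)" "r i \<noteq> {}" using memF(3)[OF sk[OF i(1)]] FF_D by auto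
      have "Max (r i) \<le> Max ?U" using Max_in[OF ri] in_U i(1) by blast
      moreover have "Max ?U \<le> Max (r i)" using ri(1) Ur by (rule Max_ge)
      ultimately have "Max ?U = Max (r i)" by (intro order_antisym)
      then show ?thesis using mem(3)[OF sk[OF i(1)]] R(1) by auto
    qed
    ultimately show "?U \<in> ?D" by blast
  qed
  moreover have "\<forall>i<k. ?e i \<inter> B n \<noteq> {}" using mem(2) E(4) by blast
  ultimately show "\<exists>n e. fu_system k e ?D \<and> (\<forall>i<k. e i \<inter> B n \<noteq> {})" by blast
qed

text \<open>By \<open>large_Un\<close> the sets that are not large form an ideal. The ultrafilters
  extending \<open>F\<close> are those that contain every \<open>D T m a b\<close> and have only
  large members; both properties pass to products, so there is an idempotent among them.\<close>

lemma good_exists: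
  assumes "C \<noteq> {}" and C: "\<And>T. T \<in> C \<Longrightarrow> condition T"
    and chain: "\<And>T T'. T \<in> C \<Longrightarrow> T' \<in> C \<Longrightarrow> extends T T' \<or> extends T' T"
  obtains v where "good v" "\<And>T m. T \<in> C \<Longrightarrow> FUs (T \<inter> tail m) \<in> v"
proof -
  note up1 = selective_ultra[OF sel1] and up2 = selective_ultra[OF sel2]
  define D where "D T m a b = {x \<in> FUs (T \<inter> tail m). Min x \<in> a \<and> Max x \<in> b}" for T m a b
  define F where "F = {A. \<exists>T m a b. T \<in> C \<and> a \<in> p1 \<and> b \<in> p2 \<and> \<not> large (D T m a b - A)}"
  have D_large: "large (D T m a b)" if "T \<in> C" "a \<in> p1" "b \<in> p2" for T m a b
    unfolding D_def using large_condition C that by blast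
  have D_F: "A \<in> F" if "T \<in> C" "a \<in> p1" "b \<in> p2" "D T m a b \<subseteq> A" for T m a b A
  proof -
    have "D T m a b - A = {}" using that(4) by blast
    then have "\<not> large (D T m a b - A)" using not_large_empty by metis
    then show ?thesis unfolding F_def using that(1-3) by blast
  qed
  \<comment> \<open>The chain condition turns the sets \<open>D T m a b\<close> into a filter
    base.\<close>
  have dir: "\<exists>T m a b. T \<in> C \<and> a \<in> p1 \<and> b \<in> p2 \<and> D T m a b \<subseteq> D T1 m1 a1 b1 \<inter> D T2 m2 a2 b2"
    if T: "T1 \<in> C" "T2 \<in> C" "a1 \<in> p1" "a2 \<in> p1" "b1 \<in> p2" "b2 \<in> p2" for T1 T2 m1 m2 a1 a2 b1 b2
  proof -
    have "\<exists>T\<in>C. \<exists>m. FUs (T \<inter> tail m) \<subseteq> FUs (T1 \<inter> tail m1) \<inter> FUs (T2 \<inter> tail m2)"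
      using chain[OF T(1,2)]
    proof
      assume "extends T1 T2"
      then obtain m where m: "FUs (T1 \<inter> tail m) \<subseteq> FUs (T2 \<inter> tail m2)" unfolding extends_def by blast
      have "FUs (T1 \<inter> tail (max m m1)) \<subseteq> FUs (T1 \<inter> tail m)"
        "FUs (T1 \<inter> tail (max m m1)) \<subseteq> FUs (T1 \<inter> tail m1)"
        by (intro FUs_mono Int_mono tail_mono; simp)+
      then show ?thesis using m T(1) by blast
    next
      assume "extends T2 T1"
      then obtain m where m: "FUs (T2 \<inter> tail m) \<subseteq> FUs (T1 \<inter> tail m1)" unfolding extends_def by blast
      have "FUs (T2 \<inter> tail (max m m2)) \<subseteq> FUs (T2 \<inter> tail m)"
        "FUs (T2 \<inter> tail (max m m2)) \<subseteq> FUs (T2 \<inter> tail m2)"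
        by (intro FUs_mono Int_mono tail_mono; simp)+
      then show ?thesis using m T(2) by blast
    qed
    then obtain T' m' where T': "T' \<in> C" "FUs (T' \<inter> tail m') \<subseteq> FUs (T1 \<inter> tail m1) \<inter> FUs (T2 \<inter> tail m2)"
      by blast
    have "D T' m' (a1 \<inter> a2) (b1 \<inter> b2) \<subseteq> D T1 m1 a1 b1 \<inter> D T2 m2 a2 b2"
      unfolding D_def using T'(2) by blast
    moreover have "a1 \<inter> a2 \<in> p1" "b1 \<inter> b2 \<in> p2" using T(3-6) ultra_Int up1 up2 by auto
    ultimately show ?thesis using T'(1) by blast
  qed
  have F: "proper_filter F"
    unfolding proper_filter_def
  proof (intro conjI ballI allI impI)
    obtain T where "T \<in> C" using assms(1) by blast
    then show "UNIV \<in> F" using D_F[of T UNIV UNIV 0 UNIV] ultra_UNIV[OF up1] ultra_UNIV[OF up2] by simp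
    show "{} \<notin> F" unfolding F_def using D_large by auto
    show "A' \<in> F" if A: "A \<in> F" "A \<subseteq> A'" for A A'
    proof -
      obtain T m a b where T: "T \<in> C" "a \<in> p1" "b \<in> p2" "\<not> large (D T m a b - A)"
        using A(1) unfolding F_def by blast
      have "D T m a b - A' \<subseteq> D T m a b - A" using A(2) by blast
      then have "\<not> large (D T m a b - A')" using T(4) large_mono by blast
      then show ?thesis unfolding F_def using T by blast
    qed
    show "A \<inter> A' \<in> F" if A: "A \<in> F" "A' \<in> F" for A A'
    proof -
      obtain T1 m1 a1 b1 where 1: "T1 \<in> C" "a1 \<in> p1" "b1 \<in> p2" "\<not> large (D T1 m1 a1 b1 - A)"
        using A(1) unfolding F_def by blast
      obtain T2 m2 a2 b2 where 2: "T2 \<in> C" "a2 \<in> p1" "b2 \<in> p2" "\<not> large (D T2 m2 a2 b2 - A')"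
        using A(2) unfolding F_def by blast
      obtain T m a b where T: "T \<in> C" "a \<in> p1" "b \<in> p2"
        "D T m a b \<subseteq> D T1 m1 a1 b1 \<inter> D T2 m2 a2 b2"
        using dir[OF 1(1) 2(1) 1(2) 2(2) 1(3) 2(3)] by blast
      have "\<not> large ((D T1 m1 a1 b1 - A) \<union> (D T2 m2 a2 b2 - A'))"
        using large_Un 1(4) 2(4) by blast
      moreover have "D T m a b - A \<inter> A' \<subseteq> (D T1 m1 a1 b1 - A) \<union> (D T2 m2 a2 b2 - A')"
        using T(4) by blast
      ultimately have "\<not> large (D T m a b - A \<inter> A')" using large_mono by blast
      then show ?thesis unfolding F_def using T by blast
    qed
  qed
  have F_large: "large A" if v: "ultra v" "F \<subseteq> v" and A: "A \<in> v" for v A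
  proof (rule ccontr)
    assume nl: "\<not> large A"
    obtain T where T: "T \<in> C" using assms(1) by blast
    have "D T 0 UNIV UNIV - - A \<subseteq> A" by blast
    then have "\<not> large (D T 0 UNIV UNIV - - A)" using nl large_mono by blast
    then have "- A \<in> F" unfolding F_def using T ultra_UNIV[OF up1] ultra_UNIV[OF up2] by blast
    then show False using v A ultra_Compl by blast
  qed
  have F_tail: "tail m \<in> F" for m
  proof -
    obtain T where T: "T \<in> C" using assms(1) by blast
    have "D T m UNIV UNIV \<subseteq> tail m" unfolding D_def using FUs_tail[of T m] by blast
    then show ?thesis using D_F[OF T ultra_UNIV[OF up1] ultra_UNIV[OF up2]] by blast
  qed
  have "sup.subsemi F"
    unfolding sup.subsemi_def
  proof (intro allI impI subsetI)
    fix v w A assume v: "ultra v" and w: "ultra w" and Fv: "F \<subseteq> v" and Fw: "F \<subseteq> w" and A: "A \<in> F"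
    note uvw = sup.ultra_uprod[OF v w]
    obtain T m a b where T: "T \<in> C" "a \<in> p1" "b \<in> p2" "\<not> large (D T m a b - A)"
      using A unfolding F_def by blast
    have "D T m a b \<in> F" using D_F[OF T(1-3)] by blast
    then have Dv: "D T m a b \<in> v" "D T m a b \<in> w" using Fv Fw by auto
    \<comment> \<open>For \<open>y\<close> after \<open>x\<close>, the union takes its minimum from
      \<open>x\<close> and its maximum from \<open>y\<close>, so it stays in the same set.\<close>
    have "D T m a b \<subseteq> sup.shift (D T m a b) w"
    proof
      fix x assume x: "x \<in> D T m a b"
      have DF: "D T m a b \<subseteq> FF"
        unfolding D_def using FUs_FF[of "T \<inter> tail m"] tail_FF by blast
      have "D T m a b \<inter> tail (Max x) \<in> w" using Dv(2) F_tail Fw ultra_Int[OF w] by blast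
      moreover have "D T m a b \<inter> tail (Max x) \<subseteq> {y. x \<union> y \<in> D T m a b}"
      proof
        fix y assume y: "y \<in> D T m a b \<inter> tail (Max x)"
        then have "Min (x \<union> y) = Min x" "Max (x \<union> y) = Max y"
          using Min_Max_Un[of x y] x DF by (auto simp: tail_def)
        then show "y \<in> {y. x \<union> y \<in> D T m a b}" using x y FUs_Un by (simp add: D_def)
      qed
      ultimately have "{y. x \<union> y \<in> D T m a b} \<in> w" by (rule ultra_mono[OF w])
      then show "x \<in> sup.shift (D T m a b) w" by (simp add: sup.shift_def)
    qed
    then have D_vw: "D T m a b \<in> sup.uprod v w"
      unfolding sup.uprod_def using ultra_mono[OF v Dv(1)] by simp
    \<comment> \<open>Membership would make the difference large by \<open>large_uprod\<close>,
      contrary to the choice of \<open>A\<close>.\<close>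
    have "D T m a b - A \<notin> sup.uprod v w"
    proof
      assume DA: "D T m a b - A \<in> sup.uprod v w"
      have "large (D T m a b - A)"
      proof (rule large_uprod[OF v _ w _ _ DA])
        show "large X" if "X \<in> v" for X using F_large[OF v Fv that] .
        show "large X" if "X \<in> w" for X using F_large[OF w Fw that] .
        show "tail n \<in> w" for n using F_tail Fw by blast
      qed
      then show False using T(4) by simp
    qed
    then have "- (D T m a b - A) \<in> sup.uprod v w" by (simp only: ultra_Compl[OF uvw] not_False_eq_True)
    then have "- (D T m a b - A) \<inter> D T m a b \<in> sup.uprod v w" using D_vw ultra_Int[OF uvw] by blast
    moreover have "- (D T m a b - A) \<inter> D T m a b \<subseteq> A" by blast
    ultimately show "A \<in> sup.uprod v w" by (rule ultra_mono[OF uvw])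
  qed
  then obtain v where v: "ultra v" "F \<subseteq> v" "sup.uprod v v = v"
    using sup.idempotent_ultrafilter_extends[OF F] by metis
  obtain T0 where T0: "T0 \<in> C" using assms(1) by blast
  have Mi: "{x. Min x \<in> a} \<in> v" if "a \<in> p1" for a
    using D_F[OF T0 that ultra_UNIV[OF up2], of 0 "{x. Min x \<in> a}"] v(2) by (auto simp: D_def)
  have Ma: "{x. Max x \<in> b} \<in> v" if "b \<in> p2" for b
    using D_F[OF T0 ultra_UNIV[OF up1] that, of 0 "{x. Max x \<in> b}"] v(2) by (auto simp: D_def)
  show thesis
  proof (rule that)
    show "good v"
      unfolding good_def
    proof (intro conjI allI ballI)
      show "tail m \<in> v" for m using F_tail v(2) by blast
      show "large A" if "A \<in> v" for A using F_large[OF v(1,2) that] .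
    qed (fact v Mi Ma)+
    show "FUs (T \<inter> tail m) \<in> v" if "T \<in> C" for T m
      using D_F[OF that ultra_UNIV[OF up1] ultra_UNIV[OF up2], of m "FUs (T \<inter> tail m)"] v(2)
      by (auto simp: D_def)
  qed
qed

section \<open>The fusion game: minima and maxima are prescribed one by one\<close>

definition extremum :: "bool \<Rightarrow> nat set \<Rightarrow> nat" where
  "extremum c x = (if c then Min x else Max x)"

text \<open>The moves that can be answered from \<open>S\<close>: some \<open>x\<close> with the
  prescribed minimum (\<open>True\<close>, a move from \<open>p1\<close>) or maximum
  (\<open>False\<close>, a move from \<open>p2\<close>) lies in \<open>S\<close> and can be
  continued within \<open>S\<close> by \<open>v\<close>-most sets.\<close>

definition legal :: "nat set set set \<Rightarrow> bool \<Rightarrow> nat set set \<Rightarrow> nat set" where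
  "legal v c S = extremum c ` (S \<inter> sup.shift S v \<inter> FF)"

text \<open>The possible answers form a member of \<open>v\<close> by idempotence, and
  \<open>Min\<close> and \<open>Max\<close> carry \<open>v\<close> to \<open>p1\<close> and
  \<open>p2\<close>.\<close>

lemma legal_large:
  assumes v: "good v" and S: "S \<in> v"
  shows "legal v True S \<in> p1" "legal v False S \<in> p2"
proof -
  have uv: "ultra v" and iv: "sup.uprod v v = v"
    and Mi: "\<And>a. a \<in> p1 \<Longrightarrow> {x. Min x \<in> a} \<in> v" and Ma: "\<And>b. b \<in> p2 \<Longrightarrow> {x. Max x \<in> b} \<in> v"
    using v unfolding good_def by blast+
  have "sup.shift S v \<in> v" using S iv by (auto simp: sup.uprod_def)
  moreover have "FF \<in> v" using v ultra_mono[OF uv _ tail_FF] unfolding good_def by blast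
  ultimately have Q: "S \<inter> sup.shift S v \<inter> FF \<in> v" using S ultra_Int[OF uv] by blast
  show "legal v True S \<in> p1"
  proof (rule ccontr)
    assume "legal v True S \<notin> p1"
    then have "{x. Min x \<in> - legal v True S} \<in> v"
      using Mi ultra_Compl[OF selective_ultra[OF sel1]] by blast
    then have "(S \<inter> sup.shift S v \<inter> FF) \<inter> {x. Min x \<in> - legal v True S} \<noteq> {}"
      using ultra_nonempty[OF uv ultra_Int[OF uv Q]] by blast
    then show False by (auto simp: legal_def extremum_def)
  qed
  show "legal v False S \<in> p2"
  proof (rule ccontr)
    assume "legal v False S \<notin> p2"
    then have "{x. Max x \<in> - legal v False S} \<in> v"
      using Ma ultra_Compl[OF selective_ultra[OF sel2]] by blast
    then have "(S \<inter> sup.shift S v \<inter> FF) \<inter> {x. Max x \<in> - legal v False S} \<noteq> {}"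
      using ultra_nonempty[OF uv ultra_Int[OF uv Q]] by blast
    then show False by (auto simp: legal_def extremum_def)
  qed
qed

text \<open>\<open>E\<close> is the finite batch added at stage \<open>n\<close>, and
  \<open>S'\<close> is the supply for all later batches. The last clause is the fusion invariant:
  unions of later sets lie in \<open>S'\<close>, and joining a union from \<open>E\<close> leads
  back into \<open>S\<close>.\<close>

definition fusion_step ::
  "nat set set set \<Rightarrow> nat set set \<Rightarrow> nat set set \<Rightarrow> nat \<Rightarrow> bool \<Rightarrow> nat \<Rightarrow> nat set set \<Rightarrow> nat set set \<Rightarrow> bool"
  where
  "fusion_step v A S n c z E S' \<longleftrightarrow>
     finite E \<and> E \<subseteq> FF \<and> disjoint E \<and> FUs E \<subseteq> S \<and> z \<in> extremum c ` E \<and>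
     (\<exists>j. \<exists>E'\<subseteq>E. finite E' \<and> card E' = n \<and> (\<forall>x\<in>E'. x \<inter> B j \<noteq> {})) \<and>
     S' \<subseteq> S \<inter> A \<and> (\<forall>x\<in>E. \<forall>y\<in>S'. Max x < Min y) \<and> (\<forall>x\<in>FUs E. \<forall>y\<in>S'. x \<union> y \<in> S)"

text \<open>A single set \<open>x\<close> realises the move \<open>z\<close>; the \<open>n\<close>
  sets sharing a block come from a Folkman system placed after \<open>x\<close> and compatible with
  it.\<close>

lemma fusion_step_exists:
  assumes v: "good v" and S: "S \<in> v" and A: "A \<in> v" and z: "z \<in> legal v c S"
  shows "\<exists>E S'. S' \<in> v \<and> fusion_step v A S n c z E S'"
proof -
  have uv: "ultra v" and iv: "sup.uprod v v = v" and tv: "\<And>m. tail m \<in> v"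
    and lv: "\<And>A. A \<in> v \<Longrightarrow> large A"
    using v unfolding good_def by blast+
  have sh: "sup.shift X v \<in> v" if "X \<in> v" for X using that iv by (auto simp: sup.uprod_def)
  obtain x where x: "x \<in> S" "x \<in> sup.shift S v" "x \<in> FF" "z = extremum c x"
    using z unfolding legal_def by blast
  \<comment> \<open>\<open>C\<close> collects what may follow \<open>x\<close>. Unions of a system
    in \<open>C \<inter> sup.shift C v\<close> can be continued further, both alone and together
    with \<open>x\<close>.\<close>
  define C where "C = S \<inter> {y. x \<union> y \<in> S} \<inter> tail (Max x)"
  have C: "C \<in> v"
    unfolding C_def using S x(2) tv by (intro ultra_Int[OF uv]) (simp_all add: sup.shift_def)
  then have "C \<inter> sup.shift C v \<in> v" using sh ultra_Int[OF uv] by blast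
  then have "large (C \<inter> sup.shift C v)" by (rule lv)
  then obtain j e where e: "fu_system n e (C \<inter> sup.shift C v)" "\<And>i. i < n \<Longrightarrow> e i \<inter> B j \<noteq> {}"
    by (rule largeE[of _ n]) blast
  define E0 where "E0 = e ` {..<n}"
  have E0F: "E0 \<subseteq> FF" using fu_systemD(1)[OF e(1)] by (auto simp: E0_def)
  have "inj_on e {..<n}"
  proof (rule inj_onI, rule ccontr)
    fix i i' assume i: "i \<in> {..<n}" "i' \<in> {..<n}" "e i = e i'" "i \<noteq> i'"
    then have "e i = {}" using fu_systemD(2)[OF e(1), of i i'] by simp
    moreover have "e i \<noteq> {}" using FF_D(2)[OF fu_systemD(1)[OF e(1)]] i(1) by simp
    ultimately show False by simp
  qed
  then have E0: "finite E0" "card E0 = n" by (simp_all add: E0_def card_image)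
  have FU0: "w \<in> C \<inter> sup.shift C v" if w: "w \<in> FUs E0" for w
  proof -
    obtain V where V: "V \<subseteq> e ` {..<n}" "V \<noteq> {}" "w = \<Union>V"
      using w unfolding FUs_def E0_def by blast
    then obtain s where s: "s \<subseteq> {..<n}" "V = e ` s" by (meson subset_imageE)
    then show ?thesis using fu_systemD(3)[OF e(1), of s] V by simp
  qed
  define E where "E = insert x E0"
  have E: "finite E" "E \<subseteq> FF" using E0 E0F x(3) by (auto simp: E_def)
  have xe: "Max x < Min y" if "y \<in> E0" for y
    using FU0[OF FUs_incl[OF that]] by (simp add: C_def tail_def)
  have "disjoint E"
    unfolding disjoint_def
  proof (intro ballI impI)
    fix a b assume ab: "a \<in> E" "b \<in> E" "a \<noteq> b"
    consider "a = x" "b \<in> E0" | "b = x" "a \<in> E0" | "a \<in> E0" "b \<in> E0"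
      using ab unfolding E_def by blast
    then show "a \<inter> b = {}"
    proof cases
      case 1
      then show ?thesis using Max_less_Min_disjoint[OF x(3)] xe E0F by blast
    next
      case 2
      then show ?thesis using Max_less_Min_disjoint[OF x(3)] xe E0F by blast
    next
      case 3
      then obtain i i' where "i < n" "i' < n" "a = e i" "b = e i'" unfolding E0_def by blast
      then show ?thesis using fu_systemD(2)[OF e(1), of i i'] ab(3) by blast
    qed
  qed
  moreover have FUE: "w \<in> S \<and> {y. w \<union> y \<in> S} \<in> v" if "w \<in> FUs E" for w
    using that unfolding E_def
  proof (cases rule: FUs_insert)
    case 1
    then show ?thesis using x by (simp add: sup.shift_def)
  next
    case 2
    then have w: "w \<in> C" "{y. w \<union> y \<in> C} \<in> v" using FU0 by (auto simp: sup.shift_def)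
    have "{y. w \<union> y \<in> S} \<in> v" by (rule ultra_mono[OF uv w(2)]) (auto simp: C_def)
    then show ?thesis using w(1) by (simp add: C_def)
  next
    case (3 y0)
    then have w: "y0 \<in> C" "{y. y0 \<union> y \<in> C} \<in> v" using FU0 by (auto simp: sup.shift_def)
    have "{y. w \<union> y \<in> S} \<in> v"
      by (rule ultra_mono[OF uv w(2)]) (auto simp: C_def 3(2) Un_assoc)
    then show ?thesis using w(1) 3(2) by (simp add: C_def)
  qed
  obtain M where M: "\<And>x. x \<in> E \<Longrightarrow> Max x \<le> M" using Max_bound[OF E] by blast
  have finFU: "finite (FUs E)"
    by (rule finite_subset[of _ "Union ` Pow E"]) (use E(1) in \<open>auto simp: FUs_def\<close>)
  define S' where "S' = S \<inter> A \<inter> tail M \<inter> (\<Inter>w\<in>FUs E. {y. w \<union> y \<in> S})"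
  have "(\<Inter>w\<in>FUs E. {y. w \<union> y \<in> S}) \<in> v" using FUE by (intro ultra_INT[OF uv finFU]) blast
  then have S': "S' \<in> v" unfolding S'_def using S A tv ultra_Int[OF uv] by simp
  have "fusion_step v A S n c z E S'"
    unfolding fusion_step_def
  proof (intro conjI)
    show "\<exists>j. \<exists>E'\<subseteq>E. finite E' \<and> card E' = n \<and> (\<forall>x\<in>E'. x \<inter> B j \<noteq> {})"
      using E0 e(2) by (intro exI[of _ j] exI[of _ E0]) (auto simp: E_def E0_def)
    show "\<forall>x\<in>E. \<forall>y\<in>S'. Max x < Min y" using M by (force simp: S'_def tail_def)
    show "FUs E \<subseteq> S" using FUE by blast
    show "z \<in> extremum c ` E" using x(4) by (simp add: E_def)
    show "S' \<subseteq> S \<inter> A" unfolding S'_def by blast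
    show "\<forall>x\<in>FUs E. \<forall>y\<in>S'. x \<union> y \<in> S" unfolding S'_def by blast
    show "disjoint E" by fact
  qed (fact E)+
  then show ?thesis using S' by blast
qed

text \<open>The sets \<open>a z\<close> and \<open>b z\<close> below are intersections over all histories with entries at most \<open>z\<close>.
  There are finitely many of these, so that \<open>X\<close> and \<open>Y\<close> can be chosen before the game is played.\<close>

lemma fusion:
  assumes v: "good v" and A: "\<And>n::nat. A n \<in> v"
  obtains T where "condition T" "\<And>n. \<exists>m. FUs (T \<inter> tail m) \<subseteq> A n"
proof -
  note up1 = selective_ultra[OF sel1] and up2 = selective_ultra[OF sel2]
  \<comment> \<open>The choice is made total, with default \<open>({}, S)\<close> for illegal moves,
    so that every history leads to a supply in \<open>v\<close> before any play is fixed.\<close>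
  have "\<exists>p. S \<in> v \<longrightarrow> snd p \<in> v \<and>
      (z \<in> legal v c S \<longrightarrow> fusion_step v (A (Suc n)) S n c z (fst p) (snd p))" for S n c z
  proof (cases "S \<in> v \<and> z \<in> legal v c S")
    case True
    then obtain E S' where "S' \<in> v" "fusion_step v (A (Suc n)) S n c z E S'"
      using fusion_step_exists[OF v _ A] by blast
    then show ?thesis by (intro exI[of _ "(E, S')"]) simp
  next
    case False
    then show ?thesis by (intro exI[of _ "({}, S)"]) simp
  qed
  then have "\<exists>ES. \<forall>S n c z. S \<in> v \<longrightarrow> snd (ES S n c z) \<in> v \<and>
      (z \<in> legal v c S \<longrightarrow> fusion_step v (A (Suc n)) S n c z (fst (ES S n c z)) (snd (ES S n c z)))"
    by (intro choice allI)
  then obtain ES where ES: "\<And>S n c z. S \<in> v \<Longrightarrow> snd (ES S n c z) \<in> v"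
    "\<And>S n c z. S \<in> v \<Longrightarrow> z \<in> legal v c S \<Longrightarrow>
      fusion_step v (A (Suc n)) S n c z (fst (ES S n c z)) (snd (ES S n c z))"
    by blast
  \<comment> \<open>Histories list the latest move first, and their length is the stage
    number.\<close>
  define st where "st = rec_list (A 0) (\<lambda>cz h S. snd (ES S (length h) (fst cz) (snd cz)))"
  have st_simps: "st [] = A 0" "st (cz # h) = snd (ES (st h) (length h) (fst cz) (snd cz))" for cz h
    by (simp_all add: st_def)
  have st: "st h \<in> v" for h
    by (induction h) (simp_all add: st_simps A ES(1))
  \<comment> \<open>Moves will be played in increasing order, so a play with entries up to
    \<open>z\<close> has at most \<open>Suc z\<close> of them; the length bound makes
    \<open>H z\<close> finite.\<close>
  define H where "H z = {h :: (bool \<times> nat) list. set h \<subseteq> UNIV \<times> {..z} \<and> length h \<le> Suc z}" for z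
  have finH: "finite (H z)" for z
    unfolding H_def by (rule finite_lists_length_le) simp
  define a where "a z = (\<Inter>h\<in>H z. legal v True (st h))" for z
  define b where "b z = (\<Inter>h\<in>H z. legal v False (st h))" for z
  have "a z \<in> p1" "b z \<in> p2" for z
    unfolding a_def b_def
    using legal_large[OF v st] by (auto intro!: ultra_INT[OF up1 finH] ultra_INT[OF up2 finH])
  then obtain X0 Y0 where XY0: "X0 \<in> p1" "Y0 \<in> p2" "X0 \<inter> Y0 = {}"
    "\<And>z z'. z \<in> X0 \<union> Y0 \<Longrightarrow> z' \<in> X0 \<Longrightarrow> z < z' \<Longrightarrow> z' \<in> a z"
    "\<And>z z'. z \<in> X0 \<union> Y0 \<Longrightarrow> z' \<in> Y0 \<Longrightarrow> z < z' \<Longrightarrow> z' \<in> b z"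
    using selective_pair_spread[OF sel1 sel2 noniso, of a b] by blast
  \<comment> \<open>The first move has no predecessor \<open>z\<close> whose \<open>a z\<close> or
    \<open>b z\<close> would make it legal, so its legality is imposed here.\<close>
  define X where "X = X0 \<inter> legal v True (A 0)"
  define Y where "Y = Y0 \<inter> legal v False (A 0)"
  have X: "X \<in> p1" unfolding X_def using XY0(1) legal_large(1)[OF v A] ultra_Int[OF up1] by blast
  have Y: "Y \<in> p2" unfolding Y_def using XY0(2) legal_large(2)[OF v A] ultra_Int[OF up2] by blast
  have infZ: "infinite (X \<union> Y)" using selective_infinite[OF sel1 X] by simp
  define e where "e = enumerate (X \<union> Y)"
  have e_mono: "e i < e j" if "i < j" for i j unfolding e_def using infZ that by (simp add: enumerate_mono)
  have e_range: "range e = X \<union> Y" unfolding e_def using infZ by (rule range_enumerate)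
  have e_ge: "n \<le> e n" for n unfolding e_def using infZ by (rule le_enumerate)
  define c where "c n \<longleftrightarrow> e n \<in> X" for n
  define hist where "hist = rec_nat [] (\<lambda>n h. (c n, e n) # h)"
  have hist_simps: "hist 0 = []" "hist (Suc n) = (c n, e n) # hist n" for n
    by (simp_all add: hist_def)
  have hist_len: "length (hist n) = n" for n by (induction n) (simp_all add: hist_simps)
  have hist_set: "set (hist n) \<subseteq> UNIV \<times> e ` {..<n}" for n
    by (induction n) (auto simp: hist_simps lessThan_Suc)
  have hist_H: "hist (Suc n) \<in> H (e n)" for n
  proof -
    have "e i \<le> e n" if "i < Suc n" for i
      using that e_mono[of i n] by (auto simp: less_Suc_eq)
    then have "e ` {..<Suc n} \<subseteq> {..e n}" by auto
    then have "set (hist (Suc n)) \<subseteq> UNIV \<times> {..e n}" using hist_set[of "Suc n"] by blast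
    then show ?thesis using e_ge[of n] by (simp add: H_def hist_len)
  qed
  have leg: "e n \<in> legal v (c n) (st (hist n))" for n
  proof (cases n)
    case 0
    have "e 0 \<in> X \<union> Y" using e_range by blast
    then have "e 0 \<in> legal v (e 0 \<in> X) (A 0)" by (cases "e 0 \<in> X") (auto simp: X_def Y_def)
    then show ?thesis using 0 by (simp add: hist_simps st_simps c_def)
  next
    case (Suc m)
    \<comment> \<open>The history before move \<open>n\<close> has entries up to \<open>e m\<close>,
      so it is among those over which \<open>a (e m)\<close> and \<open>b (e m)\<close> are
      intersected.\<close>
    have em: "e m \<in> X0 \<union> Y0" "e n \<in> X \<union> Y" using e_range by (auto simp: X_def Y_def)
    have lt: "e m < e n" using e_mono Suc by simp
    show ?thesis
    proof (cases "e n \<in> X")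
      case True
      then have "e n \<in> a (e m)" using XY0(4)[OF em(1) _ lt] by (simp add: X_def)
      then show ?thesis using hist_H[of m] True Suc by (auto simp: a_def c_def)
    next
      case False
      then have "e n \<in> Y0" using em(2) by (simp add: Y_def)
      then have "e n \<in> b (e m)" using XY0(5)[OF em(1) _ lt] by simp
      then show ?thesis using hist_H[of m] False Suc by (auto simp: b_def c_def)
    qed
  qed
  define S where "S n = st (hist n)" for n
  define E where "E n = fst (ES (S n) n (c n) (e n))" for n
  have S_Suc: "S (Suc n) = snd (ES (S n) n (c n) (e n))" for n
    by (simp add: S_def hist_simps st_simps hist_len)
  have step: "fusion_step v (A (Suc n)) (S n) n (c n) (e n) (E n) (S (Suc n))" for n
    unfolding E_def S_Suc using ES(2)[of "S n" "e n" "c n" n] leg[of n] st by (simp add: S_def)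
  note stepD = step[unfolded fusion_step_def]
  have E_fin: "finite (E n)" and E_FF: "E n \<subseteq> FF" and E_dis: "disjoint (E n)"
    and E_FU: "FUs (E n) \<subseteq> S n" and E_ext: "e n \<in> extremum (c n) ` E n"
    and E_block: "\<exists>j. \<exists>E'\<subseteq>E n. finite E' \<and> card E' = n \<and> (\<forall>x\<in>E'. x \<inter> B j \<noteq> {})"
    and S_dec: "S (Suc n) \<subseteq> S n \<inter> A (Suc n)"
    and S_gt: "\<forall>x\<in>E n. \<forall>y\<in>S (Suc n). Max x < Min y"
    and S_Un: "\<forall>x\<in>FUs (E n). \<forall>y\<in>S (Suc n). x \<union> y \<in> S n" for n
    using stepD[of n] by - (elim conjE, assumption)+
  have S_A: "S n \<subseteq> A n" for n
    by (cases n) (use S_dec in \<open>auto simp: S_def hist_simps st_simps\<close>)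
  have S_anti: "S j \<subseteq> S i" if "i \<le> j" for i j
    using that by (induction rule: dec_induct) (use S_dec in blast)+
  \<comment> \<open>Batches are peeled off from the front: the rest of \<open>V\<close> has its
    union in the next supply, and \<open>S_Un\<close> adds the part from batch
    \<open>n\<close>.\<close>
  have FU_S: "\<Union>V \<in> S n" if "V \<subseteq> (\<Union>j\<in>{n..<n + d}. E j)" "finite V" "V \<noteq> {}" for V n d
    using that
  proof (induction d arbitrary: n V)
    case 0
    then show ?case by simp
  next
    case (Suc d)
    let ?V0 = "V \<inter> E n" and ?V1 = "V - E n"
    have "?V1 \<subseteq> (\<Union>j\<in>{Suc n..<Suc n + d}. E j)"
    proof
      fix x assume x: "x \<in> ?V1"
      then obtain j where j: "j \<in> {n..<n + Suc d}" "x \<in> E j" using Suc.prems(1) by blast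
      then have "j \<noteq> n" using x by blast
      then show "x \<in> (\<Union>j\<in>{Suc n..<Suc n + d}. E j)" using j by auto
    qed
    then have V1: "\<Union>?V1 \<in> S (Suc n)" if "?V1 \<noteq> {}" using Suc.IH that Suc.prems(2) by blast
    have V0: "\<Union>?V0 \<in> FUs (E n)" if "?V0 \<noteq> {}" using that Suc.prems(2) by (intro FUsI) auto
    have eq: "\<Union>V = \<Union>?V0 \<union> \<Union>?V1" by blast
    show ?case
    proof (cases "?V0 = {}")
      case True
      then have "?V1 = V" by blast
      then show ?thesis using V1 Suc.prems(3) S_dec by auto
    next
      case F0: False
      show ?thesis
      proof (cases "?V1 = {}")
        case True
        then have "?V0 = V" by blast
        then show ?thesis using V0 Suc.prems(3) E_FU by auto
      next
        case False
        then show ?thesis unfolding eq using V0[OF F0] V1[OF False] S_Un by blast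
      qed
    qed
  qed
  define T where "T = (\<Union>n. E n)"
  have T_FF: "T \<subseteq> FF" using E_FF by (auto simp: T_def)
  have sep: "Max x < Min y" if "i < j" "x \<in> E i" "y \<in> E j" for i j x y
  proof -
    have "y \<in> S j" using E_FU FUs_incl that(3) by blast
    then have "y \<in> S (Suc i)" using S_anti[of "Suc i" j] that(1) by auto
    then show ?thesis using S_gt that(2) by blast
  qed
  have T_dis: "disjoint T"
    unfolding disjoint_def
  proof (intro ballI impI)
    fix x y assume xy: "x \<in> T" "y \<in> T" "x \<noteq> y"
    then obtain i j where ij: "x \<in> E i" "y \<in> E j" by (auto simp: T_def)
    have F: "x \<in> FF" "y \<in> FF" using xy T_FF by auto
    consider "i < j" | "i = j" | "j < i" by linarith
    then show "x \<inter> y = {}"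
    proof cases
      case 1
      then show ?thesis using Max_less_Min_disjoint[OF F] sep ij by blast
    next
      case 2
      then show ?thesis using E_dis[of i] ij xy(3) unfolding disjoint_def by blast
    next
      case 3
      then show ?thesis using Max_less_Min_disjoint[OF F(2,1)] sep ij by blast
    qed
  qed
  have "condition T"
    unfolding condition_def
  proof (intro conjI allI T_FF T_dis)
    have "X \<subseteq> Min ` T"
    proof
      fix z assume z: "z \<in> X"
      then obtain n where n: "z = e n" using e_range by blast
      then have "z \<in> Min ` E n" using E_ext[of n] z by (auto simp: c_def extremum_def)
      then show "z \<in> Min ` T" by (auto simp: T_def)
    qed
    then show "Min ` T \<in> p1" by (rule ultra_mono[OF up1 X])
    have "Y \<subseteq> Max ` T"
    proof
      fix z assume z: "z \<in> Y"
      then obtain n where n: "z = e n" using e_range by blast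
      have "z \<notin> X" using z XY0(3) by (auto simp: X_def Y_def)
      then have "z \<in> Max ` E n" using E_ext[of n] n by (auto simp: c_def extremum_def)
      then show "z \<in> Max ` T" by (auto simp: T_def)
    qed
    then show "Max ` T \<in> p2" by (rule ultra_mono[OF up2 Y])
    fix k
    obtain j E' where E': "E' \<subseteq> E k" "finite E' \<and> card E' = k \<and> (\<forall>x\<in>E'. x \<inter> B j \<noteq> {})"
      using E_block[of k] by blast
    have "E' \<subseteq> T" using E'(1) by (auto simp: T_def)
    then show "\<exists>n. \<exists>E\<subseteq>T. finite E \<and> card E = k \<and> (\<forall>x\<in>E. x \<inter> B n \<noteq> {})" using E'(2) by blast
  qed
  moreover have "\<exists>m. FUs (T \<inter> tail m) \<subseteq> A n" for n
  proof -
    have "finite (\<Union>j\<in>{..<n}. E j)" "(\<Union>j\<in>{..<n}. E j) \<subseteq> FF" using E_fin E_FF by auto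
    \<comment> \<open>Beyond the maxima of the first \<open>n\<close> batches only later batches
      remain.\<close>
    then obtain m where m: "\<And>x. x \<in> (\<Union>j\<in>{..<n}. E j) \<Longrightarrow> Max x \<le> m" using Max_bound by blast
    have Tm: "\<exists>j\<ge>n. x \<in> E j" if x: "x \<in> T \<inter> tail m" for x
    proof -
      obtain j where j: "x \<in> E j" using x by (auto simp: T_def)
      have "\<not> j < n"
      proof
        assume "j < n"
        then have "Max x \<le> m" using m j by blast
        moreover have "m < Min x" using x by (simp add: tail_def)
        moreover have "Min x \<le> Max x" using j E_FF FF_D by (intro Min_le Max_in) auto
        ultimately show False by simp
      qed
      then show ?thesis using j by (intro exI[of _ j]) simp
    qed
    have "FUs (T \<inter> tail m) \<subseteq> S n"
    proof
      fix w assume "w \<in> FUs (T \<inter> tail m)"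
      then obtain V where V: "V \<subseteq> T \<inter> tail m" "finite V" "V \<noteq> {}" "w = \<Union>V"
        unfolding FUs_def by blast
      have "\<forall>x\<in>V. \<exists>j. j \<ge> n \<and> x \<in> E j" using Tm V(1) by blast
      then obtain f where f: "\<forall>x\<in>V. f x \<ge> n \<and> x \<in> E (f x)" by (rule bchoice[THEN exE])
      obtain N where N: "\<And>x. x \<in> V \<Longrightarrow> f x < N"
        using finite_imageI[OF V(2), of f] by (meson finite_nat_set_iff_bounded imageI)
      have "V \<subseteq> (\<Union>j\<in>{n..<n + N}. E j)"
      proof
        fix x assume x: "x \<in> V"
        then have "f x \<in> {n..<n + N}" "x \<in> E (f x)" using f N[OF x] by auto
        then show "x \<in> (\<Union>j\<in>{n..<n + N}. E j)" by blast
      qed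
      then show "w \<in> S n" using FU_S V by blast
    qed
    then show ?thesis using S_A by blast
  qed
  ultimately show thesis using that by blast
qed

text \<open>A good \<open>v\<close> containing all \<open>FUs (T \<inter> tail m)\<close> with
  \<open>T \<in> C\<close> decides \<open>Q\<close>. Together with the winning side of
  \<open>Q\<close> these are countably many sets, and \<open>fusion\<close> yields one condition
  whose tails enter each of them.\<close>

lemma condition_extension:
  assumes C: "countable C" "C \<noteq> {}" "\<And>T. T \<in> C \<Longrightarrow> condition T"
    and chain: "\<And>T T'. T \<in> C \<Longrightarrow> T' \<in> C \<Longrightarrow> extends T T' \<or> extends T' T"
  obtains T m where "condition T" "\<And>T'. T' \<in> C \<Longrightarrow> extends T T'"
    "FUs (T \<inter> tail m) \<subseteq> Q \<or> FUs (T \<inter> tail m) \<subseteq> - Q"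
proof -
  obtain v where v: "good v" "\<And>T m. T \<in> C \<Longrightarrow> FUs (T \<inter> tail m) \<in> v"
    using good_exists[OF C(2,3) chain] by blast
  have uv: "ultra v" using v(1) unfolding good_def by blast
  obtain Q' where Q': "Q' \<in> v" "Q' = Q \<or> Q' = - Q" using ultra_Compl[OF uv, of Q] by blast
  define \<F> where "\<F> = insert Q' ((\<lambda>(T, m). FUs (T \<inter> tail m)) ` (C \<times> UNIV))"
  have cF: "countable \<F>" using C(1) by (simp add: \<F>_def)
  have Fv: "\<F> \<subseteq> v" using Q'(1) v(2) by (auto simp: \<F>_def)
  have QF: "Q' \<in> \<F>" by (simp add: \<F>_def)
  define A where "A = from_nat_into \<F>"
  have rA: "range A = \<F>" unfolding A_def using cF QF by (intro range_from_nat_into) auto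
  have "A n \<in> v" for n
    using Fv unfolding rA[symmetric] by (rule subsetD) (rule rangeI)
  then obtain T where T: "condition T" "\<And>n. \<exists>m. FUs (T \<inter> tail m) \<subseteq> A n"
    using fusion[OF v(1), of A] by blast
  have T2: "\<exists>m. FUs (T \<inter> tail m) \<subseteq> D" if D: "D \<in> \<F>" for D
  proof -
    obtain n where "D = A n" using D unfolding rA[symmetric] by blast
    then show ?thesis using T(2) by simp
  qed
  obtain m where m: "FUs (T \<inter> tail m) \<subseteq> Q'" using T2[OF QF] ..
  have "extends T T'" if "T' \<in> C" for T'
    unfolding extends_def
  proof (intro allI)
    fix k
    have "FUs (T' \<inter> tail k) \<in> \<F>" using that unfolding \<F>_def by blast
    then show "\<exists>m. FUs (T \<inter> tail m) \<subseteq> FUs (T' \<inter> tail k)" by (rule T2)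
  qed
  then show thesis using that[of T m] T(1) m Q'(2) by blast
qed

end

section \<open>The union ultrafilter\<close>

lemma FU_eq_FUs: "FU N x = FUs (x ` {i. enat i < N})"
proof
  show "FU N x \<subseteq> FUs (x ` {i. enat i < N})"
  proof
    fix w assume "w \<in> FU N x"
    then obtain v where v: "w = \<Union>(x ` v)" "finite v" "v \<noteq> {}" "\<forall>i\<in>v. enat i < N"
      unfolding FU_def by blast
    then show "w \<in> FUs (x ` {i. enat i < N})"
      unfolding v(1) by (intro FUsI) auto
  qed
  show "FUs (x ` {i. enat i < N}) \<subseteq> FU N x"
  proof
    fix w assume "w \<in> FUs (x ` {i. enat i < N})"
    then obtain V where V: "w = \<Union>V" "V \<subseteq> x ` {i. enat i < N}" "finite V" "V \<noteq> {}"
      unfolding FUs_def by blast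
    obtain v where v: "v \<subseteq> {i. enat i < N}" "finite v" "V = x ` v"
      using finite_subset_image[OF V(3,2)] by blast
    then show "w \<in> FU N x" unfolding FU_def using V(1,4) by blast
  qed
qed

lemma FU_infinity: "FU \<infinity> x = FUs (range x)"
  by (simp add: FU_eq_FUs)

lemma disjoint_seq_enumeration:
  assumes "R \<subseteq> FF" "disjoint R" "infinite R"
  obtains x where "disjoint_seq \<infinity> x" "range x = R" "inj x"
proof -
  have "countable FF" by (rule countable_subset[OF _ countable_Collect_finite]) (auto simp: FF_def)
  then have "bij_betw (from_nat_into R) UNIV R"
    using assms(1,3) countable_subset bij_betw_from_nat_into by blast
  then have R: "range (from_nat_into R) = R" "inj (from_nat_into R)" by (auto simp: bij_betw_def)
  have "from_nat_into R i \<inter> from_nat_into R j = {}" if "i \<noteq> j" for i j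
  proof -
    have "from_nat_into R i \<noteq> from_nat_into R j" using R(2) that by (auto dest: injD)
    moreover have "from_nat_into R i \<in> R" "from_nat_into R j \<in> R" using R(1) by blast+
    ultimately show ?thesis using assms(2) unfolding disjoint_def by blast
  qed
  moreover have "from_nat_into R i \<in> FF" for i using R(1) assms(1) by blast
  ultimately have "disjoint_seq \<infinity> (from_nat_into R)"
    by (simp add: disjoint_seq_def disjoint_family_on_def)
  then show thesis using that R by blast
qed

context selective_pair
begin

lemma condition_infinite_tail: "condition T \<Longrightarrow> infinite (T \<inter> tail m)"
  using condition_Min_tail[of T m] selective_infinite[OF sel1] by blast

text \<open>The tower below \<open>S\<close> decides every subset of \<open>FF\<close>. Its
  countable directedness gives stability: countably many members of \<open>u\<close> are witnessed
  by conditions of the tower that have a common lower bound in the tower.\<close>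

lemma union_ultrafilter_exists:
  assumes ch: continuum_hypothesis and S: "condition S"
  obtains u where "stable_union_ultrafilter u" "min_uf u = p1" "max_uf u = p2" "FUs S \<in> u"
    "\<And>A. A \<in> u \<Longrightarrow> \<exists>T m. condition T \<and> FUs (T \<inter> tail m) \<subseteq> A"
proof -
  note up1 = selective_ultra[OF sel1] and up2 = selective_ultra[OF sel2]
  \<comment> \<open>\<open>set_encode\<close> turns the sets of naturals that index the tasks into
    subsets of \<open>FF\<close>.\<close>
  define Q where "Q i = {x. set_encode x \<in> i}" for i
  have Q_surj: "\<exists>i. A = Q i \<inter> FF" if "A \<subseteq> FF" for A
  proof
    show "A = Q (set_encode ` A) \<inter> FF"
    proof (intro set_eqI iffI)
      fix x assume "x \<in> Q (set_encode ` A) \<inter> FF"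
      then obtain y where y: "y \<in> A" "set_encode x = set_encode y" "x \<in> FF" by (auto simp: Q_def)
      then have "finite x" "finite y" using that FF_D(1) by auto
      then have "x = y" using set_encode_eq y(2) by simp
      then show "x \<in> A" using y by simp
    qed (use that in \<open>auto simp: Q_def\<close>)
  qed
  have ext_refl: "extends T T" for T unfolding extends_def by blast
  define P where "P = {T. condition T \<and> extends T S}"
  define D where "D i = {T. \<exists>m. FUs (T \<inter> tail m) \<subseteq> Q i \<or> FUs (T \<inter> tail m) \<subseteq> - Q i}" for i
  obtain G where G: "G \<subseteq> P" "\<And>T T'. T \<in> G \<Longrightarrow> T' \<in> G \<Longrightarrow> extends T T' \<or> extends T' T"
    "\<And>i. \<exists>T\<in>G. T \<in> D i" "\<And>C. countable C \<Longrightarrow> C \<subseteq> G \<Longrightarrow> \<exists>T\<in>G. \<forall>T'\<in>C. extends T T'"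
  proof (rule tower_exists[OF ch, of P extends D])
    fix C i assume C: "countable C" "C \<subseteq> P" "\<forall>T\<in>C. \<forall>T'\<in>C. extends T T' \<or> extends T' T"
    obtain T m where T: "condition T" "\<And>T'. T' \<in> insert S C \<Longrightarrow> extends T T'"
      "FUs (T \<inter> tail m) \<subseteq> Q i \<or> FUs (T \<inter> tail m) \<subseteq> - Q i"
    \<comment> \<open>Inserting \<open>S\<close> keeps the new condition below \<open>S\<close> and
      makes the family nonempty at the first stage.\<close>
    proof (rule condition_extension[of "insert S C" "Q i"])
      show "countable (insert S C)" using C(1) by simp
      show "condition T" if "T \<in> insert S C" for T using that C(2) S by (auto simp: P_def)
      show "extends T T' \<or> extends T' T" if "T \<in> insert S C" "T' \<in> insert S C" for T T'
        using that C(2,3) ext_refl by (auto simp: P_def)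
    qed simp_all
    have "T \<in> P \<inter> D i" using T(1,3) T(2)[of S] by (auto simp: P_def D_def)
    then show "\<exists>T\<in>P \<inter> D i. \<forall>T'\<in>C. extends T T'" using T(2) by blast
  qed (use ext_refl in simp_all)
  have GC: "condition T" if "T \<in> G" for T using G(1) that by (auto simp: P_def)
  obtain T0 where T0: "T0 \<in> G" using G(3) by blast
  define u where "u = {A. A \<subseteq> FF \<and> (\<exists>T\<in>G. \<exists>m. FUs (T \<inter> tail m) \<subseteq> A)}"
  have uI: "A \<in> u" if "T \<in> G" "FUs (T \<inter> tail m) \<subseteq> A" "A \<subseteq> FF" for A T m
    unfolding u_def using that by blast
  have uE: "\<exists>T\<in>G. \<exists>m. FUs (T \<inter> tail m) \<subseteq> A" if "A \<in> u" for A
    using that unfolding u_def by simp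
  have tF: "FUs (T \<inter> tail m) \<subseteq> FF" for T m using FUs_tail tail_FF by blast
  have u_Int: "A \<inter> A' \<in> u" if A: "A \<in> u" "A' \<in> u" for A A'
  proof -
    obtain T m where T: "T \<in> G" "FUs (T \<inter> tail m) \<subseteq> A" using uE[OF A(1)] by blast
    obtain T' m' where T': "T' \<in> G" "FUs (T' \<inter> tail m') \<subseteq> A'" using uE[OF A(2)] by blast
    have AF: "A \<inter> A' \<subseteq> FF" using A by (auto simp: u_def)
    have mono: "FUs (R \<inter> tail (max i j)) \<subseteq> FUs (R \<inter> tail i)"
      "FUs (R \<inter> tail (max i j)) \<subseteq> FUs (R \<inter> tail j)" for R i j
      by (intro FUs_mono Int_mono tail_mono; simp)+
    from G(2)[OF T(1) T'(1)] show ?thesis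
    proof
      assume "extends T T'"
      then obtain k where k: "FUs (T \<inter> tail k) \<subseteq> FUs (T' \<inter> tail m')"
        unfolding extends_def by blast
      have "FUs (T \<inter> tail (max k m)) \<subseteq> A \<inter> A'" using mono[of T k m] k T(2) T'(2) by blast
      then show ?thesis using uI[OF T(1)] AF by blast
    next
      assume "extends T' T"
      then obtain k where k: "FUs (T' \<inter> tail k) \<subseteq> FUs (T \<inter> tail m)"
        unfolding extends_def by blast
      have "FUs (T' \<inter> tail (max k m')) \<subseteq> A \<inter> A'" using mono[of T' k m'] k T(2) T'(2) by blast
      then show ?thesis using uI[OF T'(1)] AF by blast
    qed
  qed
  have u_empty: "{} \<notin> u"
  proof
    assume "{} \<in> u"
    then obtain T m where T: "T \<in> G" "FUs (T \<inter> tail m) = {}" using uE by blast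
    then have "T \<inter> tail m = {}" using FUs_incl by blast
    then show False using condition_infinite_tail[OF GC[OF T(1)]] by (metis finite.emptyI)
  qed
  have u_ultra: "A \<in> u \<or> FF - A \<in> u" if A: "A \<subseteq> FF" for A
  proof -
    obtain i where i: "A = Q i \<inter> FF" using Q_surj[OF A] ..
    obtain T m where T: "T \<in> G" "FUs (T \<inter> tail m) \<subseteq> Q i \<or> FUs (T \<inter> tail m) \<subseteq> - Q i"
      using G(3)[of i] by (auto simp: D_def)
    then have "FUs (T \<inter> tail m) \<subseteq> A \<or> FUs (T \<inter> tail m) \<subseteq> FF - A" using tF[of T m] i by blast
    then show ?thesis using uI[OF T(1)] A by blast
  qed
  have uf: "ultrafilter_on FF u"
    unfolding ultrafilter_on_def
  proof (intro conjI ballI allI impI)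
    show "FF \<in> u" using uI[OF T0 tF] by simp
    show "C \<in> u" if C: "A \<in> u" "A \<subseteq> C \<and> C \<subseteq> FF" for A C
    proof -
      obtain T m where "T \<in> G" "FUs (T \<inter> tail m) \<subseteq> A" using uE[OF C(1)] by blast
      then show ?thesis using uI[of T m C] C(2) by blast
    qed
  qed (use u_Int u_empty u_ultra in \<open>auto simp: u_def\<close>)
  have FU_u: "FUs T \<in> u" if "T \<in> G" for T
    using uI[OF that, of 0 "FUs T"] FUs_mono[of "T \<inter> tail 0" T] FUs_FF[OF conditionD(1)[OF GC[OF that]]]
    by blast
  have union: "union_ultrafilter u"
    unfolding union_ultrafilter_def
  proof (intro conjI uf ballI)
    fix A assume "A \<in> u"
    then obtain T m where T: "T \<in> G" "FUs (T \<inter> tail m) \<subseteq> A" using uE by blast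
    have "T \<inter> tail m \<subseteq> FF" using tail_FF by blast
    moreover have "disjoint (T \<inter> tail m)"
      using conditionD(2)[OF GC[OF T(1)]] by (rule pairwise_subset) blast
    ultimately obtain x where x: "disjoint_seq \<infinity> x" "range x = T \<inter> tail m"
      using disjoint_seq_enumeration condition_infinite_tail[OF GC[OF T(1)]] by metis
    have "FU \<infinity> x = FUs (T \<inter> tail m)" by (simp add: FU_infinity x(2))
    then show "\<exists>x. disjoint_seq \<infinity> x \<and> FU \<infinity> x \<in> u \<and> FU \<infinity> x \<subseteq> A"
      using x(1) T(2) uI[OF T(1) order_refl tF] by (intro exI[of _ x]) simp
  qed
  have stable: "stable_union_ultrafilter u"
    unfolding stable_union_ultrafilter_def
  proof (intro conjI union allI impI)
    fix N :: "nat \<Rightarrow> enat" and s :: "nat \<Rightarrow> nat \<Rightarrow> nat set"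
    assume s: "\<forall>\<alpha>. disjoint_seq (N \<alpha>) (s \<alpha>) \<and> FU (N \<alpha>) (s \<alpha>) \<in> u"
    have "\<exists>T m. T \<in> G \<and> FUs (T \<inter> tail m) \<subseteq> FU (N \<alpha>) (s \<alpha>)" for \<alpha>
      using uE s by blast
    then obtain T m where T: "\<And>\<alpha>. T \<alpha> \<in> G" "\<And>\<alpha>. FUs (T \<alpha> \<inter> tail (m \<alpha>)) \<subseteq> FU (N \<alpha>) (s \<alpha>)"
      by metis
    have "countable (range T)" "range T \<subseteq> G" using T(1) by auto
    then have "\<exists>g\<in>G. \<forall>T'\<in>range T. extends g T'" by (rule G(4))
    then obtain g where g: "g \<in> G" "\<forall>T'\<in>range T. extends g T'" by (rule bexE)
    have ginf: "infinite g" using condition_infinite_tail[OF GC[OF g(1)]] finite_Int by blast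
    obtain t where t: "disjoint_seq \<infinity> t" "range t = g" "inj t"
      using disjoint_seq_enumeration[OF conditionD(1,2)[OF GC[OF g(1)]] ginf] .
    have "almost_condensation \<infinity> t (N \<alpha>) (s \<alpha>)" for \<alpha>
    proof -
      obtain k where k: "FUs (g \<inter> tail k) \<subseteq> FUs (T \<alpha> \<inter> tail (m \<alpha>))"
        using g(2)[THEN bspec, OF rangeI, of \<alpha>] unfolding extends_def by blast
      \<comment> \<open>The enumeration \<open>t\<close> follows no particular order, but only
        finitely many of its values lie outside \<open>tail k\<close>.\<close>
      have "finite (t -` (g - tail k))"
        using condition_finite_Diff_tail[OF GC[OF g(1)]] t(3) by (rule finite_vimageI)
      then obtain M where M: "\<And>i. i \<in> t -` (g - tail k) \<Longrightarrow> i < M"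
        by (meson finite_nat_set_iff_bounded)
      have "t (M + i) \<in> g \<inter> tail k" for i
        using M[of "M + i"] t(2) by auto
      then have "FUs (range (\<lambda>i. t (M + i))) \<subseteq> FUs (g \<inter> tail k)" by (intro FUs_mono) blast
      then have "condensation (\<infinity> - enat M) (\<lambda>i. t (M + i)) (N \<alpha>) (s \<alpha>)"
        using k T(2)[of \<alpha>] by (simp add: condensation_def FU_infinity)
      then show ?thesis unfolding almost_condensation_def ..
    qed
    moreover have "FU \<infinity> t \<in> u" using FU_u[OF g(1)] by (simp add: FU_infinity t(2))
    ultimately show "\<exists>M t. disjoint_seq M t \<and> FU M t \<in> u \<and> (\<forall>\<alpha>. almost_condensation M t (N \<alpha>) (s \<alpha>))"
      using t(1) by blast
  qed
  have contra: False if "A \<in> u" "A' \<in> u" "A \<inter> A' = {}" for A A'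
    using u_Int[OF that(1,2)] u_empty that(3) by simp
  \<comment> \<open>Otherwise a tail of some condition would avoid minima in \<open>a\<close>,
    although its minima form a set in \<open>p1\<close>.\<close>
  have min_in: "{x \<in> FF. Min x \<in> a} \<in> u" if a: "a \<in> p1" for a
  proof (rule ccontr)
    assume "{x \<in> FF. Min x \<in> a} \<notin> u"
    then have "FF - {x \<in> FF. Min x \<in> a} \<in> u" using u_ultra[of "{x \<in> FF. Min x \<in> a}"] by blast
    then obtain T m where T: "T \<in> G" "FUs (T \<inter> tail m) \<subseteq> FF - {x \<in> FF. Min x \<in> a}" using uE by blast
    have "{x \<in> T \<inter> tail m. Min x \<in> a} \<noteq> {}"
      using condition_infinite_Min[OF GC[OF T(1)] a, of m] by (metis finite.emptyI)
    then obtain x where x: "x \<in> T \<inter> tail m" "Min x \<in> a" by blast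
    then have "x \<in> FF - {x \<in> FF. Min x \<in> a}" using T(2) FUs_incl by blast
    then show False using x by simp
  qed
  have max_in: "{x \<in> FF. Max x \<in> b} \<in> u" if b: "b \<in> p2" for b
  proof (rule ccontr)
    assume "{x \<in> FF. Max x \<in> b} \<notin> u"
    then have "FF - {x \<in> FF. Max x \<in> b} \<in> u" using u_ultra[of "{x \<in> FF. Max x \<in> b}"] by blast
    then obtain T m where T: "T \<in> G" "FUs (T \<inter> tail m) \<subseteq> FF - {x \<in> FF. Max x \<in> b}" using uE by blast
    have "{x \<in> T \<inter> tail m. Max x \<in> b} \<noteq> {}"
      using condition_infinite_Max[OF GC[OF T(1)] b, of m] by (metis finite.emptyI)
    then obtain x where x: "x \<in> T \<inter> tail m" "Max x \<in> b" by blast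
    then have "x \<in> FF - {x \<in> FF. Max x \<in> b}" using T(2) FUs_incl by blast
    then show False using x by simp
  qed
  have "a \<in> p1" if "a \<in> min_uf u" for a
  proof (rule ccontr)
    assume "a \<notin> p1"
    then have "{x \<in> FF. Min x \<in> - a} \<in> u" using min_in ultra_Compl[OF up1] by blast
    then show False using contra[of "{x \<in> FF. Min x \<in> a}"] that by (auto simp: min_uf_def)
  qed
  then have min: "min_uf u = p1" using min_in by (auto simp: min_uf_def)
  have "b \<in> p2" if "b \<in> max_uf u" for b
  proof (rule ccontr)
    assume "b \<notin> p2"
    then have "{x \<in> FF. Max x \<in> - b} \<in> u" using max_in ultra_Compl[OF up2] by blast
    then show False using contra[of "{x \<in> FF. Max x \<in> b}"] that by (auto simp: max_uf_def)
  qed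
  then have max: "max_uf u = p2" using max_in by (auto simp: max_uf_def)
  have "extends T0 S" using G(1) T0 by (auto simp: P_def)
  then obtain m where "FUs (T0 \<inter> tail m) \<subseteq> FUs (S \<inter> tail 0)" unfolding extends_def by blast
  then have "FUs S \<in> u"
    using uI[OF T0, of m "FUs S"] FUs_mono[of "S \<inter> tail 0" S] FUs_FF[OF conditionD(1)[OF S]] by blast
  moreover have "\<exists>T m. condition T \<and> FUs (T \<inter> tail m) \<subseteq> A" if "A \<in> u" for A
    using uE[OF that] GC by blast
  ultimately show thesis using that stable min max by blast
qed

end

section \<open>The interleaved blocks and the failure of ordered condensations\<close>

lemma square_block_unique:
  fixes n m :: nat
  assumes "n * n \<le> j" "j < n * n + 2 * n" "m * m \<le> j" "j < m * m + 2 * m"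
  shows "n = m"
proof -
  have "\<not> n < m" if "m * m \<le> j" "j < n * n + 2 * n" for n m :: nat
  proof
    assume "n < m"
    then have "Suc n * Suc n \<le> m * m" by (intro mult_le_mono) simp_all
    then show False using that by simp
  qed
  then show ?thesis using assms by (meson linorder_neqE_nat)
qed

text \<open>Each ultrafilter contains at most one of three disjoint infinite sets, so two
  ultrafilters leave one of them over.\<close>

lemma small_infinite_set:
  assumes p1: "ultra (p1 :: nat set set)" and p2: "ultra p2"
  obtains D where "infinite D" "D \<notin> p1" "D \<notin> p2"
proof -
  obtain A A' :: "nat set" where A: "UNIV = A \<union> A'" "A \<inter> A' = {}" "infinite A" "infinite A'"
    using infinite_split[OF infinite_UNIV_nat] .
  obtain B C where B: "A' = B \<union> C" "B \<inter> C = {}" "infinite B" "infinite C"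
    using infinite_split[OF A(4)] .
  have dis: "\<not> (X \<in> p \<and> Y \<in> p)" if "ultra p" "X \<inter> Y = {}" for X Y and p :: "nat set set"
    using that ultra_Int ultra_nonempty by metis
  have "A \<inter> B = {}" "A \<inter> C = {}" using A(2) B(1) by auto
  then have "(A \<notin> p1 \<and> A \<notin> p2) \<or> (B \<notin> p1 \<and> B \<notin> p2) \<or> (C \<notin> p1 \<and> C \<notin> p2)"
    using dis[OF p1] dis[OF p2] B(2) by meson
  then show thesis using that A(3) B(3,4) by blast
qed

lemma unordered_union_ultrafilter_exists:
  assumes ch: continuum_hypothesis
    and p1: "selective p1" and p2: "selective p2" and iso: "\<not> isomorphic_uf p1 p2"
  obtains u where "stable_union_ultrafilter u" "min_uf u = p1" "max_uf u = p2"
    "\<exists>N s. disjoint_seq N s \<and> FU N s \<in> u \<and>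
      (\<forall>M t. ordered_seq M t \<and> condensation M t N s \<longrightarrow> FU M t \<notin> u)"
proof -
  note up1 = selective_ultra[OF p1] and up2 = selective_ultra[OF p2]
  obtain D where D: "infinite D" "D \<notin> p1" "D \<notin> p2" using small_infinite_set[OF up1 up2] .
  have CD: "- D \<in> p1" "- D \<in> p2" using D ultra_Compl up1 up2 by auto
  define d where "d = enumerate D"
  have d_less: "d i < d j \<longleftrightarrow> i < j" for i j unfolding d_def using D(1) by (simp add: enumerate_mono_iff)
  have d_inj: "d i = d j \<longleftrightarrow> i = j" for i j using d_less by (metis less_irrefl linorder_neqE_nat)
  have d_D: "d i \<in> D" for i unfolding d_def using D(1) by (rule enumerate_in_set)
  \<comment> \<open>The block occupies \<open>2 * n\<close> places from \<open>n * n\<close> on, and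
    the next one starts at \<open>n * n + 2 * n + 1\<close>, so blocks are disjoint.\<close>
  define B where "B n = d ` {n * n..<n * n + 2 * n}" for n :: nat
  \<comment> \<open>One element in each half of the block: every pair starts before every pair of
    the same block ends.\<close>
  define pr where "pr n i = {d (n * n + i), d (n * n + n + i)}" for n i :: nat
  define S where "S = (\<lambda>z. {z}) ` (- D) \<union> {pr n i | n i. i < n}"
  have pr_B: "pr n i \<subseteq> B n" if "i < n" for n i
    using that unfolding pr_def B_def by auto
  have B_dis: "n = m" if z: "z \<in> B n" "z \<in> B m" for n m z
  proof -
    obtain j where j: "z = d j" "n * n \<le> j" "j < n * n + 2 * n" using z(1) by (auto simp: B_def)
    then have "m * m \<le> j" "j < m * m + 2 * m" using z(2) by (auto simp: B_def d_inj)
    then show ?thesis using square_block_unique j(2,3) by blast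
  qed
  have B_D: "B n \<subseteq> D" for n using d_D by (auto simp: B_def)
  have pr_dis: "n = m \<and> i = j" if "i < n" "j < m" "z \<in> pr n i" "z \<in> pr m j" for n m i j z
  proof -
    have "n = m" using B_dis[of z n m] that pr_B by blast
    then show ?thesis using that by (auto simp: pr_def d_inj)
  qed
  interpret selective_pair p1 p2 B by unfold_locales (fact p1 p2 iso)+
  have S_FF: "S \<subseteq> FF" by (auto simp: S_def FF_def pr_def)
  have S_dis: "disjoint S"
    unfolding disjoint_def
  proof (intro ballI impI, rule ccontr)
    fix x y assume xy: "x \<in> S" "y \<in> S" "x \<noteq> y" "x \<inter> y \<noteq> {}"
    then obtain z where z: "z \<in> x" "z \<in> y" by blast
    have cases: "(w = {z} \<and> z \<notin> D) \<or> (z \<in> D \<and> (\<exists>n i. i < n \<and> w = pr n i))" if "w \<in> S" "z \<in> w" for w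
      using that pr_B B_D unfolding S_def by blast
    show False using cases[OF xy(1) z(1)] cases[OF xy(2) z(2)] z xy(3) pr_dis by blast
  qed
  have S_cond: "condition S"
    unfolding condition_def
  proof (intro conjI allI S_FF S_dis)
    \<comment> \<open>The singletons alone provide the minima and maxima, since \<open>- D\<close>
      belongs to both ultrafilters.\<close>
    have "z = Min {z}" "z = Max {z}" for z :: nat by simp_all
    then have "- D \<subseteq> Min ` S" "- D \<subseteq> Max ` S" unfolding S_def by blast+
    then show "Min ` S \<in> p1" "Max ` S \<in> p2" using CD ultra_mono up1 up2 by blast+
    fix k
    have inj: "inj_on (pr k) {..<k}"
      by (rule inj_onI) (use pr_dis[of _ k _ k] in \<open>fastforce simp: pr_def\<close>)
    show "\<exists>n. \<exists>E\<subseteq>S. finite E \<and> card E = k \<and> (\<forall>x\<in>E. x \<inter> B n \<noteq> {})"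
    proof (intro exI[of _ k] exI[of _ "pr k ` {..<k}"] conjI)
      show "pr k ` {..<k} \<subseteq> S" by (auto simp: S_def)
      show "card (pr k ` {..<k}) = k" using inj by (simp add: card_image)
      show "\<forall>x\<in>pr k ` {..<k}. x \<inter> B k \<noteq> {}"
        using pr_B unfolding pr_def by blast
    qed simp
  qed
  obtain u where u: "stable_union_ultrafilter u" "min_uf u = p1" "max_uf u = p2" "FUs S \<in> u"
    "\<And>A. A \<in> u \<Longrightarrow> \<exists>T m. condition T \<and> FUs (T \<inter> tail m) \<subseteq> A"
    using union_ultrafilter_exists[OF ch S_cond] by blast
  have S_inf: "infinite S" using condition_infinite_tail[OF S_cond] finite_Int by blast
  obtain s where s: "disjoint_seq \<infinity> s" "range s = S"
    using disjoint_seq_enumeration[OF S_FF S_dis S_inf] by metis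
  have FU_s: "FU \<infinity> s = FUs S" by (simp add: FU_infinity s(2))
  \<comment> \<open>The only members of \<open>S\<close> touching the block are its pairs, so a
    finite union that meets the block swallows a whole pair.\<close>
  have meets: "\<exists>i<n. pr n i \<subseteq> x" if x: "x \<in> FUs S" "x \<inter> B n \<noteq> {}" for x n
  proof -
    obtain z where z: "z \<in> x" "z \<in> B n" using x(2) by blast
    obtain y where y: "y \<in> S" "z \<in> y" "y \<subseteq> x" using x(1) z(1) unfolding FUs_def by blast
    have "z \<in> D" using z(2) B_D by blast
    then obtain m i where mi: "i < m" "y = pr m i" using y(1,2) unfolding S_def by blast
    then have "m = n" using B_dis[of z m n] pr_B[OF mi(1)] y(2) z(2) by blast
    then show ?thesis using mi y(3) by blast
  qed
  have "FU M t \<notin> u" if t: "ordered_seq M t" "condensation M t \<infinity> s" for M t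
  proof
    assume "FU M t \<in> u"
    then obtain T m where T: "condition T" "FUs (T \<inter> tail m) \<subseteq> FU M t" using u(5) by blast
    \<comment> \<open>Two sets in one block suffice; being disjoint, they involve different members
      of \<open>t\<close>.\<close>
    obtain n E where E: "E \<subseteq> T \<inter> tail m" "finite E" "card E = 2" "\<forall>x\<in>E. x \<inter> B n \<noteq> {}"
      using condition_block_tail[OF T(1)] by metis
    obtain x y where xy: "E = {x, y}" "x \<noteq> y" using E(3) by (auto simp: card_2_iff)
    have xyT: "x \<in> T" "y \<in> T" using xy E(1) by auto
    have dis: "x \<inter> y = {}" using conditionD(2)[OF T(1)] xyT xy(2) unfolding disjoint_def by blast
    have "E \<subseteq> FU M t" using T(2) E(1) FUs_incl by blast
    then have xyF: "x \<in> FU M t" "y \<in> FU M t" using xy(1) by simp_all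
    have ex: "\<exists>i. enat i < M \<and> t i \<subseteq> w \<and> t i \<inter> B n \<noteq> {}" if "w \<in> FU M t" "w \<inter> B n \<noteq> {}" for w
      using that unfolding FU_def by blast
    obtain i where i: "enat i < M" "t i \<subseteq> x" "t i \<inter> B n \<noteq> {}" using ex[OF xyF(1)] E(4) xy by blast
    obtain j where j: "enat j < M" "t j \<subseteq> y" "t j \<inter> B n \<noteq> {}" using ex[OF xyF(2)] E(4) xy by blast
    have "i \<noteq> j" using dis i j by blast
    \<comment> \<open>Each of the two members of \<open>t\<close> contains a pair of block
      \<open>n\<close>, and \<open>before\<close> would put the end of one pair below the start of
      the other.\<close>
    have no: False if ij: "i < j" "enat i < M" "enat j < M" "t i \<inter> B n \<noteq> {}" "t j \<inter> B n \<noteq> {}" for i j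
    proof -
      have tS: "t k \<in> FUs S" if "enat k < M" for k
      proof -
        have "t k \<in> FU M t" unfolding FU_eq_FUs by (rule FUs_incl) (use that in auto)
        then show ?thesis using t(2) FU_s by (auto simp: condensation_def)
      qed
      obtain a where a: "a < n" "pr n a \<subseteq> t i" using meets[OF tS[OF ij(2)] ij(4)] by blast
      obtain b where b: "b < n" "pr n b \<subseteq> t j" using meets[OF tS[OF ij(3)] ij(5)] by blast
      have fin: "finite (t i)" "finite (t j)" using t(1) ij(2,3) FF_D unfolding ordered_seq_def by auto
      have "d (n * n + n + a) \<le> Max (t i)" using a(2) fin(1) by (intro Max_ge) (auto simp: pr_def)
      also have "Max (t i) < Min (t j)" using t(1) ij(1,3) unfolding ordered_seq_def before_def by blast
      also have "Min (t j) \<le> d (n * n + b)" using b(2) fin(2) by (intro Min_le) (auto simp: pr_def)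
      finally show False using b(1) by (simp add: d_less)
    qed
    show False using no[of i j] no[of j i] i j \<open>i \<noteq> j\<close> by (metis linorder_neqE_nat)
  qed
  then have "\<exists>N s. disjoint_seq N s \<and> FU N s \<in> u \<and>
      (\<forall>M t. ordered_seq M t \<and> condensation M t N s \<longrightarrow> FU M t \<notin> u)"
    using s(1) u(4) FU_s by (intro exI[of _ \<infinity>] exI[of _ s]) simp
  then show thesis by (rule that[OF u(1-3)])
qed

theorem mainTheorem4:
  assumes "continuum_hypothesis"
  shows
    "(\<exists>u. stable_union_ultrafilter u \<and> selective (min_uf u) \<and> selective (max_uf u) \<and>
        (\<exists>N s. disjoint_seq N s \<and> FU N s \<in> u \<and>
          (\<forall>M t. ordered_seq M t \<and> condensation M t N s \<longrightarrow> FU M t \<notin> u))) \<and>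
     (\<forall>p1 p2. selective p1 \<and> selective p2 \<and> \<not> isomorphic_uf p1 p2 \<longrightarrow>
        (\<exists>u. stable_union_ultrafilter u \<and> selective (min_uf u) \<and> selective (max_uf u) \<and>
          (\<exists>N s. disjoint_seq N s \<and> FU N s \<in> u \<and>
            (\<forall>M t. ordered_seq M t \<and> condensation M t N s \<longrightarrow> FU M t \<notin> u)) \<and>
          min_uf u = p1 \<and> max_uf u = p2))"
proof (intro conjI allI impI)
  obtain p1 p2 where p: "selective p1" "selective p2" "\<not> isomorphic_uf p1 p2"
    using nonisomorphic_selective_exist[OF assms] .
  obtain u where u: "stable_union_ultrafilter u" "min_uf u = p1" "max_uf u = p2"
    "\<exists>N s. disjoint_seq N s \<and> FU N s \<in> u \<and>
      (\<forall>M t. ordered_seq M t \<and> condensation M t N s \<longrightarrow> FU M t \<notin> u)"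
    using unordered_union_ultrafilter_exists[OF assms p] .
  show "\<exists>u. stable_union_ultrafilter u \<and> selective (min_uf u) \<and> selective (max_uf u) \<and>
      (\<exists>N s. disjoint_seq N s \<and> FU N s \<in> u \<and>
        (\<forall>M t. ordered_seq M t \<and> condensation M t N s \<longrightarrow> FU M t \<notin> u))"
    by (rule exI[of _ u]) (intro conjI u; simp only: u p)
next
  fix p1 p2 assume p: "selective p1 \<and> selective p2 \<and> \<not> isomorphic_uf p1 p2"
  then have sel: "selective p1" "selective p2" and iso: "\<not> isomorphic_uf p1 p2" by simp_all
  obtain u where u: "stable_union_ultrafilter u" "min_uf u = p1" "max_uf u = p2"
    "\<exists>N s. disjoint_seq N s \<and> FU N s \<in> u \<and>
      (\<forall>M t. ordered_seq M t \<and> condensation M t N s \<longrightarrow> FU M t \<notin> u)"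
    using unordered_union_ultrafilter_exists[OF assms sel iso] .
  show "\<exists>u. stable_union_ultrafilter u \<and> selective (min_uf u) \<and> selective (max_uf u) \<and>
      (\<exists>N s. disjoint_seq N s \<and> FU N s \<in> u \<and>
        (\<forall>M t. ordered_seq M t \<and> condensation M t N s \<longrightarrow> FU M t \<notin> u)) \<and>
      min_uf u = p1 \<and> max_uf u = p2"
    by (rule exI[of _ u]) (intro conjI u; simp only: u sel)
qed

end
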